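(* Let $(X,\mu)$ be a probability space, let $T$ be an ergodic additive action on $(X,\mu)$ and let $S$ be a pretentiously ergodic finitely generated multiplicative action on $(X,\mu)$. If $T$ is totally ergodic, or $S$ is aperiodic, then $T$ and $S$ are jointly ergodic.
   Context: $\mathbb{N}=\{1,2,\dots\}$ and $\mathbb{P}$ is the set of primes. Every probability space $(X,\mu)$ is assumed regular: $X$ is a compact metric space with its Borel $\sigma$-algebra. An additive action $T$ on $(X,\mu)$ is the action $(T^n)_{n\in\mathbb{N}}$ of an invertible measure-preserving transformation $T$; $T^nF=F\circ T^n$. $T$ is totally ergodic if $T^k$ is ergodic for all $k\in\mathbb{N}$. A multiplicative action on $(X,\mu)$ is a sequence $S=(S_n)_{n\in\mathbb{N}}$ of commuting invertible measure-preserving transformations of $(X,\mu)$ with $S_{nm}=S_n\circ S_m$ for all $n,m\in\mathbb{N}$; it is finitely generated if $\{S_p:p\in\mathbb{P}\}$ is finite; $S_nF=F\circ S_n$. It is pretentiously ergodic if every measurable $A\subseteq X$ with $\sum_{p\in\mathbb{P}}\frac{\|S_p\mathbf{1}_A-\mathbf{1}_A\|_2^2}{p}<\infty$ satisfies $\mu(A)\in\{0,1\}$. It is aperiodic if for any $F\in L^2(X)$ and $r,q\in\mathbb{N}$, $\lim_{N\to\infty}\frac1N\sum_{n=1}^N S_{qn+r}F=\int_XF\,d\mu$ in $L^2(X)$. No commutation between $T$ and $S$ is assumed. $T$ and $S$ are jointly ergodic if for all $F,G\in L^\infty(X)$, $\lim_{N\to\infty}\frac1N\sum_{n=1}^N T^nF\cdot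 S_nG=\int_X F\,d\mu\int_X G\,d\mu$ in $L^2(X)$. *)

theory Defs
  imports "HOL-Probability.Probability" "HOL-Computational_Algebra.Primes"
begin

section \<open>Function spaces\<close>

text \<open>Elements of the Lebesgue spaces are represented by complex-valued functions, not by
  almost-everywhere classes.\<close>

definition L2_fun :: "'a measure \<Rightarrow> ('a \<Rightarrow> complex) \<Rightarrow> bool" where
  "L2_fun M F \<longleftrightarrow> F \<in> borel_measurable M \<and> integrable M (\<lambda>x. (norm (F x))\<^sup>2)"

definition Linf_fun :: "'a measure \<Rightarrow> ('a \<Rightarrow> complex) \<Rightarrow> bool" where
  "Linf_fun M F \<longleftrightarrow> F \<in> borel_measurable M \<and> (\<exists>C. AE x in M. norm (F x) \<le> C)"

text \<open>The Bochner integral of a non-integrable function is 0, so this is the \<open>L\<^sup>2\<close> norm only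
  for functions satisfying \<^const>\<open>L2_fun\<close>. All uses below are of this kind.\<close>

definition L2_norm :: "'a measure \<Rightarrow> ('a \<Rightarrow> complex) \<Rightarrow> real" where
  "L2_norm M F = sqrt (\<integral>x. (norm (F x))\<^sup>2 \<partial>M)"

definition tendsto_L2 :: "'a measure \<Rightarrow> (nat \<Rightarrow> 'a \<Rightarrow> complex) \<Rightarrow> ('a \<Rightarrow> complex) \<Rightarrow> bool" where
  "tendsto_L2 M f g \<longleftrightarrow> (\<lambda>N. L2_norm M (\<lambda>x. f N x - g x)) \<longlonglongrightarrow> 0"

section \<open>Actions\<close>

text \<open>The compact metric space is the subset \<open>space M\<close> of a metric type, with the induced metric.
  Transformations are functions on the whole type of which only the values on \<open>space M\<close> matter.\<close>

definition regular_prob_space :: "'a::metric_space measure \<Rightarrow> bool" where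
  "regular_prob_space M \<longleftrightarrow>
     prob_space M \<and> compact (space M) \<and> sets M = sets (restrict_space borel (space M))"

definition invertible_mpt :: "'a measure \<Rightarrow> ('a \<Rightarrow> 'a) \<Rightarrow> bool" where
  "invertible_mpt M T \<longleftrightarrow>
     T \<in> measurable M M \<and> distr M M T = M \<and>
     bij_betw T (space M) (space M) \<and> inv_into (space M) T \<in> measurable M M"

definition ergodic :: "'a measure \<Rightarrow> ('a \<Rightarrow> 'a) \<Rightarrow> bool" where
  "ergodic M T \<longleftrightarrow> (\<forall>A\<in>sets M. T -` A \<inter> space M = A \<longrightarrow> measure M A \<in> {0, 1})"

definition totally_ergodic :: "'a measure \<Rightarrow> ('a \<Rightarrow> 'a) \<Rightarrow> bool" where
  "totally_ergodic M T \<longleftrightarrow> (\<forall>k\<ge>1. ergodic M (T ^^ k))"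

text \<open>Indices of multiplicative actions are positive integers; \<open>S 0\<close> is a dummy value.\<close>

definition multiplicative_action :: "'a measure \<Rightarrow> (nat \<Rightarrow> 'a \<Rightarrow> 'a) \<Rightarrow> bool" where
  "multiplicative_action M S \<longleftrightarrow>
     (\<forall>n\<ge>1. invertible_mpt M (S n)) \<and>
     (\<forall>n\<ge>1. \<forall>m\<ge>1. \<forall>x\<in>space M. S n (S m x) = S m (S n x)) \<and>
     (\<forall>n\<ge>1. \<forall>m\<ge>1. \<forall>x\<in>space M. S (n * m) x = S n (S m x))"

definition finitely_generated :: "'a measure \<Rightarrow> (nat \<Rightarrow> 'a \<Rightarrow> 'a) \<Rightarrow> bool" where
  "finitely_generated M S \<longleftrightarrow> finite {restrict (S p) (space M) | p. prime p}"

definition pretentiously_ergodic :: "'a measure \<Rightarrow> (nat \<Rightarrow> 'a \<Rightarrow> 'a) \<Rightarrow> bool" where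
  "pretentiously_ergodic M S \<longleftrightarrow>
     (\<forall>A\<in>sets M.
        (\<lambda>p. (L2_norm M (\<lambda>x. indicator A (S p x) - indicator A x))\<^sup>2 / real p)
          summable_on {p. prime p} \<longrightarrow>
        measure M A \<in> {0, 1})"

definition aperiodic :: "'a measure \<Rightarrow> (nat \<Rightarrow> 'a \<Rightarrow> 'a) \<Rightarrow> bool" where
  "aperiodic M S \<longleftrightarrow>
     (\<forall>F. L2_fun M F \<longrightarrow> (\<forall>r\<ge>1. \<forall>q\<ge>1.
        tendsto_L2 M
          (\<lambda>N x. (\<Sum>n=1..N. F (S (q * n + r) x)) / of_nat N)
          (\<lambda>_. \<integral>y. F y \<partial>M)))"

definition jointly_ergodic ::
  "'a measure \<Rightarrow> ('a \<Rightarrow> 'a) \<Rightarrow> (nat \<Rightarrow> 'a \<Rightarrow> 'a) \<Rightarrow> bool" where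
  "jointly_ergodic M T S \<longleftrightarrow>
     (\<forall>F G. Linf_fun M F \<longrightarrow> Linf_fun M G \<longrightarrow>
        tendsto_L2 M
          (\<lambda>N x. (\<Sum>n=1..N. F ((T ^^ n) x) * G (S n x)) / of_nat N)
          (\<lambda>_. (\<integral>y. F y \<partial>M) * (\<integral>y. G y \<partial>M)))"

end

theory Submission
  imports Defs "HOL-Computational_Algebra.Squarefree" "HOL-Number_Theory.Prime_Powers" "HOL-Real_Asymp.Real_Asymp"
begin

text \<open>Write \<open>A\<^sub>x\<close> for the average of \<open>G \<circ> S\<^sub>n\<close> over \<open>n \<le> x\<close>. For a finitely generated action these averages
  converge by a dynamical form of Wirsing's theorem. It suffices to treat \<open>G = H - H \<circ> S\<^sub>p\<close> with \<open>p\<close> in a class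
  of primes with divergent reciprocal sum on which \<open>S\<close> is constant. The identity \<open>1 * \<Lambda>\<^sub>2 = ln\<^sup>2\<close> expresses \<open>A\<^sub>x\<close> as a
  weighted mean of the functions \<open>A\<^bsub>x/d\<^esub> \<circ> S\<^sub>d\<close> with \<open>d\<close> a prime or a product of two primes. If the norm of \<open>A\<^sub>x\<close> is close to its upper
  limit, uniform convexity makes almost all terms of the mean agree with \<open>A\<^sub>x\<close>. Only finitely many maps \<open>S\<^sub>d\<close> occur, and by Selberg's
  formula such \<open>d\<close> lie in every short multiplicative interval; so on long windows the slowly varying function \<open>A\<close> takes almost
  finitely many values and is almost constant. The Turan--Kubilius inequality along the given class then shows
  \<open>A\<^sub>x \<approx> A\<^sub>x \<circ> S\<^sub>p\<close>, which is incompatible with \<open>G\<close> being a coboundary unless the upper limit is 0.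

  For the joint averages, a function orthogonal to everything invariant under some power of \<open>T\<close> contributes nothing, by the
  Daboussi--Katai criterion along a class of primes on which \<open>S\<close> is constant.
  The functions invariant under a power of \<open>T\<close> are constant if \<open>T\<close> is totally ergodic, and are handled by splitting into residue
  classes if \<open>S\<close> is aperiodic.\<close>

section \<open>Sums over the positive integers up to a real bound\<close>

text \<open>The averages over \<open>n \<le> x\<close> are not asymptotically invariant under
  \<open>n \<mapsto> p * n\<close>, so a coboundary of \<open>S p\<close> does not telescope as it
  does for \<open>T\<close>; hence the multiplicative mean ergodic theorem needs arithmetic.
  \<open>\<Lambda>\<^sub>2\<close> replaces \<open>\<Lambda>\<close> because Selberg's formula is
  elementary and already gives mass of order \<open>ln y\<close> in short multiplicative intervals,
  while for \<open>\<Lambda>\<close> this would call for the prime number theorem. The price,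
  products of two primes, is harmless: finitely many maps \<open>S p\<close> have finitely many
  products. The three convergence statements (for \<open>S\<close>, for \<open>T\<close>, joint) go
  by duality: for uniformly bounded linear maps the functions with convergence form a closed real
  subspace, so only a function \<open>h\<close> orthogonal to all of them has to be analysed. For
  \<open>S\<close>, such an \<open>h\<close> is invariant under \<open>S p\<close> for all
  \<open>p\<close> in classes with divergent reciprocal sum, and the other classes contribute a
  finite amount to the sum that defines pretentious ergodicity. In the joint averages
  \<open>G\<close> is fixed and bounded, and only \<open>F\<close> varies.\<close>

definition nats_upto :: "real \<Rightarrow> nat set" where
  "nats_upto x = {n. 0 < n \<and> real n \<le> x}"

lemma nats_upto_altdef: "nats_upto x = {1..nat \<lfloor>x\<rfloor>}"
  unfolding nats_upto_def by (auto simp: le_nat_floor) linarith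

lemma finite_nats_upto [simp, intro]: "finite (nats_upto x)"
  by (simp add: nats_upto_altdef)

lemma nats_upto_of_nat: "nats_upto (real N) = {1..N}"
  by (simp add: nats_upto_altdef)

lemma nats_upto_pos: "n \<in> nats_upto x \<Longrightarrow> n > 0"
  by (simp add: nats_upto_def)

lemma nats_upto_mono: "x \<le> y \<Longrightarrow> nats_upto x \<subseteq> nats_upto y"
  by (auto simp: nats_upto_def)

lemma card_nats_upto: "x \<ge> 0 \<Longrightarrow> real (card (nats_upto x)) = of_int \<lfloor>x\<rfloor>"
  by (simp add: nats_upto_altdef)

lemma card_nats_upto_le: "x \<ge> 0 \<Longrightarrow> real (card (nats_upto x)) \<le> x"
  by (simp add: card_nats_upto)

lemma card_nats_upto_ge: "x \<ge> 0 \<Longrightarrow> real (card (nats_upto x)) \<ge> x - 1"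
  by (simp add: card_nats_upto)

text \<open>Pairs \<open>(d, m)\<close> with \<open>d * m = n\<close>. This interchange is behind
  Moebius inversion and behind all summations of the identity
  \<open>1 * \<Lambda>\<^sub>2 = ln\<^sup>2\<close>.\<close>

lemma sum_dvd_nats_upto:
  fixes f :: "nat \<Rightarrow> nat \<Rightarrow> 'b::comm_monoid_add"
  shows "(\<Sum>n\<in>nats_upto x. \<Sum>d | d dvd n. f d (n div d)) =
         (\<Sum>d\<in>nats_upto x. \<Sum>m\<in>nats_upto (x / real d). f d m)"
proof -
  have "(\<Sum>n\<in>nats_upto x. \<Sum>d | d dvd n. f d (n div d)) =
        (\<Sum>(n,d)\<in>(SIGMA n:nats_upto x. {d. d dvd n}). f d (n div d))"
    by (rule sum.Sigma, rule finite_nats_upto) (auto simp: nats_upto_def)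
  also have "\<dots> = (\<Sum>(d,m)\<in>(SIGMA d:nats_upto x. nats_upto (x / real d)). f d m)"
  proof (rule sum.reindex_bij_witness
      [where i = "\<lambda>(d,m). (d * m, d)" and j = "\<lambda>(n,d). (d, n div d)"], goal_cases)
    case (2 a)
    then obtain n d where a: "a = (n, d)" "0 < n" "real n \<le> x" "d dvd n"
      by (auto simp: nats_upto_def)
    then obtain m where m: "n = d * m" by auto
    with a have "d > 0" "m > 0" by auto
    have "real d * 1 \<le> real d * real m" using \<open>m > 0\<close> by (intro mult_left_mono) auto
    then have "real d \<le> real n" using m by simp
    then have "real d \<le> x" using a by simp
    moreover have "real m \<le> x / real d"
      using a m \<open>d > 0\<close> by (simp add: field_simps)
    ultimately show ?case using a m \<open>d > 0\<close> \<open>m > 0\<close> by (auto simp: nats_upto_def)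
  next
    case (4 b)
    then show ?case by (auto simp: nats_upto_def field_simps)
  qed (auto simp: nats_upto_def)
  also have "\<dots> = (\<Sum>d\<in>nats_upto x. \<Sum>m\<in>nats_upto (x / real d). f d m)"
    by (rule sum.Sigma [symmetric]) auto
  finally show ?thesis .
qed

lemma sum_inverse_sqrt_le:
  assumes "x \<ge> 0"
  shows "(\<Sum>n\<in>nats_upto x. 1 / sqrt (real n)) \<le> 2 * sqrt x"
proof -
  have "(\<Sum>n = 1..N. 1 / sqrt (real n)) \<le> 2 * sqrt (real N)" for N
  proof (induction N)
    case (Suc N)
    have "1 / sqrt (real (Suc N)) \<le> 2 * (sqrt (real (Suc N)) - sqrt (real N))"
    proof -
      define a b where "a = sqrt (real (Suc N))" and "b = sqrt (real N)"
      have ab: "a > 0" "b \<ge> 0" "b \<le> a" "a\<^sup>2 = b\<^sup>2 + 1" by (auto simp: a_def b_def)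
      have "1 = (a - b) * (a + b)" using ab by (simp add: algebra_simps power2_eq_square)
      also have "\<dots> \<le> (a - b) * (2 * a)" using ab by (intro mult_left_mono) auto
      finally show ?thesis unfolding a_def [symmetric] b_def [symmetric]
        using ab by (simp add: field_simps)
    qed
    with Suc show ?case by simp
  qed simp
  from this[of "nat \<lfloor>x\<rfloor>"] have "(\<Sum>n\<in>nats_upto x. 1 / sqrt (real n)) \<le> 2 * sqrt (real (nat \<lfloor>x\<rfloor>))"
    by (simp add: nats_upto_altdef)
  also have "\<dots> \<le> 2 * sqrt x" using assms by simp
  finally show ?thesis .
qed

section \<open>Moebius inversion\<close>

definition moebius_mu :: "nat \<Rightarrow> real" where
  "moebius_mu n = (if squarefree n then (-1) ^ card (prime_factors n) else 0)"

lemma abs_moebius_le: "\<bar>moebius_mu n\<bar> \<le> 1"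
  by (simp add: moebius_mu_def)

text \<open>A squarefree number is the product of its prime factors, so the squarefree divisors of
  \<open>n\<close> are the products of sets of primes dividing \<open>n\<close>. The Moebius sum
  thereby becomes an alternating sum over subsets.\<close>

lemma bij_betw_prod_squarefree_divisors:
  fixes n :: nat
  assumes "n > 0"
  shows "bij_betw prime_factors {d. d dvd n \<and> squarefree d} (Pow (prime_factors n))"
proof (rule bij_betwI[where g = "\<lambda>A. \<Prod>A"])
  show "prime_factors \<in> {d. d dvd n \<and> squarefree d} \<rightarrow> Pow (prime_factors n)"
    using assms dvd_prime_factors[of n] by auto
  have sqf: "squarefree (\<Prod>A) \<and> prime_factors (\<Prod>A) = A" if A: "A \<subseteq> prime_factors n" for A
  proof -
    have fin: "finite A" using A finite_subset by blast
    have pr: "\<And>p. p \<in> A \<Longrightarrow> prime p" using A by auto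
    have "squarefree (\<Prod>A)"
      by (rule squarefree_prod_coprime) (use pr in \<open>auto intro: primes_coprime squarefree_prime\<close>)
    moreover have "prime_factors (\<Prod>A) = A"
      using fin pr pr[of 0] by (subst prime_factors_prod) (auto simp: prime_gt_0_nat prime_prime_factors)
    ultimately show ?thesis by blast
  qed
  show "(\<lambda>A. \<Prod>A) \<in> Pow (prime_factors n) \<rightarrow> {d. d dvd n \<and> squarefree d}"
  proof
    fix A assume A: "A \<in> Pow (prime_factors n)"
    have "\<Prod>A dvd \<Prod>(prime_factors n)" using A by (intro prod_dvd_prod_subset) auto
    also have "\<Prod>(prime_factors n) dvd (\<Prod>p\<in>prime_factors n. p ^ multiplicity p n)"
      by (intro prod_dvd_prod) (auto simp: prime_factors_multiplicity intro!: dvd_power)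
    also have "\<dots> = n" using prime_factorization_nat[of n] assms by simp
    finally show "\<Prod>A \<in> {d. d dvd n \<and> squarefree d}" using sqf A by auto
  qed
  show "\<Prod>(prime_factors d) = d" if "d \<in> {d. d dvd n \<and> squarefree d}" for d
  proof -
    have d: "d > 0" "squarefree d" using that assms by (auto intro: Nat.gr0I)
    have "d = (\<Prod>p\<in>prime_factors d. p ^ multiplicity p d)"
      using prime_factorization_nat[of d] d by simp
    also have "\<dots> = \<Prod>(prime_factors d)"
    proof (rule prod.cong)
      fix p assume "p \<in> prime_factors d"
      then have "prime p" "multiplicity p d > 0"
        by (simp_all add: prime_factors_multiplicity)
      moreover have "multiplicity p d \<le> 1"
        using d(1) iffD1[OF squarefree_factorial_semiring'' d(2)] \<open>prime p\<close> by simp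
      ultimately have "multiplicity p d = 1" by linarith
      then show "p ^ multiplicity p d = p" by simp
    qed simp
    finally show ?thesis by simp
  qed
  show "prime_factors (\<Prod>A) = A" if "A \<in> Pow (prime_factors n)" for A
    using sqf that by auto
qed

lemma sum_moebius_dvd:
  assumes "n > 0"
  shows "(\<Sum>d | d dvd n. moebius_mu d) = (if n = 1 then 1 else 0)"
proof -
  have "(\<Sum>d | d dvd n. moebius_mu d) = (\<Sum>d | d dvd n \<and> squarefree d. (-1) ^ card (prime_factors d))"
    using assms by (intro sum.mono_neutral_cong_right) (auto simp: moebius_mu_def)
  also have "\<dots> = (\<Sum>A\<in>Pow (prime_factors n). (-1) ^ card A)"
    by (rule sum.reindex_bij_betw[OF bij_betw_prod_squarefree_divisors[OF assms]])
  \<comment> \<open>The alternating sum over subsets is an expanded product of factors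
    \<open>1 - 1\<close>.\<close>
  also have "\<dots> = (\<Prod>p\<in>prime_factors n. 1 - (1::real))"
    using prod_diff_conv_sum[of "prime_factors n" "\<lambda>_. 1 :: real" "\<lambda>_. 1"] by simp
  also have "\<dots> = (if n = 1 then 1 else 0)"
  proof (cases "n = 1")
    case False
    then obtain p where "prime p" "p dvd n" using prime_factor_nat by blast
    then have "p \<in> prime_factors n" using assms by (simp add: prime_factors_dvd)
    then have "card (prime_factors n) > 0" by (auto simp: card_gt_0_iff)
    then show ?thesis using False by simp
  qed simp
  finally show ?thesis .
qed

text \<open>Moebius inversion recovers \<open>E x\<close> from the sums at \<open>x / n\<close>. A
  bound of size \<open>sqrt y\<close> is small enough to lose only a constant: the sum of
  \<open>sqrt (x / n)\<close> over \<open>n \<le> x\<close> is at most \<open>2 * x\<close>, whence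
  the 2. A bound of size \<open>y\<close> would cost a logarithm.\<close>

lemma moebius_inversion_bound:
  fixes E :: "real \<Rightarrow> real"
  assumes "\<And>y. y \<ge> 1 \<Longrightarrow> \<bar>\<Sum>n\<in>nats_upto y. E (y / real n)\<bar> \<le> C * sqrt y" and "x \<ge> 1"
  shows "\<bar>E x\<bar> \<le> 2 * C * x"
proof -
  have "C \<ge> 0" using order_trans[OF abs_ge_zero assms(1)[of 1]] by simp
  have "(\<Sum>n\<in>nats_upto x. moebius_mu n * (\<Sum>m\<in>nats_upto (x / real n). E (x / real n / real m)))
      = (\<Sum>k\<in>nats_upto x. \<Sum>d | d dvd k. moebius_mu d * E (x / real d / real (k div d)))"
    using sum_dvd_nats_upto[of "\<lambda>d m. moebius_mu d * E (x / real d / real m)" x]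
    unfolding sum_distrib_left by (rule sym)
  also have "\<dots> = (\<Sum>k\<in>nats_upto x. \<Sum>d | d dvd k. moebius_mu d * E (x / real k))"
    by (intro sum.cong refl) (auto simp: nats_upto_def real_of_nat_div intro: Nat.gr0I)
  also have "\<dots> = (\<Sum>k\<in>nats_upto x. E (x / real k) * (if k = 1 then 1 else 0))"
    unfolding sum_distrib_right[symmetric]
    by (intro sum.cong refl) (auto simp: sum_moebius_dvd nats_upto_def)
  also have "\<dots> = (\<Sum>k\<in>nats_upto x. if k = 1 then E x else 0)"
    by (intro sum.cong) auto
  also have "\<dots> = E x"
    using assms(2) by (subst sum.delta, simp) (auto simp: nats_upto_def)
  finally have "\<bar>E x\<bar> \<le> (\<Sum>n\<in>nats_upto x. \<bar>moebius_mu n *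
      (\<Sum>m\<in>nats_upto (x / real n). E (x / real n / real m))\<bar>)"
    by (rule subst) (rule sum_abs)
  also have "\<dots> \<le> (\<Sum>n\<in>nats_upto x. C * sqrt x * (1 / sqrt (real n)))"
  proof (intro sum_mono)
    fix n assume n: "n \<in> nats_upto x"
    then have "x / real n \<ge> 1" by (auto simp: nats_upto_def)
    have "\<bar>moebius_mu n * (\<Sum>m\<in>nats_upto (x / real n). E (x / real n / real m))\<bar>
      \<le> 1 * (C * sqrt (x / real n))"
      unfolding abs_mult
      by (intro mult_mono abs_moebius_le assms(1)) (use \<open>x / real n \<ge> 1\<close> in auto)
    then show "\<bar>moebius_mu n * (\<Sum>m\<in>nats_upto (x / real n). E (x / real n / real m))\<bar>
      \<le> C * sqrt x * (1 / sqrt (real n))" by (simp add: real_sqrt_divide)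
  qed
  also have "\<dots> \<le> C * sqrt x * (2 * sqrt x)"
    unfolding sum_distrib_left [symmetric]
    by (intro mult_left_mono sum_inverse_sqrt_le) (use assms \<open>C \<ge> 0\<close> in auto)
  also have "\<dots> = 2 * C * x" using assms(2) by simp
  finally show ?thesis .
qed

section \<open>Selberg's formula\<close>

lemma inverse_32_le_diff:
  fixes n :: nat
  assumes "n \<ge> 1"
  shows "1 / (real n * sqrt (real n)) \<le> 4 * (1 / sqrt (real n) - 1 / sqrt (real (Suc n)))"
proof -
  define a b where "a = sqrt (real n)" and "b = sqrt (real (Suc n))"
  have a: "a \<ge> 1" "a > 0" "b > 0" "b\<^sup>2 = a\<^sup>2 + 1" "real n = a\<^sup>2"
    using assms by (auto simp: a_def b_def)
  have ab: "a \<le> b" unfolding a_def b_def by simp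
  have "a\<^sup>2 \<ge> 1" using a by (simp add: one_le_power)
  then have "b\<^sup>2 \<le> (3/2 * a)\<^sup>2" using a by (simp add: power_mult_distrib power2_eq_square)
  then have b: "b \<le> 3/2 * a" by (rule power2_le_imp_le) (use a in simp)
  have "(a + b) * b \<le> (5/2 * a) * (3/2 * a)" using a b by (intro mult_mono) auto
  also have "\<dots> \<le> 4 * a\<^sup>2" by (simp add: power2_eq_square)
  finally have *: "(a + b) * b \<le> 4 * a\<^sup>2" .
  have "(b - a) * (a + b) = 1" using a by (simp add: algebra_simps power2_eq_square)
  moreover have "1 / a - 1 / b = ((b - a) * (a + b)) / (a * ((a + b) * b))"
    using a by (simp add: divide_simps)
  ultimately have "1 / a - 1 / b = 1 / (a * ((a + b) * b))" by simp
  also have "\<dots> \<ge> 1 / (a * (4 * a\<^sup>2))"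
    using a * by (intro divide_left_mono mult_left_mono) auto
  finally have "1 / (a * (4 * a\<^sup>2)) \<le> 1 / a - 1 / b" .
  then show ?thesis unfolding a_def [symmetric] b_def [symmetric] \<open>real n = a\<^sup>2\<close>
    using a by (simp add: field_simps power2_eq_square)
qed

lemma inverse_sqrt_floor_le:
  assumes "x \<ge> 1"
  shows "1 / sqrt (real (nat \<lfloor>x\<rfloor>)) \<le> 2 / sqrt x"
proof -
  have N: "real (nat \<lfloor>x\<rfloor>) \<ge> 1" using assms by (simp add: le_nat_floor)
  have "x \<le> real (nat \<lfloor>x\<rfloor>) + 1" using assms by linarith
  then have "x \<le> 4 * real (nat \<lfloor>x\<rfloor>)" using N by linarith
  then have "sqrt x \<le> sqrt (2\<^sup>2 * real (nat \<lfloor>x\<rfloor>))" by simp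
  also have "\<dots> = 2 * sqrt (real (nat \<lfloor>x\<rfloor>))" by (simp only: real_sqrt_mult) simp
  finally show ?thesis using assms N by (simp add: field_simps)
qed

text \<open>\<open>f (N + 1)\<close> differs from the integral of \<open>f\<close> over
  \<open>[N, N + 1]\<close> by at most \<open>B / (N * sqrt N)\<close>, which is dominated by the
  decrease of \<open>g\<close>; so sum minus integral converges with rate \<open>1 / sqrt N\<close>.
  In the constant 10, 4 comes from \<open>g\<close>, 1 from the gap between \<open>x\<close> and its
  floor, and a factor 2 from replacing \<open>sqrt N\<close> by \<open>sqrt x\<close>.\<close>

lemma euler_summation_limit:
  fixes f F f' :: "real \<Rightarrow> real"
  assumes F: "\<And>t. t \<ge> 1 \<Longrightarrow> (F has_real_derivative f t) (at t)"
    and f: "\<And>t. t \<ge> 1 \<Longrightarrow> (f has_real_derivative f' t) (at t)"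
    and f'_le: "\<And>t. t \<ge> 1 \<Longrightarrow> \<bar>f' t\<bar> \<le> B / (t * sqrt t)"
    and f_le: "\<And>t. t \<ge> 1 \<Longrightarrow> \<bar>f t\<bar> \<le> B / sqrt t"
  obtains c where
    "\<And>x. x \<ge> 1 \<Longrightarrow> \<bar>(\<Sum>n\<in>nats_upto x. f (real n)) - F x - c\<bar> \<le> 10 * B / sqrt x"
proof -
  have "B \<ge> 0" using order_trans[OF abs_ge_zero f_le[of 1]] by simp
  define s where "s N = (\<Sum>n=1..N. f (real n)) - F (real N)" for N
  define g where "g N = 4 * B / sqrt (real N)" for N
  have step: "\<bar>s (Suc N) - s N\<bar> \<le> g N - g (Suc N)" if N: "N \<ge> 1" for N
  proof -
    obtain z where z: "real N < z" "z < real (Suc N)"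
      "F (real (Suc N)) - F (real N) = (real (Suc N) - real N) * f z"
      using MVT2[of "real N" "real (Suc N)" F f] F N by auto
    obtain w where w: "z < w" "w < real (Suc N)"
      "f (real (Suc N)) - f z = (real (Suc N) - z) * f' w"
      using MVT2[of z "real (Suc N)" f f'] f N z by auto
    have "\<bar>s (Suc N) - s N\<bar> = \<bar>f (real (Suc N)) - f z\<bar>"
      using z by (simp add: s_def)
    also have "\<dots> = (real (Suc N) - z) * \<bar>f' w\<bar>" using w z by (simp add: abs_mult)
    also have "\<dots> \<le> 1 * (B / (w * sqrt w))"
      using w z N by (intro mult_mono f'_le) auto
    also have "\<dots> \<le> B / (real N * sqrt (real N))"
      using w z N \<open>B \<ge> 0\<close> by (auto intro!: divide_left_mono mult_mono)
    also have "\<dots> = B * (1 / (real N * sqrt (real N)))" by simp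
    also have "\<dots> \<le> B * (4 * (1 / sqrt (real N) - 1 / sqrt (real (Suc N))))"
      by (intro mult_left_mono inverse_32_le_diff) (use N \<open>B \<ge> 0\<close> in auto)
    also have "\<dots> = g N - g (Suc N)" by (simp add: g_def algebra_simps)
    finally show ?thesis .
  qed
  have "g \<longlonglongrightarrow> 0" unfolding g_def by real_asymp
  then have g0: "(\<lambda>n. g (Suc n)) \<longlonglongrightarrow> 0" by (rule LIMSEQ_Suc)
  have g_nonneg: "g n \<ge> 0" for n using \<open>B \<ge> 0\<close> by (simp add: g_def)
  have "\<exists>l. ((\<forall>n. s (Suc n) - g (Suc n) \<le> l) \<and> (\<lambda>n. s (Suc n) - g (Suc n)) \<longlonglongrightarrow> l) \<and>
            ((\<forall>n. l \<le> s (Suc n) + g (Suc n)) \<and> (\<lambda>n. s (Suc n) + g (Suc n)) \<longlonglongrightarrow> l)"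
  proof (rule nested_sequence_unique)
    show "\<forall>n. s (Suc n) - g (Suc n) \<le> s (Suc (Suc n)) - g (Suc (Suc n))"
    proof
      fix n show "s (Suc n) - g (Suc n) \<le> s (Suc (Suc n)) - g (Suc (Suc n))"
        using step[of "Suc n"] by simp
    qed
    show "\<forall>n. s (Suc (Suc n)) + g (Suc (Suc n)) \<le> s (Suc n) + g (Suc n)"
    proof
      fix n show "s (Suc (Suc n)) + g (Suc (Suc n)) \<le> s (Suc n) + g (Suc n)"
        using step[of "Suc n"] by simp
    qed
    show "\<forall>n. s (Suc n) - g (Suc n) \<le> s (Suc n) + g (Suc n)" using g_nonneg by simp
    show "(\<lambda>n. s (Suc n) - g (Suc n) - (s (Suc n) + g (Suc n))) \<longlonglongrightarrow> 0"
      using tendsto_mult_right[OF g0, of "-2"] by (simp add: mult.commute)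
  qed
  then obtain l where l: "\<And>n. s (Suc n) - g (Suc n) \<le> l" "\<And>n. l \<le> s (Suc n) + g (Suc n)"
    by blast
  show ?thesis
  proof
    fix x :: real assume x: "x \<ge> 1"
    define N where "N = nat \<lfloor>x\<rfloor>"
    have N: "N \<ge> 1" "real N \<le> x" "x \<le> real N + 1" using x by (auto simp: N_def le_nat_floor)
    have "\<bar>F x - F (real N)\<bar> \<le> B / sqrt (real N)"
    proof (cases "real N < x")
      case True
      obtain z where z: "real N < z" "z < x" "F x - F (real N) = (x - real N) * f z"
        using MVT2[of "real N" x F f] F N True by auto
      have "\<bar>F x - F (real N)\<bar> = (x - real N) * \<bar>f z\<bar>" using z by (simp add: abs_mult)
      also have "\<dots> \<le> 1 * (B / sqrt z)" using z N by (intro mult_mono f_le) auto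
      also have "\<dots> \<le> B / sqrt (real N)" using z N \<open>B \<ge> 0\<close> by (auto intro!: divide_left_mono)
      finally show ?thesis .
    qed (use N \<open>B \<ge> 0\<close> in auto)
    moreover have "\<bar>s N - l\<bar> \<le> g N" using l[of "N - 1"] N by simp
    ultimately have "\<bar>(\<Sum>n\<in>nats_upto x. f (real n)) - F x - l\<bar> \<le> 5 * B * (1 / sqrt (real N))"
      unfolding nats_upto_altdef N_def [symmetric] s_def g_def by (simp add: abs_le_iff)
    also have "\<dots> \<le> 5 * B * (2 / sqrt x)"
      unfolding N_def by (intro mult_left_mono inverse_sqrt_floor_le x) (use \<open>B \<ge> 0\<close> in auto)
    finally show "\<bar>(\<Sum>n\<in>nats_upto x. f (real n)) - F x - l\<bar> \<le> 10 * B / sqrt x" by simp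
  qed
qed

text \<open>The error \<open>2 / x\<close> is sharper than what \<open>euler_summation_limit\<close>
  gives. Selberg's formula multiplies it by \<open>x * ln x\<close> and tolerates only
  \<open>O(sqrt x)\<close>.\<close>

lemma sum_inverse_approx:
  assumes "x \<ge> 1"
  shows "\<bar>(\<Sum>n\<in>nats_upto x. 1 / real n) - ln x - euler_mascheroni\<bar> \<le> 2 / x"
proof -
  define N where "N = nat \<lfloor>x\<rfloor>"
  have N: "N \<ge> 1" "real N \<le> x" "x \<le> real N + 1"
    using assms by (auto simp: N_def le_nat_floor)
  have "(\<Sum>n\<in>nats_upto x. 1 / real n) = harm N"
    by (simp add: nats_upto_altdef N_def harm_def inverse_eq_divide)
  moreover have "ln (real N + 1) - ln x \<le> (real N + 1 - x) / x"
    using N assms by (intro ln_diff_le) auto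
  moreover have "(real N + 1 - x) / x \<le> 1 / x" using N assms by (intro divide_right_mono) auto
  moreover have "ln x \<le> ln (real N + 1)" using N assms by simp
  moreover have "1 / (2 * real N) \<le> 1 / x"
    using N assms by (intro divide_left_mono) auto
  moreover have "euler_mascheroni \<le> harm N - ln (real N + 1) + 1 / (2 * real N)"
    "harm N - ln (real N + 1) \<le> (euler_mascheroni :: real)"
    using euler_mascheroni_bounds[OF N(1)] by (auto simp: inverse_eq_divide add.commute intro: order_trans[rotated])
  ultimately show ?thesis unfolding abs_le_iff by auto
qed

lemma ln_le_2sqrt: "x > 0 \<Longrightarrow> ln (x::real) \<le> 2 * sqrt x"
  using ln_le_minus_one[of "sqrt x"] by (simp add: ln_sqrt)

lemma ln_sq_le_16sqrt:
  fixes x :: real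
  assumes "x \<ge> 1"
  shows "(ln x)\<^sup>2 \<le> 16 * sqrt x"
proof -
  have "ln x = 2 * ln (sqrt x)" using assms by (simp add: ln_sqrt)
  also have "\<dots> \<le> 2 * (2 * sqrt (sqrt x))" using assms by (intro mult_left_mono ln_le_2sqrt) auto
  finally have "(ln x)\<^sup>2 \<le> (4 * sqrt (sqrt x))\<^sup>2" using assms by (intro power_mono) auto
  then show ?thesis using assms by (simp add: power_mult_distrib)
qed

lemma sum_ln_over_n_approx:
  obtains c where
    "\<And>x. x \<ge> 1 \<Longrightarrow> \<bar>(\<Sum>n\<in>nats_upto x. ln (real n) / real n) - (ln x)\<^sup>2 / 2 - c\<bar> \<le> 30 / sqrt x"
proof (rule euler_summation_limit[where f = "\<lambda>t. ln t / t" and F = "\<lambda>t. (ln t)\<^sup>2 / 2"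
      and f' = "\<lambda>t. (1 - ln t) / t\<^sup>2" and B = 3])
  fix t :: real assume t: "t \<ge> 1"
  show "((\<lambda>t. (ln t)\<^sup>2 / 2) has_real_derivative ln t / t) (at t)"
    using t by (auto intro!: derivative_eq_intros simp: field_simps)
  show "((\<lambda>t. ln t / t) has_real_derivative (1 - ln t) / t\<^sup>2) (at t)"
    using t by (auto intro!: derivative_eq_intros simp: field_simps power2_eq_square)
  have s: "sqrt t \<ge> 1" "t = sqrt t * sqrt t" using t by auto
  have l: "ln t \<le> 2 * sqrt t" "ln t \<ge> 0" using t ln_le_2sqrt by auto
  have "\<bar>1 - ln t\<bar> \<le> 3 * sqrt t" using s(1) l by (simp only: abs_le_iff) linarith
  then have "\<bar>(1 - ln t) / t\<^sup>2\<bar> \<le> 3 * sqrt t / t\<^sup>2"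
    using t by (simp add: abs_div divide_right_mono)
  also have "\<dots> = 3 / (t * sqrt t)"
    using s t by (simp add: field_simps power2_eq_square) 
  finally show "\<bar>(1 - ln t) / t\<^sup>2\<bar> \<le> 3 / (t * sqrt t)" .
  have "ln t \<le> 3 * sqrt t" using s(1) l by linarith
  then have "\<bar>ln t / t\<bar> \<le> 3 * sqrt t / t"
    using t l(2) by (auto intro!: divide_right_mono)
  also have "\<dots> = 3 / sqrt t" using s t by (simp add: field_simps)
  finally show "\<bar>ln t / t\<bar> \<le> 3 / sqrt t" .
qed auto

lemma sum_ln_sq_approx:
  assumes "x \<ge> 1"
  shows "\<bar>(\<Sum>n\<in>nats_upto x. (ln (real n))\<^sup>2) - (x * (ln x)\<^sup>2 - 2 * x * ln x + 2 * x)\<bar> \<le> 34 * sqrt x"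
proof -
  define G :: "real \<Rightarrow> real" where "G t = t * (ln t)\<^sup>2 - 2 * t * ln t + 2 * t" for t
  have der: "(G has_real_derivative (ln t)\<^sup>2) (at t)" if "t \<ge> 1" for t
    unfolding G_def using that
    by (auto intro!: derivative_eq_intros simp: field_simps power2_eq_square)
  have mono: "(ln s)\<^sup>2 \<le> (ln t)\<^sup>2" if "1 \<le> s" "s \<le> t" for s t :: real
    using that by (intro power_mono) auto
  have bounds: "(t - s) * (ln s)\<^sup>2 \<le> G t - G s \<and> G t - G s \<le> (t - s) * (ln t)\<^sup>2"
    if "1 \<le> s" "s \<le> t" for s t
  proof (cases "s < t")
    case True
    have "\<exists>z>s. z < t \<and> G t - G s = (t - s) * (ln z)\<^sup>2"
      by (rule MVT2[OF True]) (use der that in auto)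
    then obtain z where "s < z" "z < t" "G t - G s = (t - s) * (ln z)\<^sup>2" by blast
    then show ?thesis using that by (auto intro!: mult_left_mono mono)
  qed (use that in auto)
  \<comment> \<open>The offset 2 is the value \<open>G 1\<close>, since the sum starts with
    \<open>ln 1 = 0\<close>.\<close>
  have ind: "G (real (Suc N)) - 2 \<le> (\<Sum>n=1..Suc N. (ln (real n))\<^sup>2) \<and>
        (\<Sum>n=1..Suc N. (ln (real n))\<^sup>2) \<le> G (real (Suc N)) + (ln (real (Suc N)))\<^sup>2" for N
  proof (induction N)
    case 0
    show ?case by (simp add: G_def)
  next
    case (Suc N)
    have "(\<Sum>n=1..Suc (Suc N). (ln (real n))\<^sup>2) =
      (\<Sum>n=1..Suc N. (ln (real n))\<^sup>2) + (ln (real (Suc (Suc N))))\<^sup>2" by simp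
    moreover have "real (Suc (Suc N)) - real (Suc N) = 1" by simp
    ultimately show ?case
      using Suc bounds[of "real (Suc N)" "real (Suc (Suc N))"] by simp
  qed
  define N where "N = nat \<lfloor>x\<rfloor>"
  have N: "N \<ge> 1" "real N \<le> x" "x \<le> real N + 1"
    using assms by (auto simp: N_def le_nat_floor)
  have "G (real N) - 2 \<le> (\<Sum>n=1..N. (ln (real n))\<^sup>2)"
    "(\<Sum>n=1..N. (ln (real n))\<^sup>2) \<le> G (real N) + (ln (real N))\<^sup>2"
    using ind[of "N - 1"] N by auto
  moreover have "(x - real N) * (ln x)\<^sup>2 \<le> 1 * (ln x)\<^sup>2"
    using N by (intro mult_right_mono) auto
  moreover have "0 \<le> (x - real N) * (ln (real N))\<^sup>2" using N by simp
  moreover have "(x - real N) * (ln (real N))\<^sup>2 \<le> G x - G (real N)"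
    "G x - G (real N) \<le> (x - real N) * (ln x)\<^sup>2" using bounds[of "real N" x] N by auto
  moreover have "(ln (real N))\<^sup>2 \<le> (ln x)\<^sup>2" using mono N by auto
  moreover have "sqrt x \<ge> 1" using assms by simp
  ultimately have "\<bar>(\<Sum>n=1..N. (ln (real n))\<^sup>2) - G x\<bar> \<le> 34 * sqrt x"
    using ln_sq_le_16sqrt[OF assms] unfolding abs_le_iff by linarith
  then show ?thesis unfolding nats_upto_altdef N_def G_def .
qed

text \<open>A weak Stirling formula: the sum of \<open>ln n\<close> is
  \<open>x * ln x + O(x)\<close>. It serves the lower Mertens bound and the error term in Selberg's
  identity for the averages.\<close>

lemma sum_ln_diff_le:
  assumes "x \<ge> 1"
  shows "(\<Sum>n\<in>nats_upto x. ln x - ln (real n)) \<le> 4 * x"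
proof -
  have "(\<Sum>n\<in>nats_upto x. ln x - ln (real n)) \<le> (\<Sum>n\<in>nats_upto x. 2 * sqrt x * (1 / sqrt (real n)))"
  proof (intro sum_mono)
    fix n assume "n \<in> nats_upto x"
    then have n: "n > 0" by (simp add: nats_upto_def)
    then have "ln x - ln (real n) = ln (x / real n)" using assms by (simp add: ln_div)
    also have "\<dots> \<le> 2 * sqrt (x / real n)" using assms n by (intro ln_le_2sqrt) auto
    finally show "ln x - ln (real n) \<le> 2 * sqrt x * (1 / sqrt (real n))" by (simp add: real_sqrt_divide)
  qed
  also have "\<dots> \<le> 2 * sqrt x * (2 * sqrt x)" unfolding sum_distrib_left [symmetric]
    by (intro mult_left_mono sum_inverse_sqrt_le) (use assms in auto)
  finally show ?thesis using assms by simp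
qed

text \<open>This is \<open>\<Lambda>\<^sub>2\<close>, the Dirichlet convolution of the Moebius
  function with the squared logarithm. The explicit form shows that it is nonnegative and supported
  on numbers with at most two distinct prime factors.\<close>

definition selberg :: "nat \<Rightarrow> real" where
  "selberg n = mangoldt n * ln (real n) + (\<Sum>d | d dvd n. mangoldt d * mangoldt (n div d))"

lemma selberg_nonneg: "selberg n \<ge> 0"
proof (cases "n = 0")
  case False
  then show ?thesis unfolding selberg_def
    by (intro add_nonneg_nonneg mult_nonneg_nonneg sum_nonneg mangoldt_nonneg) auto
qed (simp add: selberg_def)

lemma sum_dvd_flip:
  fixes f :: "nat \<Rightarrow> 'b::comm_monoid_add"
  assumes "n > 0"
  shows "(\<Sum>d | d dvd n. f (n div d)) = (\<Sum>d | d dvd n. f d)"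
  by (rule sum.reindex_bij_witness[where i = "\<lambda>d. n div d" and j = "\<lambda>d. n div d"])
     (use assms in \<open>auto simp: div_dvd_iff_mult dvd_div_eq_mult elim!: dvdE\<close>)

lemma sum_dvd_dvd:
  fixes f :: "nat \<Rightarrow> nat \<Rightarrow> 'b::comm_monoid_add"
  assumes "n > 0"
  shows "(\<Sum>d | d dvd n. \<Sum>e | e dvd d. f e (d div e)) = (\<Sum>e | e dvd n. \<Sum>m | m dvd n div e. f e m)"
proof -
  have fin: "finite {e. e dvd d}" if "d dvd n" for d
    using that assms by (auto intro: Nat.gr0I)
  have fin2: "finite {m. m dvd n div e}" if "e dvd n" for e
    using that assms by (auto simp: dvd_div_eq_0_iff)
  have "(\<Sum>d | d dvd n. \<Sum>e | e dvd d. f e (d div e)) =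
        (\<Sum>(d,e)\<in>(SIGMA d:{d. d dvd n}. {e. e dvd d}). f e (d div e))"
    by (rule sum.Sigma) (use assms fin in auto)
  also have "\<dots> = (\<Sum>(e,m)\<in>(SIGMA e:{e. e dvd n}. {m. m dvd n div e}). f e m)"
  proof (rule sum.reindex_bij_witness
      [where i = "\<lambda>(e,m). (e * m, e)" and j = "\<lambda>(d,e). (e, d div e)"], goal_cases)
    case (2 a)
    then obtain d e where "a = (d, e)" "d dvd n" "e dvd d" by auto
    then show ?case using assms by (auto intro: dvd_trans div_dvd_div[THEN iffD2])
  next
    case (3 b)
    then obtain e m where "b = (e, m)" "e dvd n" "m dvd n div e" by auto
    moreover have "e > 0" using assms calculation by (auto intro: Nat.gr0I)
    ultimately show ?case by auto
  next
    case (4 b)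
    then obtain e m where "b = (e, m)" "e dvd n" "m dvd n div e" by auto
    then have "e * m dvd e * (n div e)" by (intro mult_dvd_mono) auto
    then show ?case using \<open>b = (e, m)\<close> \<open>e dvd n\<close> by simp
  qed auto
  also have "\<dots> = (\<Sum>e | e dvd n. \<Sum>m | m dvd n div e. f e m)"
    by (rule sum.Sigma [symmetric]) (use assms fin2 in auto)
  finally show ?thesis .
qed

text \<open>Because \<open>1 * \<Lambda> = ln\<close>, the convolution part contributes the sum of
  \<open>\<Lambda> e * (ln n - ln e)\<close> over the divisors \<open>e\<close>. The part with
  \<open>ln e\<close> cancels the term \<open>mangoldt d * ln d\<close> of \<open>selberg\<close>,
  and what is left is \<open>ln n\<close> times \<open>ln n\<close>.\<close>

lemma sum_selberg_dvd:
  assumes "n > 0"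
  shows "(\<Sum>d | d dvd n. selberg d) = (ln (real n))\<^sup>2"
proof -
  have "(\<Sum>d | d dvd n. \<Sum>e | e dvd d. mangoldt e * mangoldt (d div e)) =
        (\<Sum>e | e dvd n. mangoldt e * (\<Sum>m | m dvd n div e. mangoldt m :: real))"
    using sum_dvd_dvd[OF assms, of "\<lambda>e m. mangoldt e * mangoldt m :: real"]
    by (simp add: sum_distrib_left)
  also have "\<dots> = (\<Sum>e | e dvd n. mangoldt e * (ln (real n) - ln (real e)))"
  proof (intro sum.cong refl)
    fix e assume "e \<in> {e. e dvd n}"
    then have e: "e dvd n" "e > 0" "n div e \<noteq> 0" using assms by (auto intro: Nat.gr0I simp: dvd_div_eq_0_iff)
    then show "mangoldt e * (\<Sum>m | m dvd n div e. mangoldt m) = mangoldt e * (ln (real n) - ln (real e))"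
      using assms by (simp add: mangoldt_sum real_of_nat_div ln_div)
  qed
  finally have "(\<Sum>d | d dvd n. selberg d) = (\<Sum>e | e dvd n. mangoldt e * ln (real n))"
    by (simp add: selberg_def sum.distrib algebra_simps sum_subtractf)
  also have "\<dots> = ln (real n) * ln (real n)"
    using assms by (simp add: mangoldt_sum flip: sum_distrib_right)
  finally show ?thesis by (simp add: power2_eq_square)
qed

lemma sum_dvd_card_nats_upto:
  fixes f :: "nat \<Rightarrow> real"
  shows "(\<Sum>n\<in>nats_upto x. \<Sum>d | d dvd n. f d) = (\<Sum>d\<in>nats_upto x. f d * real (card (nats_upto (x / real d))))"
  using sum_dvd_nats_upto[of "\<lambda>d m. f d" x] by (simp add: mult.commute)

lemma sum_selberg_scaled:
  "(\<Sum>n\<in>nats_upto x. \<Sum>d\<in>nats_upto (x / real n). selberg d) = (\<Sum>n\<in>nats_upto x. (ln (real n))\<^sup>2)"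
proof -
  have "(\<Sum>n\<in>nats_upto x. \<Sum>d\<in>nats_upto (x / real n). selberg d) =
      (\<Sum>n\<in>nats_upto x. \<Sum>d | d dvd n. selberg (n div d))"
    by (rule sum_dvd_nats_upto [symmetric])
  also have "\<dots> = (\<Sum>n\<in>nats_upto x. (ln (real n))\<^sup>2)"
    by (intro sum.cong refl) (subst sum_dvd_flip, auto simp: sum_selberg_dvd nats_upto_def)
  finally show ?thesis .
qed

text \<open>Summed over \<open>x / n\<close>, the function \<open>\<psi>\<close> gives the sum of
  \<open>ln\<^sup>2\<close>. An explicit \<open>g\<close> with main term \<open>2 * x * ln x\<close>
  gives the same up to \<open>O(sqrt x)\<close>, and Moebius inversion of the difference yields
  \<open>\<psi> = g + O(x)\<close>.\<close>

theorem selberg_formula: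
  obtains C where "C \<ge> 0"
    "\<And>x. x \<ge> 1 \<Longrightarrow> \<bar>(\<Sum>d\<in>nats_upto x. selberg d) - 2 * x * ln x\<bar> \<le> C * x"
proof -
  obtain b where b: "\<And>x. x \<ge> 1 \<Longrightarrow>
      \<bar>(\<Sum>n\<in>nats_upto x. ln (real n) / real n) - (ln x)\<^sup>2 / 2 - b\<bar> \<le> 30 / sqrt x"
    using sum_ln_over_n_approx by blast
  define a :: real where "a = euler_mascheroni"
  \<comment> \<open>\<open>c1\<close> and \<open>c2\<close> are found by comparing the coefficients
    of \<open>x * ln x\<close> and of \<open>x\<close> in the sum of \<open>g (x / n)\<close> with
    those in the sum of \<open>ln\<^sup>2\<close>.\<close>
  define c1 where "c1 = - 2 - 2 * a"
  define c2 where "c2 = 2 + 2 * b - c1 * a"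
  define g where "g x = 2 * x * ln x + c1 * x + c2" for x :: real
  define \<psi> where "\<psi> x = (\<Sum>d\<in>nats_upto x. selberg d)" for x
  define K where "K = 102 + 2 * \<bar>c1\<bar> + \<bar>c2\<bar>"
  have bound: "\<bar>\<Sum>n\<in>nats_upto x. \<psi> (x / real n) - g (x / real n)\<bar> \<le> K * sqrt x" if x: "x \<ge> 1" for x
  proof -
    define e1 where "e1 = (\<Sum>n\<in>nats_upto x. 1 / real n) - ln x - a"
    define e2 where "e2 = (\<Sum>n\<in>nats_upto x. ln (real n) / real n) - (ln x)\<^sup>2 / 2 - b"
    define e3 where "e3 = (\<Sum>n\<in>nats_upto x. (ln (real n))\<^sup>2) - (x * (ln x)\<^sup>2 - 2 * x * ln x + 2 * x)"
    define e4 where "e4 = real (card (nats_upto x)) - x"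
    have "\<bar>e1\<bar> \<le> 2 / x" using sum_inverse_approx[OF x] by (simp add: e1_def a_def)
    then have e1': "\<bar>x * e1\<bar> \<le> 2" using x by (simp add: abs_mult field_simps)
    have "\<bar>e2\<bar> \<le> 30 / sqrt x" using b[OF x] by (simp add: e2_def)
    then have "\<bar>x * e2\<bar> \<le> x * (30 / sqrt x)"
      using x mult_left_mono[of "\<bar>e2\<bar>" "30 / sqrt x" x] by (simp add: abs_mult)
    also have "\<dots> = 30 * sqrt x" using x by (simp add: field_simps)
    finally have e2': "\<bar>x * e2\<bar> \<le> 30 * sqrt x" .
    have e3': "\<bar>e3\<bar> \<le> 34 * sqrt x" using sum_ln_sq_approx[OF x] by (simp add: e3_def)
    have e4': "\<bar>e4\<bar> \<le> 1"
      using card_nats_upto_le[of x] card_nats_upto_ge[of x] x by (simp add: e4_def)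
    have sx: "sqrt x \<ge> 1" using x by simp
    have "(\<Sum>n\<in>nats_upto x. g (x / real n)) =
      (\<Sum>n\<in>nats_upto x. 2 * x * ln x * (1 / real n) - 2 * x * (ln (real n) / real n) + c1 * x * (1 / real n) + c2)"
    proof (intro sum.cong refl)
      fix n assume "n \<in> nats_upto x"
      then have "n > 0" by (simp add: nats_upto_def)
      then have ln_eq: "ln (x / real n) = ln x - ln (real n)" using x by (simp add: ln_div)
      show "g (x / real n) = 2 * x * ln x * (1 / real n) - 2 * x * (ln (real n) / real n) + c1 * x * (1 / real n) + c2"
        unfolding g_def ln_eq by (simp add: algebra_simps diff_divide_distrib)
    qed
    also have "\<dots> = 2 * x * ln x * (ln x + a + e1) - 2 * x * ((ln x)\<^sup>2 / 2 + b + e2)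
        + c1 * x * (ln x + a + e1) + c2 * (x + e4)"
      unfolding sum.distrib sum_subtractf sum_distrib_left [symmetric]
      by (simp add: e1_def e2_def e4_def)
    finally have g: "(\<Sum>n\<in>nats_upto x. g (x / real n)) = \<dots>" .
    have "(\<Sum>n\<in>nats_upto x. \<psi> (x / real n)) = x * (ln x)\<^sup>2 - 2 * x * ln x + 2 * x + e3"
      by (simp add: \<psi>_def sum_selberg_scaled e3_def)
    then have "(\<Sum>n\<in>nats_upto x. \<psi> (x / real n) - g (x / real n)) =
      e3 - 2 * ln x * (x * e1) + 2 * (x * e2) - c1 * (x * e1) - c2 * e4"
      by (simp add: sum_subtractf g c1_def c2_def power2_eq_square algebra_simps)
    also have "\<bar>\<dots>\<bar> \<le> \<bar>e3\<bar> + 2 * ln x * \<bar>x * e1\<bar> + 2 * \<bar>x * e2\<bar> + \<bar>c1\<bar> * \<bar>x * e1\<bar> + \<bar>c2\<bar> * \<bar>e4\<bar>"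
    proof -
      have "\<bar>2 * ln x * (x * e1)\<bar> = 2 * ln x * \<bar>x * e1\<bar>" using x by (simp add: abs_mult)
      moreover have "\<bar>c1 * (x * e1)\<bar> = \<bar>c1\<bar> * \<bar>x * e1\<bar>" "\<bar>c2 * e4\<bar> = \<bar>c2\<bar> * \<bar>e4\<bar>" by (simp_all add: abs_mult)
      ultimately show ?thesis by linarith
    qed
    also have "\<dots> \<le> 34 * sqrt x + 2 * (2 * sqrt x) * 2 + 2 * (30 * sqrt x) + \<bar>c1\<bar> * 2 + \<bar>c2\<bar> * 1"
      by (intro add_mono mult_mono e1' e2' e3' e4' order_refl ln_le_2sqrt) (use x in auto)
    also have "\<dots> \<le> 34 * sqrt x + 2 * (2 * sqrt x) * 2 + 2 * (30 * sqrt x) + \<bar>c1\<bar> * (2 * sqrt x) + \<bar>c2\<bar> * sqrt x"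
      by (intro add_mono mult_left_mono order_refl) (use sx in auto)
    also have "\<dots> = K * sqrt x" by (simp add: K_def algebra_simps)
    finally show ?thesis .
  qed
  have K: "K \<ge> 0" by (simp add: K_def)
  show ?thesis
  proof (rule that[of "2 * K + \<bar>c1\<bar> + \<bar>c2\<bar>"])
    fix x :: real assume x: "x \<ge> 1"
    have "\<bar>\<psi> x - g x\<bar> \<le> 2 * K * x" by (rule moebius_inversion_bound) (use bound x in auto)
    moreover have "\<bar>g x - 2 * x * ln x\<bar> \<le> \<bar>c1\<bar> * x + \<bar>c2\<bar> * x"
    proof -
      have "\<bar>g x - 2 * x * ln x\<bar> \<le> \<bar>c1 * x\<bar> + \<bar>c2\<bar> * 1" by (simp add: g_def)
      also have "\<dots> \<le> \<bar>c1\<bar> * x + \<bar>c2\<bar> * x"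
        using x by (intro add_mono mult_left_mono) (auto simp: abs_mult)
      finally show ?thesis .
    qed
    ultimately show "\<bar>(\<Sum>d\<in>nats_upto x. selberg d) - 2 * x * ln x\<bar> \<le> (2 * K + \<bar>c1\<bar> + \<bar>c2\<bar>) * x"
      unfolding \<psi>_def [symmetric] by (simp add: algebra_simps)
  qed (use K in simp)
qed

section \<open>Chebyshev and Mertens type bounds for \<open>mangoldt\<close> and
  \<open>selberg\<close>\<close>

lemma card_nats_upto_ge_half:
  assumes "y \<ge> 1"
  shows "y / 2 \<le> real (card (nats_upto y))"
proof -
  have "1 \<in> nats_upto y" using assms by (simp add: nats_upto_def)
  then have "card (nats_upto y) \<ge> 1" by (simp add: Suc_le_eq card_gt_0_iff) blast
  then show ?thesis using card_nats_upto_ge[of y] assms by linarith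
qed

text \<open>Chebyshev's method: in the sum of \<open>ln n\<close>, each \<open>mangoldt d\<close> is
  counted as often as the floor of \<open>x / d\<close>, which is at least half of
  \<open>x / d\<close>. Only the order \<open>ln x\<close> matters later, so the factor 2 is
  harmless.\<close>

lemma sum_mangoldt_over_le:
  assumes "x \<ge> 1"
  shows "(\<Sum>d\<in>nats_upto x. mangoldt d / real d) \<le> 2 * ln x"
proof -
  have "x / 2 * (\<Sum>d\<in>nats_upto x. mangoldt d / real d) = (\<Sum>d\<in>nats_upto x. mangoldt d * (x / real d / 2))"
    by (simp add: sum_distrib_left mult_ac)
  also have "\<dots> \<le> (\<Sum>d\<in>nats_upto x. mangoldt d * real (card (nats_upto (x / real d))))"
  proof (intro sum_mono mult_left_mono mangoldt_nonneg)
    fix d assume "d \<in> nats_upto x"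
    then have "x / real d \<ge> 1" by (auto simp: nats_upto_def)
    then show "x / real d / 2 \<le> real (card (nats_upto (x / real d)))" by (rule card_nats_upto_ge_half)
  qed
  also have "\<dots> = (\<Sum>n\<in>nats_upto x. ln (real n))"
    unfolding sum_dvd_card_nats_upto [symmetric]
    by (intro sum.cong refl) (auto simp: mangoldt_sum nats_upto_def)
  also have "\<dots> \<le> (\<Sum>n\<in>nats_upto x. ln x)"
    by (intro sum_mono) (auto simp: nats_upto_def)
  also have "\<dots> \<le> x * ln x" using assms by (auto intro!: mult_right_mono card_nats_upto_le)
  finally have "x * (\<Sum>d\<in>nats_upto x. mangoldt d / real d) \<le> x * (2 * ln x)" by simp
  then show ?thesis by (rule mult_left_le_imp_le) (use assms in auto)
qed

text \<open>The same identity with the floor bounded from above. The 5 is 4 from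
  \<open>sum_ln_diff_le\<close> plus 1 from \<open>ln x \<le> x\<close>, which absorbs the rounding
  of the number of terms.\<close>

lemma sum_mangoldt_over_ge:
  assumes "x \<ge> 1"
  shows "(\<Sum>d\<in>nats_upto x. mangoldt d / real d) \<ge> ln x - 5"
proof -
  have "(x - 1) * ln x - 4 * x \<le> (\<Sum>n\<in>nats_upto x. ln x) - (\<Sum>n\<in>nats_upto x. ln x - ln (real n))"
    using sum_ln_diff_le[OF assms] assms card_nats_upto_ge[of x]
      mult_right_mono[of "x - 1" "real (card (nats_upto x))" "ln x"] by simp
  also have "\<dots> = (\<Sum>n\<in>nats_upto x. ln (real n))" by (simp add: sum_subtractf)
  also have "\<dots> = (\<Sum>d\<in>nats_upto x. mangoldt d * real (card (nats_upto (x / real d))))"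
    unfolding sum_dvd_card_nats_upto [symmetric]
    by (intro sum.cong refl) (auto simp: mangoldt_sum nats_upto_def)
  also have "\<dots> \<le> (\<Sum>d\<in>nats_upto x. mangoldt d * (x / real d))"
    using assms by (intro sum_mono mult_left_mono mangoldt_nonneg card_nats_upto_le) auto
  also have "\<dots> = x * (\<Sum>d\<in>nats_upto x. mangoldt d / real d)"
    by (simp add: sum_distrib_left mult_ac)
  finally have "(x - 1) * ln x - 4 * x \<le> x * (\<Sum>d\<in>nats_upto x. mangoldt d / real d)" .
  moreover have "ln x \<le> x" using ln_le_minus_one[of x] assms by simp
  ultimately have "x * (ln x - 5) \<le> x * (\<Sum>d\<in>nats_upto x. mangoldt d / real d)"
    by (simp add: algebra_simps)
  then show ?thesis by (rule mult_left_le_imp_le) (use assms in auto)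
qed

lemma sum_inverse_32_le: "(\<Sum>n=1..N. 1 / (real n * sqrt (real n))) \<le> 4"
proof -
  have "(\<Sum>n=1..N. 1 / (real n * sqrt (real n))) \<le> 4 - 4 / sqrt (real (Suc N))"
  proof (induction N)
    case (Suc N)
    then show ?case using inverse_32_le_diff[of "Suc N"] by simp
  qed simp
  also have "\<dots> \<le> 4" by simp
  finally show ?thesis .
qed

text \<open>Only proper prime powers count. For fixed \<open>p\<close> they give \<open>ln p\<close>
  times a geometric series, at most \<open>2 * sqrt p * 2 / p\<^sup>2\<close>, and the resulting sum
  of \<open>4 / (n * sqrt n)\<close> is at most 16.\<close>

lemma sum_mangoldt_nonprime_le:
  "(\<Sum>d | d \<in> nats_upto x \<and> \<not> prime d. mangoldt d / real d) \<le> 16"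
proof -
  define K where "K = nat \<lfloor>x\<rfloor>"
  define P where "P = {p. prime p \<and> p \<in> nats_upto x}"
  have finP: "finite P" unfolding P_def by (rule finite_subset[OF _ finite_nats_upto[of x]]) auto
  \<comment> \<open>The exponents may be cut at \<open>K\<close> too, because
    \<open>k \<le> p ^ k\<close>.\<close>
  let ?A = "(\<lambda>(p,k). p ^ k) ` (P \<times> {2..K})"
  have fin: "finite ?A" using finP by auto
  have "(\<Sum>d | d \<in> nats_upto x \<and> \<not> prime d. mangoldt d / real d) =
        (\<Sum>d | d \<in> nats_upto x \<and> \<not> prime d \<and> primepow d. mangoldt d / real d)"
    by (rule sum.mono_neutral_right) (auto simp: mangoldt_def)
  also have "\<dots> \<le> (\<Sum>d\<in>?A. mangoldt d / real d)"
  proof (rule sum_mono2[OF fin])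
    show "{d. d \<in> nats_upto x \<and> \<not> prime d \<and> primepow d} \<subseteq> ?A"
    proof
      fix d assume d: "d \<in> {d. d \<in> nats_upto x \<and> \<not> prime d \<and> primepow d}"
      then obtain p k where pk: "prime p" "k > 0" "d = p ^ k" by (auto simp: primepow_def)
      then have "k \<noteq> 1" using d by auto
      then have k: "k \<ge> 2" using pk by simp
      have "d \<in> {1..K}" using d by (simp add: nats_upto_altdef K_def)
      moreover have "p \<le> d" using pk by (metis One_nat_def Suc_leI prime_ge_1_nat self_le_power)
      moreover have "k \<le> d" using pk by (metis less_imp_le less_exp power_mono prime_ge_2_nat zero_le order_trans)
      ultimately have "p \<in> P" "k \<in> {2..K}"
        using pk k prime_gt_0_nat[of p] by (auto simp: P_def nats_upto_altdef K_def)
      then show "d \<in> ?A" using pk by (intro image_eqI[of _ _ "(p, k)"]) auto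
    qed
  qed (auto simp: mangoldt_nonneg)
  also have "\<dots> \<le> (\<Sum>(p,k)\<in>P \<times> {2..K}. mangoldt (p ^ k) / real (p ^ k))"
    using finP sum_image_le[of "P \<times> {2..K}" "\<lambda>d. mangoldt d / real d" "\<lambda>(p,k). p ^ k"]
    by (simp add: mangoldt_nonneg case_prod_unfold o_def)
  also have "\<dots> = (\<Sum>p\<in>P. \<Sum>k=2..K. mangoldt (p ^ k) / real (p ^ k))"
    by (rule sum.Sigma [symmetric]) (use finP in auto)
  also have "\<dots> \<le> (\<Sum>p\<in>P. 4 * (1 / (real p * sqrt (real p))))"
  proof (intro sum_mono)
    fix p assume "p \<in> P"
    then have p: "prime p" "p \<ge> 2" by (auto simp: P_def prime_ge_2_nat)
    define q where "q = 1 / real p"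
    have q: "0 < q" "q \<le> 1/2" using p by (auto simp: q_def)
    have geo: "(\<Sum>k=2..K. q ^ k) \<le> 2 * q\<^sup>2"
    proof -
      have "(\<Sum>k=2..Suc m. q ^ k) \<le> 2 * q\<^sup>2 - 2 * (q ^ Suc m * q)" for m
      proof (induction m)
        case 0
        show ?case by (simp add: power2_eq_square)
      next
        case (Suc m)
        have "q ^ Suc m * q * (2 * q) \<le> q ^ Suc m * q * 1" using q by (intro mult_left_mono) auto
        moreover have "(\<Sum>k=2..Suc (Suc m). q ^ k) = (\<Sum>k=2..Suc m. q ^ k) + q ^ Suc m * q"
          by (subst sum.nat_ivl_Suc') (simp_all add: mult_ac)
        moreover have "q ^ Suc (Suc m) * q = q ^ Suc m * q * q" by (simp add: mult_ac)
        ultimately show ?case using Suc by linarith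
      qed
      note * = this[of "K - 1"]
      have "q ^ Suc (K - 1) * q \<ge> 0" using q by simp
      with * show ?thesis by (cases K) auto
    qed
    have "(\<Sum>k=2..K. mangoldt (p ^ k) / real (p ^ k)) = ln (real p) * (\<Sum>k=2..K. q ^ k)"
      unfolding sum_distrib_left using p
      by (intro sum.cong refl) (auto simp: q_def power_divide)
    also have "\<dots> \<le> (2 * sqrt (real p)) * (2 * q\<^sup>2)"
      using p q by (intro mult_mono ln_le_2sqrt geo) (auto intro: sum_nonneg)
    also have "\<dots> = 4 * (1 / (real p * sqrt (real p)))"
    proof -
      have "real p * real p = real p * sqrt (real p) * sqrt (real p)" by simp
      then show ?thesis using p by (simp add: q_def power2_eq_square field_simps)
    qed
    finally show "(\<Sum>k=2..K. mangoldt (p ^ k) / real (p ^ k)) \<le> 4 * (1 / (real p * sqrt (real p)))" .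
  qed
  also have "\<dots> \<le> (\<Sum>n=1..K. 4 * (1 / (real n * sqrt (real n))))"
    by (rule sum_mono2) (auto simp: P_def nats_upto_altdef K_def)
  also have "\<dots> \<le> 4 * 4" unfolding sum_distrib_left [symmetric]
    by (intro mult_left_mono sum_inverse_32_le) auto
  finally show ?thesis by simp
qed

text \<open>If the series converged, the primes outside a finite set \<open>F\<close> would have
  reciprocal sum at most 1/4, so the sum of \<open>ln p / p\<close> up to \<open>x\<close> would be
  at most a constant plus \<open>ln x / 4\<close>. This contradicts the lower Mertens bound, in
  which proper prime powers account for at most 16.\<close>

lemma not_summable_on_prime_inverse: "\<not> (\<lambda>p. 1 / real p) summable_on {p. prime p}"
proof
  assume sm: "(\<lambda>p. 1 / real p) summable_on {p::nat. prime p}"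
  define s where "s = infsum (\<lambda>p. 1 / real p) {p::nat. prime p}"
  have hs: "((\<lambda>p. 1 / real p) has_sum s) {p. prime p}" using sm by (simp add: s_def)
  then have "eventually (\<lambda>F. dist (\<Sum>p\<in>F. 1 / real p) s < 1/4) (finite_subsets_at_top {p. prime p})"
    unfolding has_sum_def by (rule tendstoD) simp
  then obtain F where F: "finite F" "F \<subseteq> {p. prime p}" "dist (\<Sum>p\<in>F. 1 / real p) s < 1/4"
    unfolding eventually_finite_subsets_at_top by auto
  have tail: "(\<Sum>p\<in>G. 1 / real p) \<le> 1/4" if G: "finite G" "G \<subseteq> {p. prime p}" "F \<inter> G = {}" for G
  proof -
    have "(\<Sum>p\<in>F \<union> G. 1 / real p) \<le> s"
      using F G by (intro has_sum_mono_neutral[OF has_sum_finite hs]) auto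
    then have "(\<Sum>p\<in>F. 1 / real p) + (\<Sum>p\<in>G. 1 / real p) \<le> s"
      using F G by (simp add: sum.union_disjoint)
    moreover have "\<bar>(\<Sum>p\<in>F. 1 / real p) - s\<bar> < 1/4" using F(3) by (simp only: dist_real_def)
    ultimately show ?thesis by linarith
  qed
  define c where "c = (\<Sum>p\<in>F. ln (real p) / real p)"
  \<comment> \<open>Large enough for \<open>3/4 * ln x\<close> to exceed \<open>c + 21\<close>,
    where 21 is 5 from the Mertens bound plus 16 from the prime powers.\<close>
  define x where "x = exp (2 * (c + 22))"
  have c: "c \<ge> 0" unfolding c_def using F
    by (intro sum_nonneg divide_nonneg_nonneg ln_ge_zero) (auto dest!: subsetD prime_ge_1_nat)
  have x: "x \<ge> 1" using c by (simp add: x_def)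
  define P where "P = {p. p \<in> nats_upto x \<and> prime p}"
  have finP: "finite P" unfolding P_def by (rule finite_subset[OF _ finite_nats_upto[of x]]) auto
  have "ln x - 5 \<le> (\<Sum>d\<in>nats_upto x. mangoldt d / real d)" by (rule sum_mangoldt_over_ge[OF x])
  also have "\<dots> = (\<Sum>p\<in>P. mangoldt p / real p) + (\<Sum>d | d \<in> nats_upto x \<and> \<not> prime d. mangoldt d / real d)"
    unfolding P_def by (subst sum.union_disjoint [symmetric]) (auto intro!: sum.cong)
  also have "\<dots> \<le> (\<Sum>p\<in>P. mangoldt p / real p) + 16" using sum_mangoldt_nonprime_le[of x] by simp
  also have "(\<Sum>p\<in>P. mangoldt p / real p) = (\<Sum>p\<in>P. ln (real p) / real p)"
    by (intro sum.cong) (auto simp: P_def)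
  also have "\<dots> \<le> (\<Sum>p\<in>F \<union> (P - F). ln (real p) / real p)"
    using F finP by (intro sum_mono2) (auto simp: P_def intro!: divide_nonneg_nonneg ln_ge_zero dest!: subsetD prime_ge_1_nat)
  also have "\<dots> = c + (\<Sum>p\<in>P - F. ln (real p) / real p)"
    using F finP unfolding c_def by (subst sum.union_disjoint) auto
  also have "(\<Sum>p\<in>P - F. ln (real p) / real p) \<le> (\<Sum>p\<in>P - F. ln x * (1 / real p))"
    by (intro sum_mono) (auto simp: P_def nats_upto_def intro!: divide_right_mono)
  also have "\<dots> \<le> ln x * (1/4)" unfolding sum_distrib_left [symmetric]
    using x finP by (intro mult_left_mono tail) (auto simp: P_def)
  finally have "3/4 * ln x \<le> c + 21" by simp
  then show False using c by (simp add: x_def)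
qed

text \<open>Summing the divisor identity bounds the sum of \<open>selberg d\<close> times the floor
  of \<open>x / d\<close> by \<open>x * (ln x)\<^sup>2\<close>; dropping the floor costs the sum of
  \<open>selberg d\<close>, which Selberg's formula controls. The leading coefficient 1 is
  essential: after division by \<open>(ln x)\<^sup>2\<close> the weights in Selberg's identity for
  the averages have total mass at most \<open>1 + o(1)\<close>.\<close>

lemma sum_selberg_over_le:
  obtains C where "C \<ge> 0"
    "\<And>x. x \<ge> 1 \<Longrightarrow> (\<Sum>d\<in>nats_upto x. selberg d / real d) \<le> (ln x)\<^sup>2 + 2 * ln x + C"
proof -
  obtain C where C: "C \<ge> 0"
    "\<And>x. x \<ge> 1 \<Longrightarrow> \<bar>(\<Sum>d\<in>nats_upto x. selberg d) - 2 * x * ln x\<bar> \<le> C * x"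
    using selberg_formula by blast
  show ?thesis
  proof (rule that[OF C(1)])
    fix x :: real assume x: "x \<ge> 1"
    have "x * (\<Sum>d\<in>nats_upto x. selberg d / real d) - (\<Sum>d\<in>nats_upto x. selberg d) =
      (\<Sum>d\<in>nats_upto x. selberg d * (x / real d - 1))"
      by (simp add: sum_distrib_left sum_subtractf algebra_simps)
    also have "\<dots> \<le> (\<Sum>d\<in>nats_upto x. selberg d * real (card (nats_upto (x / real d))))"
      using x by (intro sum_mono mult_left_mono selberg_nonneg card_nats_upto_ge) auto
    also have "\<dots> = (\<Sum>n\<in>nats_upto x. (ln (real n))\<^sup>2)"
      unfolding sum_dvd_card_nats_upto [symmetric]
      by (intro sum.cong refl) (auto simp: sum_selberg_dvd nats_upto_def)
    also have "\<dots> \<le> (\<Sum>n\<in>nats_upto x. (ln x)\<^sup>2)"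
      by (intro sum_mono power_mono) (auto simp: nats_upto_def)
    also have "\<dots> \<le> x * (ln x)\<^sup>2" using x by (auto intro!: mult_right_mono card_nats_upto_le)
    finally have "x * (\<Sum>d\<in>nats_upto x. selberg d / real d) \<le> x * (ln x)\<^sup>2 + (2 * x * ln x + C * x)"
      using C(2)[OF x] by (simp add: abs_le_iff)
    then have "x * (\<Sum>d\<in>nats_upto x. selberg d / real d) \<le> x * ((ln x)\<^sup>2 + 2 * ln x + C)"
      by (simp add: algebra_simps)
    then show "(\<Sum>d\<in>nats_upto x. selberg d / real d) \<le> (ln x)\<^sup>2 + 2 * ln x + C"
      by (rule mult_left_le_imp_le) (use x in auto)
  qed
qed

definition prime_or_semiprime :: "nat \<Rightarrow> bool" where
  "prime_or_semiprime d \<longleftrightarrow> prime d \<or> (\<exists>p q. prime p \<and> prime q \<and> d = p * q)"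

text \<open>Every nonzero term of \<open>selberg d\<close> for such a \<open>d\<close> contains
  \<open>mangoldt\<close> at a proper prime power. Those have weighted sum at most 16, while the
  other factor contributes \<open>ln x\<close> or a sum of at most \<open>2 * ln x\<close>; the
  total is \<open>16 * ln x + 2 * 16 * 2 * ln x\<close>, negligible against
  \<open>(ln x)\<^sup>2\<close>.\<close>

lemma sum_selberg_not_semiprime_le:
  assumes "x \<ge> 1"
  shows "(\<Sum>d | d \<in> nats_upto x \<and> \<not> prime_or_semiprime d. selberg d / real d) \<le> 80 * ln x"
proof -
  let ?B = "{d. d \<in> nats_upto x \<and> \<not> prime_or_semiprime d}"
  let ?L = "\<lambda>n. mangoldt n / real n"
  let ?N = "\<lambda>n. if prime n then 0 else ?L n"
  have N0: "?N n \<ge> 0" "?L n \<ge> 0" for n by (auto simp: mangoldt_nonneg)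
  have Nsum: "(\<Sum>n\<in>nats_upto y. ?N n) \<le> 16" for y
  proof -
    have "(\<Sum>n\<in>nats_upto y. ?N n) = (\<Sum>d | d \<in> nats_upto y \<and> \<not> prime d. ?L d)"
      by (rule sum.mono_neutral_cong_right) auto
    then show ?thesis using sum_mangoldt_nonprime_le[of y] by simp
  qed
  have finB: "finite ?B" by (rule finite_subset[OF _ finite_nats_upto[of x]]) auto
  have "selberg d / real d \<le> ?N d * ln x + (\<Sum>e | e dvd d. ?N e * ?L (d div e) + ?L e * ?N (d div e))"
    if d: "d \<in> ?B" for d
  proof -
    have d0: "d > 0" "real d \<le> x" "\<not> prime d" using d by (auto simp: nats_upto_def prime_or_semiprime_def)
    have "selberg d / real d = ?L d * ln (real d) + (\<Sum>e | e dvd d. ?L e * ?L (d div e))"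
    proof -
      have "(\<Sum>e | e dvd d. mangoldt e * mangoldt (d div e)) / real d = (\<Sum>e | e dvd d. ?L e * ?L (d div e))"
        unfolding sum_divide_distrib using d0
        by (intro sum.cong refl) (auto simp: real_of_nat_div)
      then show ?thesis by (simp add: selberg_def add_divide_distrib)
    qed
    also have "\<dots> \<le> ?N d * ln x + (\<Sum>e | e dvd d. ?N e * ?L (d div e) + ?L e * ?N (d div e))"
    proof (intro add_mono sum_mono)
      show "?L d * ln (real d) \<le> ?N d * ln x"
        using d0 N0[of d] by (simp only: if_False) (intro mult_left_mono, auto simp: mangoldt_nonneg)
    next
      fix e assume e: "e \<in> {e. e dvd d}"
      have "\<not> (prime e \<and> prime (d div e))"
      proof
        assume "prime e \<and> prime (d div e)"
        moreover have "d = e * (d div e)" using e by simp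
        ultimately show False using d unfolding prime_or_semiprime_def by blast
      qed
      then show "?L e * ?L (d div e) \<le> ?N e * ?L (d div e) + ?L e * ?N (d div e)"
      proof (cases "prime e")
        case True
        then show ?thesis using \<open>\<not> (prime e \<and> prime (d div e))\<close> by (simp only: if_True if_False simp_thms)
      next
        case False
        then show ?thesis using mult_nonneg_nonneg[OF N0(2)[of e] N0(1)[of "d div e"]]
          by (simp only: if_False)
      qed
    qed
    finally show ?thesis .
  qed
  then have "(\<Sum>d\<in>?B. selberg d / real d) \<le>
      (\<Sum>d\<in>?B. ?N d * ln x + (\<Sum>e | e dvd d. ?N e * ?L (d div e) + ?L e * ?N (d div e)))"
    by (rule sum_mono)
  also have "\<dots> \<le> (\<Sum>d\<in>nats_upto x. ?N d * ln x + (\<Sum>e | e dvd d. ?N e * ?L (d div e) + ?L e * ?N (d div e)))"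
  proof (intro sum_mono2 finite_nats_upto)
    fix d
    have "?N d * ln x \<ge> 0" using N0 assms by (intro mult_nonneg_nonneg) auto
    moreover have "(\<Sum>e | e dvd d. ?N e * ?L (d div e) + ?L e * ?N (d div e)) \<ge> 0"
      using N0 by (intro sum_nonneg add_nonneg_nonneg mult_nonneg_nonneg) auto
    ultimately show "0 \<le> ?N d * ln x + (\<Sum>e | e dvd d. ?N e * ?L (d div e) + ?L e * ?N (d div e))"
      by (rule add_nonneg_nonneg)
  qed auto
  also have "\<dots> = (\<Sum>d\<in>nats_upto x. ?N d) * ln x +
      (\<Sum>e\<in>nats_upto x. \<Sum>m\<in>nats_upto (x / real e). ?N e * ?L m + ?L e * ?N m)"
    unfolding sum.distrib[of "\<lambda>d. ?N d * ln x"] sum_distrib_right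
    using sum_dvd_nats_upto[of "\<lambda>e m. ?N e * ?L m + ?L e * ?N m" x] by simp
  also have "(\<Sum>e\<in>nats_upto x. \<Sum>m\<in>nats_upto (x / real e). ?N e * ?L m + ?L e * ?N m) \<le>
      (\<Sum>e\<in>nats_upto x. \<Sum>m\<in>nats_upto x. ?N e * ?L m + ?L e * ?N m)"
  proof (intro sum_mono sum_mono2 finite_nats_upto nats_upto_mono)
    fix e assume "e \<in> nats_upto x"
    then show "x / real e \<le> x" using assms by (auto simp: nats_upto_def field_simps)
  next
    fix e m show "0 \<le> ?N e * ?L m + ?L e * ?N m"
      using N0 by (intro add_nonneg_nonneg mult_nonneg_nonneg) auto
  qed
  also have "\<dots> = 2 * ((\<Sum>e\<in>nats_upto x. ?N e) * (\<Sum>m\<in>nats_upto x. ?L m))"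
    unfolding sum.distrib sum_product [symmetric] by (simp add: mult.commute)
  also have "(\<Sum>d\<in>nats_upto x. ?N d) * ln x + 2 * ((\<Sum>e\<in>nats_upto x. ?N e) * (\<Sum>m\<in>nats_upto x. ?L m))
      \<le> 16 * ln x + 2 * (16 * (2 * ln x))"
    using assms N0 by (intro add_mono mult_mono mult_left_mono Nsum sum_mangoldt_over_le sum_nonneg) auto
  finally show ?thesis by simp
qed

text \<open>Difference of Selberg's formula at \<open>y * exp \<delta>\<close> and at
  \<open>y\<close>: the main term is at least \<open>2 * \<delta> * y * ln y\<close>, whereas the
  errors are linear in \<open>y\<close> and are swallowed for large \<open>y\<close>, however small
  \<open>\<delta>\<close> is.\<close>

lemma sum_selberg_interval_ge:
  fixes \<delta> :: real
  assumes "\<delta> > 0"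
  obtains y0 where "y0 \<ge> 1"
    "\<And>y. y \<ge> y0 \<Longrightarrow> (\<Sum>d | d \<in> nats_upto (y * exp \<delta>) \<and> real d > y. selberg d / real d) \<ge> \<delta> * exp (-\<delta>) * ln y"
proof -
  obtain C where C: "C \<ge> 0"
    "\<And>x. x \<ge> 1 \<Longrightarrow> \<bar>(\<Sum>d\<in>nats_upto x. selberg d) - 2 * x * ln x\<bar> \<le> C * x"
    using selberg_formula by blast
  \<comment> \<open>Beyond \<open>y0\<close> the error terms use up at most half of the main
    term.\<close>
  define y0 where "y0 = exp (2 * C * exp \<delta> / \<delta>)"
  have e: "exp \<delta> \<ge> 1 + \<delta>" "exp \<delta> > 1" using exp_ge_add_one_self[of \<delta>] assms by auto
  show ?thesis
  proof (rule that[of y0])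
    show "y0 \<ge> 1" unfolding y0_def using C assms by simp
    fix y assume "y \<ge> y0"
    then have y: "y \<ge> 1" using \<open>y0 \<ge> 1\<close> by linarith
    have "ln y0 \<le> ln y" using \<open>y0 \<ge> 1\<close> \<open>y \<ge> y0\<close> by simp
    then have lny: "ln y \<ge> 2 * C * exp \<delta> / \<delta>" by (simp add: y0_def)
    define z where "z = y * exp \<delta>"
    have z: "z \<ge> y" "z > 0" using y e by (auto simp: z_def)
    define \<psi> where "\<psi> x = (\<Sum>d\<in>nats_upto x. selberg d)" for x
    have split: "\<psi> z = \<psi> y + (\<Sum>d | d \<in> nats_upto z \<and> real d > y. selberg d)"
      unfolding \<psi>_def using z
      by (subst sum.union_disjoint [symmetric])
        (auto intro!: sum.cong finite_subset[OF _ finite_nats_upto[of z]] simp: nats_upto_def)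
    have "2 * z * ln z - C * z \<le> \<psi> z" "\<psi> y \<le> 2 * y * ln y + C * y"
      using C(2)[of z] C(2)[of y] y z by (auto simp: \<psi>_def abs_le_iff)
    moreover have "z * ln z \<ge> z * ln y" using z y by (intro mult_left_mono) auto
    moreover have "C * y \<le> C * z" using C z by (intro mult_left_mono)
    ultimately have "2 * (z - y) * ln y - 2 * C * z \<le> (\<Sum>d | d \<in> nats_upto z \<and> real d > y. selberg d)"
      using split by (simp add: algebra_simps)
    moreover have "2 * (z - y) * ln y \<ge> 2 * (y * \<delta>) * ln y"
      using y mult_left_mono[OF e(1), of y] by (intro mult_right_mono) (auto simp: z_def algebra_simps)
    moreover have "2 * C * z \<le> y * \<delta> * ln y"
    proof -
      have "2 * C * z = y * \<delta> * (2 * C * exp \<delta> / \<delta>)" using assms by (simp add: z_def)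
      also have "\<dots> \<le> y * \<delta> * ln y" using y lny assms by (intro mult_left_mono) auto
      finally show ?thesis .
    qed
    ultimately have "y * \<delta> * ln y \<le> (\<Sum>d | d \<in> nats_upto z \<and> real d > y. selberg d)" by simp
    also have "\<dots> \<le> (\<Sum>d | d \<in> nats_upto z \<and> real d > y. z * (selberg d / real d))"
    proof (intro sum_mono)
      fix d assume "d \<in> {d. d \<in> nats_upto z \<and> real d > y}"
      then have d: "0 < real d" "real d \<le> z" by (auto simp: nats_upto_def)
      have "selberg d * real d \<le> selberg d * z" using d selberg_nonneg by (intro mult_left_mono)
      then show "selberg d \<le> z * (selberg d / real d)" using d by (simp add: field_simps)
    qed
    also have "\<dots> = z * (\<Sum>d | d \<in> nats_upto z \<and> real d > y. selberg d / real d)"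
      by (simp add: sum_distrib_left)
    finally have "y * \<delta> * ln y / z \<le> (\<Sum>d | d \<in> nats_upto z \<and> real d > y. selberg d / real d)"
      using z by (simp add: pos_divide_le_eq mult.commute)
    moreover have "y * \<delta> * ln y / z = \<delta> * exp (-\<delta>) * ln y"
      using y by (simp add: z_def exp_minus field_simps)
    ultimately show "(\<Sum>d | d \<in> nats_upto (y * exp \<delta>) \<and> real d > y. selberg d / real d) \<ge> \<delta> * exp (-\<delta>) * ln y"
      by (simp add: z_def)
  qed
qed

section \<open>Long runs of multiplicative cells\<close>

text \<open>Without a run of \<open>r\<close> good cells, every block of \<open>r\<close>
  consecutive cells would contain one lying entirely in \<open>B\<close>. Such a cell has mass at
  least \<open>\<delta> * exp (- \<delta>) * ln x / 2\<close>, and there are of order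
  \<open>ln x / (\<delta> * r)\<close> disjoint blocks, so \<open>B\<close> would carry more than
  \<open>\<kappa> * (ln x)\<^sup>2\<close>.\<close>

lemma run_of_good_cells:
  fixes \<delta> :: real and r :: nat
  assumes \<delta>: "\<delta> > 0" and r: "r \<ge> 1"
  obtains \<kappa> X where "\<kappa> > 0"
    "\<And>x B. x \<ge> X \<Longrightarrow> (\<Sum>d | d \<in> nats_upto x \<and> d \<in> B. selberg d / real d) \<le> \<kappa> * (ln x)\<^sup>2 \<Longrightarrow>
      \<exists>j0. real (j0 + r) * \<delta> \<le> 7/8 * ln x \<and>
        (\<forall>j\<in>{j0..<j0 + r}. \<exists>d. d \<in> nats_upto x \<and> d \<notin> B \<and> exp (real j * \<delta>) < real d \<and> real d \<le> exp (real (Suc j) * \<delta>))"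
proof -
  obtain y0 where y0: "y0 \<ge> 1"
    "\<And>y. y \<ge> y0 \<Longrightarrow> (\<Sum>d | d \<in> nats_upto (y * exp \<delta>) \<and> real d > y. selberg d / real d) \<ge> \<delta> * exp (-\<delta>) * ln y"
    using sum_selberg_interval_ge[OF \<delta>] by blast
  \<comment> \<open>Half of the mass, relative to \<open>(ln x)\<^sup>2\<close>, that the bad cells
    would have.\<close>
  define \<kappa> where "\<kappa> = exp (-\<delta>) / (32 * real r)"
  define X where "X = exp (max (2 * ln y0) (8 * \<delta> * (real r + 1)))"
  have \<kappa>: "\<kappa> > 0" using r by (simp add: \<kappa>_def)
  show ?thesis
  proof (rule that[OF \<kappa>])
    fix x B assume xX: "x \<ge> X"
      and small: "(\<Sum>d | d \<in> nats_upto x \<and> d \<in> B. selberg d / real d) \<le> \<kappa> * (ln x)\<^sup>2"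
    have "X > 0" by (simp add: X_def)
    then have x: "x > 0" using xX by linarith
    have "ln X \<le> ln x" using xX x \<open>X > 0\<close> by simp
    then have lx: "ln x \<ge> 2 * ln y0" "ln x \<ge> 8 * \<delta> * (real r + 1)"
      by (simp_all add: X_def)
    have lx0: "ln x > 0" using lx(2) \<delta> r by (smt (verit) mult_pos_pos of_nat_0_le_iff)
    define cell where "cell j = {d. d \<in> nats_upto (exp (real j * \<delta>) * exp \<delta>) \<and> real d > exp (real j * \<delta>)}" for j :: nat
    have fin_cell: "finite (cell j)" for j
      unfolding cell_def by (rule finite_subset[OF _ finite_nats_upto]) auto
    have cell_iff: "d \<in> cell j \<longleftrightarrow> exp (real j * \<delta>) < real d \<and> real d \<le> exp (real (Suc j) * \<delta>)" for d j
    proof -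
      have "exp (real j * \<delta>) * exp \<delta> = exp (real (Suc j) * \<delta>)" by (simp add: algebra_simps flip: exp_add)
      moreover have "exp (real j * \<delta>) < real d \<Longrightarrow> 0 < d"
        using exp_gt_zero[of "real j * \<delta>"] by (cases "d = 0") (auto simp del: exp_gt_zero)
      ultimately show ?thesis by (auto simp: cell_def nats_upto_def)
    qed
    \<comment> \<open>The blocks start at \<open>exp (a * \<delta>) \<ge> sqrt x\<close>, where a
      cell already has mass proportional to \<open>ln x\<close>, and end before
      \<open>x powr (7/8)\<close>, so that \<open>x / d\<close> stays at least
      \<open>x powr (1/8)\<close>.\<close>
    define a where "a = nat \<lceil>ln x / (2 * \<delta>)\<rceil>"
    define n where "n = nat \<lfloor>ln x / (4 * \<delta> * real r)\<rfloor>"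
    have a: "real a \<ge> ln x / (2 * \<delta>)" "real a \<le> ln x / (2 * \<delta>) + 1"
      using lx0 \<delta> by (auto simp: a_def)
    have n: "real n \<le> ln x / (4 * \<delta> * real r)" "real n \<ge> ln x / (4 * \<delta> * real r) - 1"
      using lx0 \<delta> r by (auto simp: n_def)
    have a': "real a * \<delta> \<ge> ln x / 2" "real a * \<delta> \<le> ln x / 2 + \<delta>"
      using a \<delta> by (simp_all add: field_simps)
    have n': "real n * real r * \<delta> \<le> ln x / 4" using n(1) \<delta> r by (simp add: field_simps)
    have "ln x / (8 * \<delta> * real r) \<ge> 1" using lx(2) \<delta> r by (simp add: field_simps)
    moreover have "ln x / (4 * \<delta> * real r) = 2 * (ln x / (8 * \<delta> * real r))" by simp
    ultimately have n'': "real n \<ge> ln x / (8 * \<delta> * real r)" using n(2) by linarith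
    have top: "real (a + n * r) * \<delta> \<le> 7/8 * ln x"
    proof -
      have "real (a + n * r) * \<delta> = real a * \<delta> + real n * real r * \<delta>" by (simp add: algebra_simps)
      moreover have "\<delta> \<le> ln x / 8" using lx(2) \<delta> r by (simp add: algebra_simps) (smt (verit) mult_nonneg_nonneg of_nat_0_le_iff)
      ultimately show ?thesis using a' n' by linarith
    qed
    show "\<exists>j0. real (j0 + r) * \<delta> \<le> 7/8 * ln x \<and>
        (\<forall>j\<in>{j0..<j0 + r}. \<exists>d. d \<in> nats_upto x \<and> d \<notin> B \<and> exp (real j * \<delta>) < real d \<and> real d \<le> exp (real (Suc j) * \<delta>))"
    proof (rule ccontr)
      assume neg: "\<not> ?thesis"
      have le: "real j * \<delta> \<le> 7/8 * ln x" if "j \<le> a + n * r" for j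
      proof -
        have "real j * \<delta> \<le> real (a + n * r) * \<delta>" using that \<delta> by (intro mult_right_mono) (simp_all only: of_nat_le_iff less_imp_le)
        then show ?thesis using top by linarith
      qed
      have in_x: "d \<in> nats_upto x" if "d \<in> cell j" "Suc j \<le> a + n * r" for d j
      proof -
        have "real d \<le> exp (real (Suc j) * \<delta>)" "exp (real j * \<delta>) < real d" using that by (auto simp: cell_iff)
        moreover have "exp (real (Suc j) * \<delta>) \<le> exp (ln x)"
          using le[OF that(2)] lx0 by (subst exp_le_cancel_iff) linarith
        ultimately have "real d \<le> x" "0 < real d" using x exp_gt_zero[of "real j * \<delta>"] by (auto simp del: exp_gt_zero)
        then show ?thesis by (simp add: nats_upto_def)
      qed
      have "\<forall>i. \<exists>j. i < n \<longrightarrow> j \<in> {a + i * r..<a + i * r + r} \<and> cell j \<subseteq> B"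
      proof
        fix i
        show "\<exists>j. i < n \<longrightarrow> j \<in> {a + i * r..<a + i * r + r} \<and> cell j \<subseteq> B"
        proof (cases "i < n")
          case True
          have i: "a + i * r + r \<le> a + n * r"
          proof -
            have "Suc i * r \<le> n * r" using True by (intro mult_le_mono1) simp
            then show ?thesis by simp
          qed
          then obtain j where j: "j \<in> {a + i * r..<a + i * r + r}"
            "\<not> (\<exists>d. d \<in> nats_upto x \<and> d \<notin> B \<and> exp (real j * \<delta>) < real d \<and> real d \<le> exp (real (Suc j) * \<delta>))"
            using neg le[OF i] by blast
          have "cell j \<subseteq> B"
          proof
            fix d assume d: "d \<in> cell j"
            have "Suc j \<le> a + n * r" using j(1) i by simp
            from in_x[OF d this] show "d \<in> B" using j(2) d unfolding cell_iff by blast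
          qed
          then show ?thesis using j(1) by blast
        qed simp
      qed
      from choice[OF this] obtain c where
        c: "\<And>i. i < n \<Longrightarrow> c i \<in> {a + i * r..<a + i * r + r}" "\<And>i. i < n \<Longrightarrow> cell (c i) \<subseteq> B" by blast
      have disj_cell: "cell j \<inter> cell k = {}" if "j < k" for j k
      proof -
        have "exp (real (Suc j) * \<delta>) \<le> exp (real k * \<delta>)" using that \<delta> by (simp only: exp_le_cancel_iff) (intro mult_right_mono, auto)
        then have "\<not> (d \<in> cell j \<and> d \<in> cell k)" for d unfolding cell_iff by linarith
        then show ?thesis by blast
      qed
      have c_mono: "c i < c k" if "i < k" "k < n" for i k
      proof -
        have "Suc i * r \<le> k * r" using that by (intro mult_le_mono1) simp
        then show ?thesis using c(1)[of i] c(1)[of k] that by simp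
      qed
      have disj: "\<forall>i\<in>{..<n}. \<forall>k\<in>{..<n}. i \<noteq> k \<longrightarrow> cell (c i) \<inter> cell (c k) = {}"
      proof (intro ballI impI)
        fix i k assume "i \<in> {..<n}" "k \<in> {..<n}" "i \<noteq> k"
        then consider "c i < c k" | "c k < c i" using c_mono by (metis lessThan_iff linorder_neqE_nat)
        then show "cell (c i) \<inter> cell (c k) = {}" using disj_cell by cases blast+
      qed
      have mass: "(\<Sum>d\<in>cell (c i). selberg d / real d) \<ge> \<delta> * exp (-\<delta>) * (ln x / 2)" if i: "i < n" for i
      proof -
        have "real a * \<delta> \<le> real (c i) * \<delta>" using c(1)[OF i] \<delta> by (intro mult_right_mono) auto
        then have ci: "ln x / 2 \<le> real (c i) * \<delta>" using a' by linarith
        have "y0 = exp (ln y0)" using y0 by simp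
        also have "\<dots> \<le> exp (real (c i) * \<delta>)" using ci lx(1) by (subst exp_le_cancel_iff) linarith
        finally have "(\<Sum>d\<in>cell (c i). selberg d / real d) \<ge> \<delta> * exp (-\<delta>) * (real (c i) * \<delta>)"
          using y0(2)[of "exp (real (c i) * \<delta>)"] by (simp add: cell_def)
        moreover have "\<delta> * exp (-\<delta>) * (real (c i) * \<delta>) \<ge> \<delta> * exp (-\<delta>) * (ln x / 2)"
          using ci \<delta> by (intro mult_left_mono) auto
        ultimately show ?thesis by linarith
      qed
      have "real n * (\<delta> * exp (-\<delta>) * (ln x / 2)) = (\<Sum>i<n. \<delta> * exp (-\<delta>) * (ln x / 2))" by simp
      also have "\<dots> \<le> (\<Sum>i<n. \<Sum>d\<in>cell (c i). selberg d / real d)" by (intro sum_mono mass) simp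
      also have "\<dots> = (\<Sum>d\<in>(\<Union>i\<in>{..<n}. cell (c i)). selberg d / real d)"
        by (rule sum.UNION_disjoint [symmetric]) (use fin_cell disj in auto)
      also have "\<dots> \<le> (\<Sum>d | d \<in> nats_upto x \<and> d \<in> B. selberg d / real d)"
      proof (rule sum_mono2)
        show "finite {d. d \<in> nats_upto x \<and> d \<in> B}" by (rule finite_subset[OF _ finite_nats_upto[of x]]) auto
        show "(\<Union>i\<in>{..<n}. cell (c i)) \<subseteq> {d. d \<in> nats_upto x \<and> d \<in> B}"
        proof
          fix d assume "d \<in> (\<Union>i\<in>{..<n}. cell (c i))"
          then obtain i where i: "i < n" "d \<in> cell (c i)" by auto
          have "Suc i * r \<le> n * r" using i by (intro mult_le_mono1) simp
          then have "Suc (c i) \<le> a + n * r" using c(1)[OF i(1)] by simp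
          then show "d \<in> {d. d \<in> nats_upto x \<and> d \<in> B}" using in_x i c(2) by blast
        qed
      qed (auto simp: selberg_nonneg)
      also have "\<dots> \<le> \<kappa> * (ln x)\<^sup>2" by (rule small)
      finally have "real n * (\<delta> * exp (-\<delta>) * (ln x / 2)) \<le> \<kappa> * (ln x)\<^sup>2" .
      moreover have "ln x / (8 * \<delta> * real r) * (\<delta> * exp (-\<delta>) * (ln x / 2)) \<le> real n * (\<delta> * exp (-\<delta>) * (ln x / 2))"
        using n'' \<delta> lx0 by (intro mult_right_mono) auto
      moreover have "ln x / (8 * \<delta> * real r) * (\<delta> * exp (-\<delta>) * (ln x / 2)) = 2 * \<kappa> * (ln x)\<^sup>2"
        using \<delta> r by (simp add: \<kappa>_def power2_eq_square)
      ultimately have "\<kappa> * (ln x)\<^sup>2 \<le> 0" by linarith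
      then show False using \<kappa> lx0 by (simp add: mult_le_0_iff)
    qed
  qed
qed

text \<open>A walk with small steps which revisits every colour only close by cannot go far: jump to the last
  visit of the current colour, then make one step.\<close>

lemma coloured_walk:
  fixes D :: "nat \<Rightarrow> nat \<Rightarrow> real" and c :: "nat \<Rightarrow> 'k"
  assumes tri: "\<And>i j k. D i k \<le> D i j + D j k"
    and same: "\<And>i j. a \<le> i \<Longrightarrow> i \<le> j \<Longrightarrow> j \<le> b \<Longrightarrow> c i = c j \<Longrightarrow> D i j \<le> 2 * e"
    and step: "\<And>i. a \<le> i \<Longrightarrow> i < b \<Longrightarrow> D i (Suc i) \<le> e"
    and "a \<le> b" and e: "e \<ge> 0"
  shows "D a b \<le> 3 * e * real (card (c ` {a..b}))"
proof -
  have "D i b \<le> 3 * e * real (card (c ` {i..b}))" if "a \<le> i" "i \<le> b" for i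
    using that
  proof (induction "b - i" arbitrary: i rule: less_induct)
    case less
    define j where "j = Max {k\<in>{i..b}. c k = c i}"
    have fin: "finite {k\<in>{i..b}. c k = c i}" by simp
    have ne: "{k\<in>{i..b}. c k = c i} \<noteq> {}" using less by auto
    have j: "i \<le> j" "j \<le> b" "c j = c i" using Max_in[OF fin ne] by (auto simp: j_def)
    have last: "k \<le> j" if "k \<in> {i..b}" "c k = c i" for k unfolding j_def using that fin by (intro Max_ge) auto
    have ij: "D i j \<le> 2 * e" using less j by (intro same) auto
    show ?case
    proof (cases "j = b")
      case True
      have "card (c ` {i..b}) \<ge> 1" using less by (simp add: Suc_le_eq card_gt_0_iff)
      then have "3 * e * 1 \<le> 3 * e * real (card (c ` {i..b}))" using e by (intro mult_left_mono) auto
      moreover have "D i b \<le> 2 * e" using ij True by simp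
      ultimately show ?thesis using e by linarith
    next
      case False
      then have "Suc j \<le> b" using j by simp
      have "D (Suc j) b \<le> 3 * e * real (card (c ` {Suc j..b}))"
        using less(1)[of "Suc j"] j less(2) \<open>Suc j \<le> b\<close> by simp
      moreover have "card (c ` {Suc j..b}) + 1 \<le> card (c ` {i..b})"
      proof -
        have "c i \<notin> c ` {Suc j..b}"
        proof
          assume "c i \<in> c ` {Suc j..b}"
          then obtain k where k: "k \<in> {Suc j..b}" "c k = c i" by force
          then show False using last[of k] j by simp
        qed
        then have "card (insert (c i) (c ` {Suc j..b})) = card (c ` {Suc j..b}) + 1" by simp
        moreover have "insert (c i) (c ` {Suc j..b}) \<subseteq> c ` {i..b}" using j less(3) by auto
        then have "card (insert (c i) (c ` {Suc j..b})) \<le> card (c ` {i..b})" by (intro card_mono) auto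
        ultimately show ?thesis by simp
      qed
      then have "3 * e * (real (card (c ` {Suc j..b})) + 1) \<le> 3 * e * real (card (c ` {i..b}))"
        using e by (intro mult_left_mono) linarith+
      moreover have "D j (Suc j) \<le> e" using j less(2) \<open>Suc j \<le> b\<close> by (intro step) auto
      moreover have "D i b \<le> D i j + D j b" "D j b \<le> D j (Suc j) + D (Suc j) b" by (rule tri)+
      ultimately show ?thesis using ij by (simp add: algebra_simps)
    qed
  qed
  then show ?thesis using \<open>a \<le> b\<close> by blast
qed

section \<open>The Turan--Kubilius inequality\<close>

definition num_divisors_in :: "nat set \<Rightarrow> nat \<Rightarrow> real" where
  "num_divisors_in Q n = real (card {p\<in>Q. p dvd n})"

lemma num_divisors_in_altdef:
  "finite Q \<Longrightarrow> num_divisors_in Q n = (\<Sum>p\<in>Q. if p dvd n then 1 else 0)"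
  by (simp add: num_divisors_in_def sum.inter_filter [symmetric])

lemma sum_multiples_nats_upto:
  fixes f :: "nat \<Rightarrow> 'b::comm_monoid_add"
  assumes "p > 0"
  shows "(\<Sum>n\<in>nats_upto x. if p dvd n then f n else 0) = (\<Sum>m\<in>nats_upto (x / real p). f (p * m))"
proof -
  have "(\<Sum>n\<in>nats_upto x. if p dvd n then f n else 0) = (\<Sum>n | n \<in> nats_upto x \<and> p dvd n. f n)"
    by (simp add: sum.inter_filter)
  also have "\<dots> = (\<Sum>m\<in>nats_upto (x / real p). f (p * m))"
    by (rule sum.reindex_bij_witness[where i = "\<lambda>m. p * m" and j = "\<lambda>n. n div p"])
       (use assms in \<open>auto simp: nats_upto_def field_simps\<close>)
  finally show ?thesis .
qed

text \<open>The number of prime divisors in \<open>Q\<close> has mean square deviation at most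
  \<open>3 * L\<close> from \<open>L\<close>, since for distinct primes at most
  \<open>x / (p * q)\<close> numbers are divisible by both. Cauchy--Schwarz passes to the first
  moment. The rounding errors of the mean add up to \<open>card Q\<close>, which
  \<open>x \<ge> card Q\<close> absorbs.\<close>

lemma turan_kubilius:
  fixes Q :: "nat set"
  assumes fin: "finite Q" and prime: "\<And>p. p \<in> Q \<Longrightarrow> prime p"
    and L: "L = (\<Sum>p\<in>Q. 1 / real p)" "L > 0" and x: "x \<ge> real (card Q)" "x \<ge> 1"
  shows "(\<Sum>n\<in>nats_upto x. \<bar>1 - num_divisors_in Q n / L\<bar>) \<le> 2 * x / sqrt L"
proof -
  let ?\<omega> = "num_divisors_in Q"
  let ?N = "real (card (nats_upto x))"
  have mult: "(\<Sum>n\<in>nats_upto x. if d dvd n then 1 else 0) = real (card (nats_upto (x / real d)))"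
    if "d > 0" for d :: nat
    using sum_multiples_nats_upto[OF that, of "\<lambda>_. 1::real" x] by simp
  have s1: "(\<Sum>n\<in>nats_upto x. ?\<omega> n) \<ge> x * L - real (card Q)"
  proof -
    have "x * L - real (card Q) = (\<Sum>p\<in>Q. x / real p - 1)"
      by (simp add: L sum_subtractf sum_distrib_left)
    also have "\<dots> \<le> (\<Sum>p\<in>Q. real (card (nats_upto (x / real p))))"
      using x by (intro sum_mono card_nats_upto_ge) auto
    also have "\<dots> = (\<Sum>p\<in>Q. \<Sum>n\<in>nats_upto x. if p dvd n then 1 else 0)"
      using prime by (intro sum.cong refl mult [symmetric]) (auto simp: prime_gt_0_nat)
    also have "\<dots> = (\<Sum>n\<in>nats_upto x. ?\<omega> n)"
      by (subst sum.swap) (simp add: num_divisors_in_altdef fin)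
    finally show ?thesis .
  qed
  have s2: "(\<Sum>n\<in>nats_upto x. (?\<omega> n)\<^sup>2) \<le> x * L\<^sup>2 + x * L"
  proof -
    have "(\<Sum>n\<in>nats_upto x. (?\<omega> n)\<^sup>2) =
        (\<Sum>n\<in>nats_upto x. \<Sum>p\<in>Q. \<Sum>q\<in>Q. (if p dvd n then 1 else 0) * (if q dvd n then 1 else 0))"
      by (simp add: num_divisors_in_altdef fin power2_eq_square sum_product)
    also have "\<dots> = (\<Sum>p\<in>Q. \<Sum>n\<in>nats_upto x. \<Sum>q\<in>Q. (if p dvd n then 1 else 0) * (if q dvd n then 1 else 0))"
      by (rule sum.swap)
    also have "\<dots> = (\<Sum>p\<in>Q. \<Sum>q\<in>Q. \<Sum>n\<in>nats_upto x. (if p dvd n then 1 else 0) * (if q dvd n then 1 else 0))"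
      by (rule sum.cong[OF refl]) (rule sum.swap)
    also have "\<dots> \<le> (\<Sum>p\<in>Q. \<Sum>q\<in>Q. x * (1 / real p) * (1 / real q) + (if p = q then x * (1 / real p) else 0))"
    proof (intro sum_mono)
      fix p q assume pq: "p \<in> Q" "q \<in> Q"
      then have pos: "p > 0" "q > 0" "prime p" "prime q" using prime by (auto simp: prime_gt_0_nat)
      show "(\<Sum>n\<in>nats_upto x. (if p dvd n then 1 else 0) * (if q dvd n then 1 else 0))
        \<le> x * (1 / real p) * (1 / real q) + (if p = q then x * (1 / real p) else 0)"
      proof (cases "p = q")
        case True
        have "(\<Sum>n\<in>nats_upto x. (if p dvd n then 1 else 0) * (if q dvd n then 1 else 0)) =
            (\<Sum>n\<in>nats_upto x. if p dvd n then 1 else (0::real))"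
          using True by (intro sum.cong) auto
        also have "\<dots> \<le> x / real p" unfolding mult[OF pos(1)] using x by (intro card_nats_upto_le) auto
        also have "\<dots> \<le> x * (1 / real p) * (1 / real q) + x * (1 / real p)" using x by simp
        finally show ?thesis using True by simp
      next
        case False
        then have cop: "coprime p q" using pos by (intro primes_coprime)
        have "(\<Sum>n\<in>nats_upto x. (if p dvd n then 1 else 0) * (if q dvd n then 1 else 0)) =
            (\<Sum>n\<in>nats_upto x. if p * q dvd n then 1 else (0::real))"
          using cop by (intro sum.cong refl) (auto simp: divides_mult dest: dvd_mult_left dvd_mult_right)
        also have "\<dots> \<le> x / real (p * q)"
          using mult[of "p * q"] pos x by (auto intro!: card_nats_upto_le)
        finally show ?thesis using False by simp
      qed
    qed
    also have "\<dots> = x * L\<^sup>2 + x * L"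
    proof -
      have "(\<Sum>p\<in>Q. \<Sum>q\<in>Q. x * (1 / real p) * (1 / real q)) = x * L * L"
        unfolding L(1) by (simp add: sum_distrib_left sum_distrib_right mult_ac)
      moreover have "(\<Sum>p\<in>Q. \<Sum>q\<in>Q. if p = q then x * (1 / real p) else 0) = x * L"
        unfolding L(1) by (simp add: sum_distrib_left fin)
      ultimately show ?thesis by (simp add: sum.distrib power2_eq_square)
    qed
    finally show ?thesis .
  qed
  have N: "?N \<le> x" using x by (intro card_nats_upto_le) simp
  have "(\<Sum>n\<in>nats_upto x. (1 - ?\<omega> n / L)\<^sup>2) * L\<^sup>2 = (\<Sum>n\<in>nats_upto x. L\<^sup>2 - 2 * L * ?\<omega> n + (?\<omega> n)\<^sup>2)"
    unfolding sum_distrib_right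
  proof (rule sum.cong[OF refl])
    fix n
    have "(1 - ?\<omega> n / L) * L = L - ?\<omega> n" using L(2) by (simp add: left_diff_distrib)
    then have "(1 - ?\<omega> n / L)\<^sup>2 * L\<^sup>2 = (L - ?\<omega> n)\<^sup>2" by (simp flip: power_mult_distrib)
    then show "(1 - ?\<omega> n / L)\<^sup>2 * L\<^sup>2 = L\<^sup>2 - 2 * L * ?\<omega> n + (?\<omega> n)\<^sup>2"
      by (simp add: power2_diff)
  qed
  also have "\<dots> = ?N * L\<^sup>2 - 2 * L * (\<Sum>n\<in>nats_upto x. ?\<omega> n) + (\<Sum>n\<in>nats_upto x. (?\<omega> n)\<^sup>2)"
    by (simp add: sum.distrib sum_subtractf sum_distrib_left)
  also have "\<dots> \<le> x * L\<^sup>2 - 2 * L * (x * L - real (card Q)) + (x * L\<^sup>2 + x * L)"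
  proof -
    have "?N * L\<^sup>2 \<le> x * L\<^sup>2" using N by (rule mult_right_mono) simp
    moreover have "2 * L * (x * L - real (card Q)) \<le> 2 * L * (\<Sum>n\<in>nats_upto x. ?\<omega> n)"
      using s1 L(2) by (intro mult_left_mono) auto
    ultimately show ?thesis using s2 by linarith
  qed
  also have "\<dots> = x * L + 2 * L * real (card Q)" by (simp add: algebra_simps power2_eq_square)
  also have "\<dots> \<le> x * L + 2 * L * x" using x L(2) by (intro add_mono mult_left_mono) auto
  finally have "(\<Sum>n\<in>nats_upto x. (1 - ?\<omega> n / L)\<^sup>2) * L\<^sup>2 \<le> (3 * x / L) * L\<^sup>2"
    using L(2) by (simp add: power2_eq_square)
  then have var: "(\<Sum>n\<in>nats_upto x. (1 - ?\<omega> n / L)\<^sup>2) \<le> 3 * x / L"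
    by (rule mult_right_le_imp_le) (use L(2) in simp)
  have "(\<Sum>n\<in>nats_upto x. \<bar>1 - ?\<omega> n / L\<bar>)\<^sup>2 \<le> (\<Sum>n\<in>nats_upto x. \<bar>1 - ?\<omega> n / L\<bar>\<^sup>2) * (\<Sum>n\<in>nats_upto x. 1\<^sup>2)"
    using Cauchy_Schwarz_ineq_sum[of "\<lambda>n. \<bar>1 - ?\<omega> n / L\<bar>" "\<lambda>_. 1" "nats_upto x"] by simp
  also have "\<dots> \<le> (3 * x / L) * x" using var N x L(2) by (intro mult_mono) auto
  also have "\<dots> = 3 * x\<^sup>2 / L" by (simp add: power2_eq_square)
  also have "\<dots> \<le> 4 * x\<^sup>2 / L" using L(2) by (intro divide_right_mono) auto
  also have "\<dots> = (2 * x / sqrt L)\<^sup>2" using L(2) by (simp add: power_divide power_mult_distrib)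
  finally show ?thesis by (rule power2_le_imp_le) (use L(2) x in auto)
qed

section \<open>The space of square integrable functions\<close>

text \<open>This is the real part of the Hermitian inner product, because \<open>\<bullet>\<close>
  on \<open>complex\<close> is real-valued. The Hilbert space arguments run over the reals.\<close>

definition L2_inner :: "'a measure \<Rightarrow> ('a \<Rightarrow> complex) \<Rightarrow> ('a \<Rightarrow> complex) \<Rightarrow> real" where
  "L2_inner M f g = (\<integral>x. f x \<bullet> g x \<partial>M)"

lemma L2_fun_measurable [measurable_dest]: "L2_fun M f \<Longrightarrow> f \<in> borel_measurable M"
  by (simp add: L2_fun_def)

lemma L2_fun_integrable_sq: "L2_fun M f \<Longrightarrow> integrable M (\<lambda>x. (norm (f x))\<^sup>2)"
  by (simp add: L2_fun_def)

lemma norm_add_sq_le: "(norm (a + b))\<^sup>2 \<le> 2 * (norm a)\<^sup>2 + 2 * (norm (b :: complex))\<^sup>2"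
proof -
  have "(norm (a + b))\<^sup>2 \<le> (norm a + norm b)\<^sup>2" by (intro power_mono norm_triangle_ineq) auto
  also have "\<dots> \<le> 2 * (norm a)\<^sup>2 + 2 * (norm b)\<^sup>2"
    using zero_le_power2[of "norm a - norm b"] by (simp add: power2_eq_square algebra_simps)
  finally show ?thesis .
qed

lemma L2_fun_add [intro]:
  assumes "L2_fun M f" "L2_fun M g"
  shows "L2_fun M (\<lambda>x. f x + g x)"
  unfolding L2_fun_def
proof
  have [measurable]: "f \<in> borel_measurable M" "g \<in> borel_measurable M"
    using assms by (auto simp: L2_fun_def)
  show "(\<lambda>x. f x + g x) \<in> borel_measurable M" by measurable
  show "integrable M (\<lambda>x. (norm (f x + g x))\<^sup>2)"
    by (rule Bochner_Integration.integrable_bound[of M "\<lambda>x. 2 * (norm (f x))\<^sup>2 + 2 * (norm (g x))\<^sup>2"])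
       (use assms in \<open>auto simp: L2_fun_def norm_add_sq_le\<close>)
qed

lemma L2_fun_cmult [intro]: "L2_fun M f \<Longrightarrow> L2_fun M (\<lambda>x. c * f x)"
  by (auto simp: L2_fun_def norm_mult power_mult_distrib)

lemma L2_fun_scaleR [intro]: "L2_fun M f \<Longrightarrow> L2_fun M (\<lambda>x. c *\<^sub>R f x)"
  by (auto simp: L2_fun_def power_mult_distrib)

lemma L2_fun_diff [intro]: "L2_fun M f \<Longrightarrow> L2_fun M g \<Longrightarrow> L2_fun M (\<lambda>x. f x - g x)"
  using L2_fun_add[of M f "\<lambda>x. -1 * g x"] L2_fun_cmult[of M g "-1"] by simp

lemma L2_fun_zero [simp, intro]: "L2_fun M (\<lambda>_. 0)"
  by (simp add: L2_fun_def)

lemma L2_fun_sum [intro]: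
  "(\<And>i. i \<in> I \<Longrightarrow> L2_fun M (f i)) \<Longrightarrow> L2_fun M (\<lambda>x. \<Sum>i\<in>I. f i x)"
  by (induction I rule: infinite_finite_induct) (auto intro: L2_fun_add)

lemma integrable_inner:
  assumes "L2_fun M f" "L2_fun M g"
  shows "integrable M (\<lambda>x. f x \<bullet> g x)"
proof (rule Bochner_Integration.integrable_bound[of M "\<lambda>x. (norm (f x))\<^sup>2 + (norm (g x))\<^sup>2"])
  have [measurable]: "f \<in> borel_measurable M" "g \<in> borel_measurable M"
    using assms by (auto simp: L2_fun_def)
  show "integrable M (\<lambda>x. (norm (f x))\<^sup>2 + (norm (g x))\<^sup>2)" using assms by (auto simp: L2_fun_def)
  show "(\<lambda>x. f x \<bullet> g x) \<in> borel_measurable M" by measurable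
  have "\<bar>a \<bullet> b\<bar> \<le> (norm a)\<^sup>2 + (norm b)\<^sup>2" for a b :: complex
  proof -
    have "\<bar>a \<bullet> b\<bar> \<le> norm a * norm b" by (rule Cauchy_Schwarz_ineq2)
    also have "\<dots> \<le> (norm a)\<^sup>2 + (norm b)\<^sup>2"
    proof -
      have "0 \<le> norm a * norm b" by simp
      then show ?thesis using sum_squares_bound[of "norm a" "norm b"] by linarith
    qed
    finally show ?thesis .
  qed
  then show "AE x in M. norm (f x \<bullet> g x) \<le> norm ((norm (f x))\<^sup>2 + (norm (g x))\<^sup>2)" by simp
qed

lemma L2_inner_commute: "L2_inner M f g = L2_inner M g f"
  by (simp add: L2_inner_def inner_commute)

lemma L2_inner_add_left:
  "L2_fun M f \<Longrightarrow> L2_fun M g \<Longrightarrow> L2_fun M h \<Longrightarrow>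
    L2_inner M (\<lambda>x. f x + g x) h = L2_inner M f h + L2_inner M g h"
  by (simp add: L2_inner_def inner_add_left integrable_inner)

lemma L2_inner_add_right:
  "L2_fun M f \<Longrightarrow> L2_fun M g \<Longrightarrow> L2_fun M h \<Longrightarrow>
    L2_inner M h (\<lambda>x. f x + g x) = L2_inner M h f + L2_inner M h g"
  by (simp add: L2_inner_def inner_add_right integrable_inner)

lemma L2_inner_diff_left:
  "L2_fun M f \<Longrightarrow> L2_fun M g \<Longrightarrow> L2_fun M h \<Longrightarrow>
    L2_inner M (\<lambda>x. f x - g x) h = L2_inner M f h - L2_inner M g h"
  by (simp add: L2_inner_def inner_diff_left integrable_inner)

lemma L2_inner_diff_right:
  "L2_fun M f \<Longrightarrow> L2_fun M g \<Longrightarrow> L2_fun M h \<Longrightarrow>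
    L2_inner M h (\<lambda>x. f x - g x) = L2_inner M h f - L2_inner M h g"
  by (simp add: L2_inner_def inner_diff_right integrable_inner)

lemma L2_inner_scaleR_left: "L2_inner M (\<lambda>x. c *\<^sub>R f x) g = c * L2_inner M f g"
  by (simp add: L2_inner_def)

lemma L2_inner_scaleR_right: "L2_inner M g (\<lambda>x. c *\<^sub>R f x) = c * L2_inner M g f"
  by (simp add: L2_inner_def)

lemma L2_inner_sum_left:
  "(\<And>i. i \<in> I \<Longrightarrow> L2_fun M (f i)) \<Longrightarrow> L2_fun M h \<Longrightarrow>
    L2_inner M (\<lambda>x. \<Sum>i\<in>I. f i x) h = (\<Sum>i\<in>I. L2_inner M (f i) h)"
  by (simp add: L2_inner_def inner_sum_left integrable_inner)

lemma L2_inner_sum_right: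
  "(\<And>i. i \<in> I \<Longrightarrow> L2_fun M (f i)) \<Longrightarrow> L2_fun M h \<Longrightarrow>
    L2_inner M h (\<lambda>x. \<Sum>i\<in>I. f i x) = (\<Sum>i\<in>I. L2_inner M h (f i))"
  by (simp add: L2_inner_def inner_sum_right integrable_inner)

lemma L2_norm_nonneg [simp]: "L2_norm M f \<ge> 0"
  by (simp add: L2_norm_def)

lemma L2_norm_sq: "(L2_norm M f)\<^sup>2 = L2_inner M f f"
  by (simp add: L2_norm_def L2_inner_def power2_norm_eq_inner)

lemma L2_norm_zero [simp]: "L2_norm M (\<lambda>_. 0) = 0"
  by (simp add: L2_norm_def)

lemma L2_norm_minus [simp]: "L2_norm M (\<lambda>x. - f x) = L2_norm M f"
  by (simp add: L2_norm_def)

lemma L2_norm_scaleR: "L2_norm M (\<lambda>x. c *\<^sub>R f x) = \<bar>c\<bar> * L2_norm M f"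
  by (simp add: L2_norm_def power_mult_distrib real_sqrt_mult)

lemma L2_norm_diff_sq:
  assumes "L2_fun M f" "L2_fun M g"
  shows "(L2_norm M (\<lambda>x. f x - g x))\<^sup>2 = (L2_norm M f)\<^sup>2 - 2 * L2_inner M f g + (L2_norm M g)\<^sup>2"
  using assms by (simp add: L2_norm_sq L2_inner_diff_left L2_inner_diff_right L2_fun_diff
      L2_inner_commute[of M g f])

lemma L2_norm_add_sq:
  assumes "L2_fun M f" "L2_fun M g"
  shows "(L2_norm M (\<lambda>x. f x + g x))\<^sup>2 = (L2_norm M f)\<^sup>2 + 2 * L2_inner M f g + (L2_norm M g)\<^sup>2"
  using assms by (simp add: L2_norm_sq L2_inner_add_left L2_inner_add_right L2_fun_add
      L2_inner_commute[of M g f])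

lemma L2_Cauchy_Schwarz:
  assumes "L2_fun M f" "L2_fun M g"
  shows "\<bar>L2_inner M f g\<bar> \<le> L2_norm M f * L2_norm M g"
proof -
  define p a b where "p = L2_inner M f g" and "a = (L2_norm M f)\<^sup>2" and "b = (L2_norm M g)\<^sup>2"
  have nonneg: "a - 2 * t * p + t\<^sup>2 * b \<ge> 0" for t
  proof -
    have "0 \<le> (L2_norm M (\<lambda>x. f x - t *\<^sub>R g x))\<^sup>2" by simp
    also have "\<dots> = a - 2 * t * p + t\<^sup>2 * b"
      using assms by (subst L2_norm_diff_sq)
        (auto simp: L2_inner_scaleR_right L2_norm_scaleR power_mult_distrib a_def b_def p_def)
    finally show ?thesis .
  qed
  have "p\<^sup>2 \<le> a * b"
  \<comment> \<open>If \<open>b = 0\<close>, the expression in \<open>nonneg\<close> is affine in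
    \<open>t\<close> and bounded below, which forces \<open>p = 0\<close>; otherwise its minimum is
    at \<open>t = p / b\<close>.\<close>
  proof (cases "b = 0")
    case True
    have "p = 0"
    proof (rule ccontr)
      assume "p \<noteq> 0"
      then show False using nonneg[of "(a + 1) / (2 * p)"] True by (simp add: a_def)
    qed
    then show ?thesis by (simp add: a_def b_def)
  next
    case False
    then have "b > 0" by (simp add: b_def)
    have "0 \<le> (a - 2 * (p / b) * p + (p / b)\<^sup>2 * b) * b"
      using nonneg[of "p / b"] \<open>b > 0\<close> by (intro mult_nonneg_nonneg) auto
    also have "\<dots> = a * b - p\<^sup>2" using \<open>b > 0\<close> by (simp add: field_simps power2_eq_square)
    finally show ?thesis by simp
  qed
  then have "\<bar>p\<bar>\<^sup>2 \<le> (L2_norm M f * L2_norm M g)\<^sup>2" by (simp add: a_def b_def power_mult_distrib)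
  then show ?thesis unfolding p_def by (rule power2_le_imp_le) simp
qed

lemma L2_norm_add_le:
  assumes "L2_fun M f" "L2_fun M g"
  shows "L2_norm M (\<lambda>x. f x + g x) \<le> L2_norm M f + L2_norm M g"
proof (rule power2_le_imp_le)
  show "(L2_norm M (\<lambda>x. f x + g x))\<^sup>2 \<le> (L2_norm M f + L2_norm M g)\<^sup>2"
    using L2_Cauchy_Schwarz[OF assms] by (simp add: L2_norm_add_sq[OF assms] power2_sum abs_le_iff)
qed simp

lemma L2_norm_minus_commute: "L2_norm M (\<lambda>x. f x - g x) = L2_norm M (\<lambda>x. g x - f x)"
  by (simp add: L2_norm_def norm_minus_commute)

lemma L2_norm_triangle:
  assumes "L2_fun M f" "L2_fun M g" "L2_fun M h"
  shows "L2_norm M (\<lambda>x. f x - h x) \<le> L2_norm M (\<lambda>x. f x - g x) + L2_norm M (\<lambda>x. g x - h x)"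
  using L2_norm_add_le[of M "\<lambda>x. f x - g x" "\<lambda>x. g x - h x"] assms by (simp add: L2_fun_diff)

lemma L2_norm_diff_le:
  assumes "L2_fun M f" "L2_fun M g"
  shows "L2_norm M (\<lambda>x. f x - g x) \<le> L2_norm M f + L2_norm M g"
  using L2_norm_triangle[of M f "\<lambda>_. 0" g] assms by (simp add: L2_norm_minus_commute[of M "\<lambda>_. 0"])

lemma L2_norm_diff_ge:
  assumes "L2_fun M f" "L2_fun M g"
  shows "L2_norm M f - L2_norm M g \<le> L2_norm M (\<lambda>x. f x - g x)"
  using L2_norm_triangle[of M f g "\<lambda>_. 0"] assms by simp

lemma L2_norm_sum_le:
  "(\<And>i. i \<in> I \<Longrightarrow> L2_fun M (f i)) \<Longrightarrow> L2_norm M (\<lambda>x. \<Sum>i\<in>I. f i x) \<le> (\<Sum>i\<in>I. L2_norm M (f i))"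
proof (induction I rule: infinite_finite_induct)
  case (insert i I)
  then show ?case
    using L2_norm_add_le[of M "f i" "\<lambda>x. \<Sum>i\<in>I. f i x"] L2_fun_sum[of I M f] by force
qed auto

lemma L2_norm_mono_AE:
  assumes "AE x in M. norm (f x) \<le> norm (g x)" "f \<in> borel_measurable M" "L2_fun M g"
  shows "L2_norm M f \<le> L2_norm M g" and "L2_fun M f"
proof -
  have *: "AE x in M. (norm (f x))\<^sup>2 \<le> (norm (g x))\<^sup>2"
    using assms(1) by eventually_elim (auto intro: power_mono)
  show "L2_fun M f" unfolding L2_fun_def
  proof
    show "integrable M (\<lambda>x. (norm (f x))\<^sup>2)"
      by (rule Bochner_Integration.integrable_bound[OF L2_fun_integrable_sq[OF assms(3)]])
         (use assms * in auto)
  qed fact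
  then show "L2_norm M f \<le> L2_norm M g" unfolding L2_norm_def
    by (intro real_sqrt_le_mono integral_mono_AE * L2_fun_integrable_sq assms)
qed

lemma L2_norm_cong_AE:
  assumes "AE x in M. f x = g x" "f \<in> borel_measurable M" "g \<in> borel_measurable M"
  shows "L2_norm M f = L2_norm M g"
  unfolding L2_norm_def using assms by (intro arg_cong[of _ _ sqrt] integral_cong_AE) auto

lemma L2_norm_eq_0_iff:
  assumes "L2_fun M f"
  shows "L2_norm M f = 0 \<longleftrightarrow> (AE x in M. f x = 0)"
  unfolding L2_norm_def using integral_nonneg_eq_0_iff_AE[OF L2_fun_integrable_sq[OF assms]] by simp

section \<open>Square integrable functions on a probability space\<close>

context prob_space
begin

lemma L2_fun_const [simp, intro]: "L2_fun M (\<lambda>_. c)"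
  by (simp add: L2_fun_def)

lemma L2_norm_const [simp]: "L2_norm M (\<lambda>_. c) = norm c"
  by (simp add: L2_norm_def prob_space)

lemma L2_fun_integrable:
  assumes "L2_fun M f"
  shows "integrable M f"
proof (rule Bochner_Integration.integrable_bound[of M "\<lambda>x. 1 + (norm (f x))\<^sup>2"])
  have "a \<le> 1 + a\<^sup>2" for a :: real
    using zero_le_power2[of "a - 1/2"] by (simp add: power2_eq_square algebra_simps)
  then show "AE x in M. norm (f x) \<le> norm (1 + (norm (f x))\<^sup>2)" by simp
qed (use assms in \<open>auto simp: L2_fun_def\<close>)

lemma integral_norm_le_L2_norm:
  assumes "L2_fun M f"
  shows "(\<integral>x. norm (f x) \<partial>M) \<le> L2_norm M f"
proof -
  define g where "g x = complex_of_real (norm (f x))" for x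
  have g: "L2_fun M g" "L2_norm M g = L2_norm M f"
    using assms by (auto simp: L2_fun_def g_def[abs_def] L2_norm_def)
  have "(\<integral>x. norm (f x) \<partial>M) = L2_inner M g (\<lambda>_. 1)"
    by (simp add: L2_inner_def g_def inner_complex_def)
  also have "\<dots> \<le> L2_norm M g * L2_norm M (\<lambda>_. 1)"
    using L2_Cauchy_Schwarz[OF g(1), of "\<lambda>_. 1"] by simp
  finally show ?thesis using g by simp
qed

lemma norm_integral_le_L2_norm:
  assumes "L2_fun M f"
  shows "norm (\<integral>x. f x \<partial>M) \<le> L2_norm M f"
  using integral_norm_bound[of M f] integral_norm_le_L2_norm[OF assms] by (rule order_trans)

lemma Linf_imp_L2_fun: "Linf_fun M f \<Longrightarrow> L2_fun M f"
proof -
  assume "Linf_fun M f"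
  then obtain C where C: "f \<in> borel_measurable M" "AE x in M. norm (f x) \<le> C"
    by (auto simp: Linf_fun_def)
  have "AE x in M. norm (f x) \<le> norm (complex_of_real C)" using C(2) by eventually_elim simp
  from L2_norm_mono_AE(2)[OF this C(1) L2_fun_const] show ?thesis .
qed

lemma L2_mult_bounded:
  assumes "L2_fun M f" "g \<in> borel_measurable M" "AE x in M. norm (g x) \<le> C"
  shows "L2_fun M (\<lambda>x. f x * g x)" and "L2_norm M (\<lambda>x. f x * g x) \<le> C * L2_norm M f"
proof -
  have [measurable]: "f \<in> borel_measurable M" "g \<in> borel_measurable M" using assms by auto
  have "C \<ge> 0"
  proof -
    have "AE x in M. 0 \<le> C" using assms(3) by eventually_elim (meson norm_ge_zero order_trans)
    then show ?thesis by simp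
  qed
  have *: "AE x in M. norm (f x * g x) \<le> norm (C *\<^sub>R f x)"
    using assms(3) by eventually_elim
      (use \<open>C \<ge> 0\<close> in \<open>simp add: norm_mult mult.commute[of "norm (f _)"] mult_right_mono\<close>)
  have m: "(\<lambda>x. f x * g x) \<in> borel_measurable M" by measurable
  show "L2_fun M (\<lambda>x. f x * g x)" "L2_norm M (\<lambda>x. f x * g x) \<le> C * L2_norm M f"
    using L2_norm_mono_AE[OF * m] assms \<open>C \<ge> 0\<close> by (auto simp: L2_norm_scaleR)
qed

text \<open>Riesz--Fischer for geometric steps, the form used for projections. On a probability
  space the steps are also summable in \<open>L1\<close>, so the sequence converges almost
  everywhere, and Fatou's lemma bounds the distance to the limit.\<close>

lemma L2_complete:
  assumes f: "\<And>n. L2_fun M (f n)"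
    and step: "\<And>n. L2_norm M (\<lambda>x. f (Suc n) x - f n x) \<le> (1/2) ^ n"
  obtains g where "L2_fun M g" "\<And>n. L2_norm M (\<lambda>x. f n x - g x) \<le> 2 * (1/2) ^ n"
proof -
  have [measurable]: "f n \<in> borel_measurable M" for n using f by (rule L2_fun_measurable)
  have dist: "L2_norm M (\<lambda>x. f n x - f (n + k) x) \<le> 2 * (1/2) ^ n - 2 * (1/2) ^ (n + k)" for n k
  proof (induction k)
    case (Suc k)
    have "L2_norm M (\<lambda>x. f n x - f (n + Suc k) x) \<le>
        L2_norm M (\<lambda>x. f n x - f (n + k) x) + L2_norm M (\<lambda>x. f (n + k) x - f (n + Suc k) x)"
      by (rule L2_norm_triangle) (rule f)+
    also have "\<dots> \<le> (2 * (1/2) ^ n - 2 * (1/2) ^ (n + k)) + (1/2) ^ (n + k)"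
      using Suc step[of "n + k"] L2_norm_minus_commute[of M "f (n + k)" "f (n + Suc k)"]
      by (intro add_mono) simp_all
    finally show ?case by simp
  qed simp
  have dist': "L2_norm M (\<lambda>x. f n x - f m x) \<le> 2 * (1/2) ^ n" if "m \<ge> n" for n m
  proof -
    define k where "k = m - n"
    have "m = n + k" using that by (simp add: k_def)
    then have "L2_norm M (\<lambda>x. f n x - f m x) \<le> 2 * (1/2) ^ n - 2 * (1/2) ^ (n + k)"
      using dist[of n k] by (simp only:)
    also have "\<dots> \<le> 2 * (1/2) ^ n" by simp
    finally show ?thesis .
  qed
  have "(\<integral>\<^sup>+x. (\<Sum>n. ennreal (norm (f (Suc n) x - f n x))) \<partial>M) =
        (\<Sum>n. \<integral>\<^sup>+x. ennreal (norm (f (Suc n) x - f n x)) \<partial>M)"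
    by (rule nn_integral_suminf) measurable
  also have "\<dots> \<le> (\<Sum>n. ennreal ((1/2) ^ n))"
  proof (intro suminf_le)
    fix n
    have "(\<integral>\<^sup>+x. ennreal (norm (f (Suc n) x - f n x)) \<partial>M) =
      ennreal (\<integral>x. norm (f (Suc n) x - f n x) \<partial>M)"
      by (intro nn_integral_eq_integral integrable_norm L2_fun_integrable L2_fun_diff f) auto
    also have "\<dots> \<le> ennreal ((1/2) ^ n)"
      using integral_norm_le_L2_norm[OF L2_fun_diff[OF f f], of "Suc n" n] step[of n]
      by (intro ennreal_leI) linarith
    finally show "(\<integral>\<^sup>+x. ennreal (norm (f (Suc n) x - f n x)) \<partial>M) \<le> ennreal ((1/2) ^ n)" .
  qed auto
  also have "\<dots> = ennreal (\<Sum>n. (1/2) ^ n)"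
    by (rule suminf_ennreal2) (simp_all add: summable_geometric)
  also have "\<dots> < top" by (rule ennreal_less_top)
  finally have fin: "(\<integral>\<^sup>+x. (\<Sum>n. ennreal (norm (f (Suc n) x - f n x))) \<partial>M) \<noteq> \<infinity>"
    unfolding infinity_ennreal_def by (rule order.strict_implies_not_eq)
  have "AE x in M. (\<Sum>n. ennreal (norm (f (Suc n) x - f n x))) \<noteq> \<infinity>"
    by (rule nn_integral_PInf_AE[OF _ fin]) measurable
  then have conv: "AE x in M. convergent (\<lambda>n. f n x)"
  proof eventually_elim
    case (elim x)
    then have "summable (\<lambda>n. norm (f (Suc n) x - f n x))"
      by (intro summable_suminf_not_top) auto
    then have "summable (\<lambda>n. f (Suc n) x - f n x)" by (rule summable_norm_cancel)
    then have "convergent (\<lambda>n. \<Sum>k<n. f (Suc k) x - f k x)" by (simp add: summable_iff_convergent)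
    then have "convergent (\<lambda>n. f n x - f 0 x)" 
      by (simp add: sum_lessThan_telescope[of "\<lambda>n. f n x"])
    then show ?case by (simp add: convergent_diff_const_right_iff)
  qed
  \<comment> \<open>Where the sequence diverges \<open>lim\<close> has no meaning, but this happens
    only on a null set.\<close>
  define g where "g x = lim (\<lambda>n. f n x)" for x
  have [measurable]: "g \<in> borel_measurable M" unfolding g_def by (rule borel_measurable_lim_metric) simp
  have nn: "(\<integral>\<^sup>+x. ennreal ((norm (f n x - g x))\<^sup>2) \<partial>M) \<le> ennreal ((2 * (1/2) ^ n)\<^sup>2)" for n
  proof -
    have "AE x in M. ennreal ((norm (f n x - g x))\<^sup>2) = liminf (\<lambda>m. ennreal ((norm (f n x - f m x))\<^sup>2))"
      using conv
    proof eventually_elim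
      case (elim x)
      then have lim: "(\<lambda>m. f m x) \<longlonglongrightarrow> g x" by (simp add: g_def convergent_LIMSEQ_iff)
      have "(\<lambda>m. (norm (f n x - f m x))\<^sup>2) \<longlonglongrightarrow> (norm (f n x - g x))\<^sup>2"
        by (intro tendsto_power tendsto_norm tendsto_diff tendsto_const lim)
      then have "(\<lambda>m. ennreal ((norm (f n x - f m x))\<^sup>2)) \<longlonglongrightarrow> ennreal ((norm (f n x - g x))\<^sup>2)"
        by (rule tendsto_ennrealI)
      then show ?case by (rule lim_imp_Liminf[OF trivial_limit_sequentially, symmetric])
    qed
    then have "(\<integral>\<^sup>+x. ennreal ((norm (f n x - g x))\<^sup>2) \<partial>M) =
        (\<integral>\<^sup>+x. liminf (\<lambda>m. ennreal ((norm (f n x - f m x))\<^sup>2)) \<partial>M)"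
      by (rule nn_integral_cong_AE)
    also have "\<dots> \<le> liminf (\<lambda>m. \<integral>\<^sup>+x. ennreal ((norm (f n x - f m x))\<^sup>2) \<partial>M)"
      by (rule nn_integral_liminf) measurable
    also have "\<dots> \<le> ennreal ((2 * (1/2) ^ n)\<^sup>2)"
    proof (rule order_trans[OF Liminf_le_Limsup Limsup_bounded], rule trivial_limit_sequentially)
      show "\<forall>\<^sub>F m in sequentially. (\<integral>\<^sup>+x. ennreal ((norm (f n x - f m x))\<^sup>2) \<partial>M) \<le> ennreal ((2 * (1/2) ^ n)\<^sup>2)"
        using eventually_ge_at_top[of n]
      proof eventually_elim
        case (elim m)
        have "(\<integral>\<^sup>+x. ennreal ((norm (f n x - f m x))\<^sup>2) \<partial>M) = ennreal ((L2_norm M (\<lambda>x. f n x - f m x))\<^sup>2)"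
          using L2_fun_integrable_sq[OF L2_fun_diff[OF f f]]
          by (subst nn_integral_eq_integral) (auto simp: L2_norm_def)
        also have "\<dots> \<le> ennreal ((2 * (1/2) ^ n)\<^sup>2)"
          using dist'[OF elim] by (intro ennreal_leI power_mono) auto
        finally show ?case .
      qed
    qed
    finally show ?thesis .
  qed
  have diff: "L2_fun M (\<lambda>x. f n x - g x)" for n
    unfolding L2_fun_def
  proof
    show "integrable M (\<lambda>x. (norm (f n x - g x))\<^sup>2)"
    proof (rule integrableI_bounded)
      have "(\<integral>\<^sup>+x. ennreal (norm ((norm (f n x - g x))\<^sup>2)) \<partial>M) \<le> ennreal ((2 * (1/2) ^ n)\<^sup>2)"
        using nn[of n] by simp
      also have "\<dots> < \<infinity>" by simp
      finally show "(\<integral>\<^sup>+x. ennreal (norm ((norm (f n x - g x))\<^sup>2)) \<partial>M) < \<infinity>" .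
    qed measurable
  qed simp
  show ?thesis
  proof
    have "L2_fun M (\<lambda>x. f 0 x - (f 0 x - g x))" by (intro L2_fun_diff f diff)
    then show "L2_fun M g" by simp
    fix n
    have "ennreal ((L2_norm M (\<lambda>x. f n x - g x))\<^sup>2) \<le> ennreal ((2 * (1/2) ^ n)\<^sup>2)"
      using nn[of n] L2_fun_integrable_sq[OF diff[of n]]
      by (subst (asm) nn_integral_eq_integral) (auto simp: L2_norm_def)
    then have "(L2_norm M (\<lambda>x. f n x - g x))\<^sup>2 \<le> (2 * (1/2) ^ n)\<^sup>2"
      by (subst (asm) ennreal_le_iff) auto
    then show "L2_norm M (\<lambda>x. f n x - g x) \<le> 2 * (1/2) ^ n"
      by (rule power2_le_imp_le) simp
  qed
qed

end

section \<open>Orthogonal projection and duality\<close>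

definition L2_subspace :: "'a measure \<Rightarrow> (('a \<Rightarrow> complex) \<Rightarrow> bool) \<Rightarrow> bool" where
  "L2_subspace M V \<longleftrightarrow> (\<forall>f. V f \<longrightarrow> L2_fun M f) \<and> V (\<lambda>_. 0) \<and>
     (\<forall>f g. V f \<longrightarrow> V g \<longrightarrow> V (\<lambda>x. f x + g x)) \<and> (\<forall>c f. V f \<longrightarrow> V (\<lambda>x. c *\<^sub>R f x))"

context prob_space
begin

text \<open>\<open>h\<close> is the component of \<open>f\<close> orthogonal to the closure of
  \<open>V\<close>, obtained as the limit of \<open>f - v n\<close> along a minimising sequence.
  \<open>V\<close> is not assumed closed, so \<open>f - h\<close> is only approximated by elements
  of \<open>V\<close>.\<close>

lemma L2_projection:
  assumes V: "L2_subspace M V" and f: "L2_fun M f"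
  obtains h where "L2_fun M h" "\<And>v. V v \<Longrightarrow> L2_inner M h v = 0"
    "\<And>e. e > 0 \<Longrightarrow> \<exists>v. V v \<and> L2_norm M (\<lambda>x. f x - v x - h x) < e"
proof -
  have VL2: "\<And>v. V v \<Longrightarrow> L2_fun M v" and V0: "V (\<lambda>_. 0)"
    and Vadd: "\<And>v w. V v \<Longrightarrow> V w \<Longrightarrow> V (\<lambda>x. v x + w x)"
    and Vscale: "\<And>c v. V v \<Longrightarrow> V (\<lambda>x. c *\<^sub>R v x)"
    using V unfolding L2_subspace_def by blast+
  define D where "D = {(L2_norm M (\<lambda>x. f x - v x))\<^sup>2 | v. V v}"
  define d where "d = Inf D"
  have D: "D \<noteq> {}" "bdd_below D" using V0 by (auto simp: D_def intro!: bdd_belowI[of _ 0])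
  have d_le: "d \<le> (L2_norm M (\<lambda>x. f x - v x))\<^sup>2" if "V v" for v
    unfolding d_def using D that by (intro cInf_lower) (auto simp: D_def)
  have quarter: "(1/4 :: real) ^ n = ((1/2) ^ n)\<^sup>2" for n
    by (simp add: power2_eq_square flip: power_mult_distrib)
  \<comment> \<open>With this margin the parallelogram law, applied to the midpoint, gives steps of
    size at most \<open>(1/2) ^ n\<close>, as \<open>L2_complete\<close> requires.\<close>
  have "\<forall>n. \<exists>v. V v \<and> (L2_norm M (\<lambda>x. f x - v x))\<^sup>2 < d + (1/4) ^ n / 4"
  proof
    fix n :: nat
    have "Inf D < d + (1/4) ^ n / 4" by (simp add: d_def)
    then obtain y where "y \<in> D" "y < d + (1/4) ^ n / 4"
      using cInf_less_iff[OF D] by blast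
    then show "\<exists>v. V v \<and> (L2_norm M (\<lambda>x. f x - v x))\<^sup>2 < d + (1/4) ^ n / 4" by (auto simp: D_def)
  qed
  from choice[OF this] obtain v where
    v: "\<And>n. V (v n)" "\<And>n. (L2_norm M (\<lambda>x. f x - v n x))\<^sup>2 < d + (1/4) ^ n / 4"
    by blast
  have fv: "L2_fun M (\<lambda>x. f x - v n x)" for n by (intro L2_fun_diff f VL2 v)
  have step: "L2_norm M (\<lambda>x. (f x - v (Suc n) x) - (f x - v n x)) \<le> (1/2) ^ n" for n
  proof (rule power2_le_imp_le)
    let ?a = "\<lambda>x. f x - v (Suc n) x" and ?b = "\<lambda>x. f x - v n x"
    define m where "m x = (1/2) *\<^sub>R (v (Suc n) x + v n x)" for x
    have "V m" unfolding m_def [abs_def] by (intro Vscale Vadd v)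
    have "(\<lambda>x. ?a x + ?b x) = (\<lambda>x. 2 *\<^sub>R (f x - m x))"
      by (simp add: m_def fun_eq_iff complex_eq_iff add_divide_distrib)
    then have "(L2_norm M (\<lambda>x. ?a x + ?b x))\<^sup>2 = 4 * (L2_norm M (\<lambda>x. f x - m x))\<^sup>2"
      by (simp add: L2_norm_scaleR power_mult_distrib)
    moreover have "\<dots> \<ge> 4 * d" using d_le[OF \<open>V m\<close>] by simp
    moreover have "(L2_norm M (\<lambda>x. ?a x - ?b x))\<^sup>2 + (L2_norm M (\<lambda>x. ?a x + ?b x))\<^sup>2 =
        2 * (L2_norm M ?a)\<^sup>2 + 2 * (L2_norm M ?b)\<^sup>2"
      unfolding L2_norm_diff_sq[OF fv fv] L2_norm_add_sq[OF fv fv] by simp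
    ultimately have "(L2_norm M (\<lambda>x. ?a x - ?b x))\<^sup>2 \<le> 2 * ((1/4) ^ Suc n / 4) + 2 * ((1/4) ^ n / 4)"
      using v(2)[of n] v(2)[of "Suc n"] by linarith
    also have "\<dots> \<le> (1/4) ^ n" by simp
    also have "\<dots> = ((1/2) ^ n)\<^sup>2" by (rule quarter)
    finally show "(L2_norm M (\<lambda>x. ?a x - ?b x))\<^sup>2 \<le> ((1/2) ^ n)\<^sup>2" .
  qed simp
  obtain h where h: "L2_fun M h" "\<And>n. L2_norm M (\<lambda>x. (f x - v n x) - h x) \<le> 2 * (1/2) ^ n"
    using L2_complete[of "\<lambda>n x. f x - v n x"] fv step by blast
  have small: "\<exists>n. 2 * (1/2) ^ n < e" if e_pos: "e > 0" for e :: real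
  proof -
    obtain n where "(1/2) ^ n < e / 2" using real_arch_pow_inv[of "e / 2" "1/2"] e_pos by auto
    then have "2 * (1/2) ^ n < e" by simp
    then show ?thesis by blast
  qed
  have d_nonneg: "d \<ge> 0" unfolding d_def using D by (intro cInf_greatest) (auto simp: D_def)
  have near: "L2_norm M h \<le> sqrt d"
  proof (rule field_le_epsilon)
    fix e :: real assume "e > 0"
    then obtain n where n: "2 * (1/2) ^ n < e / 2" using small[OF half_gt_zero] by blast
    have "L2_norm M h \<le> L2_norm M (\<lambda>x. f x - v n x) + L2_norm M (\<lambda>x. (f x - v n x) - h x)"
      using L2_norm_diff_ge[OF h(1) fv[of n]] L2_norm_minus_commute[of M h "\<lambda>x. f x - v n x"] by linarith
    also have "L2_norm M (\<lambda>x. f x - v n x) \<le> sqrt (d + (1/4) ^ n / 4)"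
      using v(2)[of n] by (intro real_le_rsqrt) simp
    also have "\<dots> \<le> sqrt d + sqrt ((1/4) ^ n / 4)"
      using d_nonneg by (intro sqrt_add_le_add_sqrt) auto
    also have "sqrt ((1/4) ^ n / 4) \<le> 2 * (1/2) ^ n"
      by (rule real_le_lsqrt) (simp_all add: quarter power_mult_distrib)
    finally show "L2_norm M h \<le> sqrt d + e" using n h(2)[of n] by simp
  qed
  have h_min: "sqrt d \<le> L2_norm M (\<lambda>x. h x - w x)" if "V w" for w
  proof (rule field_le_epsilon)
    fix e :: real assume "e > 0"
    then obtain n where n: "2 * (1/2) ^ n < e" using small[OF \<open>e > 0\<close>] by blast
    have "V (\<lambda>x. v n x + w x)" using that v by (intro Vadd)
    from d_le[OF this] have "sqrt d \<le> L2_norm M (\<lambda>x. f x - (v n x + w x))"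
      by (intro real_le_lsqrt) auto
    also have "\<dots> = L2_norm M (\<lambda>x. ((f x - v n x) - h x) + (h x - w x))"
      by (simp add: algebra_simps)
    also have "\<dots> \<le> L2_norm M (\<lambda>x. (f x - v n x) - h x) + L2_norm M (\<lambda>x. h x - w x)"
      by (intro L2_norm_add_le L2_fun_diff f v VL2 h that)
    finally show "sqrt d \<le> L2_norm M (\<lambda>x. h x - w x) + e" using h(2)[of n] n by simp
  qed
  show ?thesis
  proof
    show "L2_fun M h" by fact
    show "L2_inner M h w = 0" if w: "V w" for w
    proof (rule ccontr)
      define p q where "p = L2_inner M h w" and "q = (L2_norm M w)\<^sup>2"
      assume "L2_inner M h w \<noteq> 0"
      then have p: "p\<^sup>2 > 0" by (simp add: p_def)
      \<comment> \<open>The exact minimiser would be \<open>p / q\<close>; the denominator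
        \<open>q + 1\<close> avoids a separate case \<open>q = 0\<close>.\<close>
      define t where "t = p / (q + 1)"
      have q: "q \<ge> 0" by (simp add: q_def)
      have "(L2_norm M h)\<^sup>2 \<le> (sqrt d)\<^sup>2" using near by (intro power_mono) auto
      also have "\<dots> \<le> (L2_norm M (\<lambda>x. h x - t *\<^sub>R w x))\<^sup>2"
        using h_min[OF Vscale[OF w, of t]] d_nonneg by (intro power_mono) auto
      also have "\<dots> = (L2_norm M h)\<^sup>2 - 2 * t * p + t\<^sup>2 * q"
        using h w VL2 by (subst L2_norm_diff_sq)
          (auto simp: L2_inner_scaleR_right L2_norm_scaleR power_mult_distrib p_def q_def)
      finally have "2 * t * p \<le> t\<^sup>2 * q" by simp
      then have "2 * (p\<^sup>2 / (q + 1)) \<le> p\<^sup>2 / (q + 1) * (q / (q + 1))"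
        by (simp add: t_def power2_eq_square)
      also have "\<dots> \<le> p\<^sup>2 / (q + 1) * 1" using q by (intro mult_left_mono) auto
      finally have "p\<^sup>2 / (q + 1) \<le> 0" by simp
      moreover have "p\<^sup>2 / (q + 1) > 0" using p q by (intro divide_pos_pos) auto
      ultimately show False by simp
    qed
    show "\<exists>v. V v \<and> L2_norm M (\<lambda>x. f x - v x - h x) < e" if e: "e > 0" for e
    proof -
      obtain n where "2 * (1/2) ^ n < e" using small[OF e] by blast
      then show ?thesis using v(1)[of n] h(2)[of n] by (intro exI[of _ "v n"]) simp
    qed
  qed
qed

lemma L2_inner_null: "L2_fun M f \<Longrightarrow> L2_fun M h \<Longrightarrow> L2_norm M h = 0 \<Longrightarrow> L2_inner M f h = 0"
  using L2_Cauchy_Schwarz[of M f h] by simp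

text \<open>The residual \<open>h\<close> of \<open>f\<close> is orthogonal to \<open>V\<close>,
  hence by \<open>orth\<close> also to \<open>f\<close>. As it is a limit of differences of
  \<open>f\<close> and elements of \<open>V\<close>, it is orthogonal to itself, so \<open>f\<close>
  lies in the closure of \<open>V\<close>.\<close>

lemma L2_closed_subspace_mem:
  assumes V: "L2_subspace M V"
    and closed: "\<And>f. L2_fun M f \<Longrightarrow> (\<And>e. e > 0 \<Longrightarrow> \<exists>v. V v \<and> L2_norm M (\<lambda>x. f x - v x) < e) \<Longrightarrow> V f"
    and f: "L2_fun M f"
    and orth: "\<And>h. L2_fun M h \<Longrightarrow> (\<And>v. V v \<Longrightarrow> L2_inner M h v = 0) \<Longrightarrow> L2_inner M f h = 0"
  shows "V f"
proof -
  obtain h where h: "L2_fun M h" "\<And>v. V v \<Longrightarrow> L2_inner M h v = 0"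
    "\<And>e. e > 0 \<Longrightarrow> \<exists>v. V v \<and> L2_norm M (\<lambda>x. f x - v x - h x) < e"
    using L2_projection[OF V f] by blast
  have VL2: "L2_fun M v" if "V v" for v using V that by (auto simp: L2_subspace_def)
  have fh: "L2_inner M f h = 0" using orth h by blast
  have "L2_norm M h \<le> 0"
  proof (rule field_le_epsilon)
    fix e :: real assume e: "e > 0"
    obtain v where v: "V v" "L2_norm M (\<lambda>x. f x - v x - h x) < e" using h(3)[OF e] by blast
    have L: "L2_fun M (\<lambda>x. f x - v x)" by (intro L2_fun_diff f VL2 v)
    have "L2_inner M (\<lambda>x. f x - v x - h x) h = - (L2_norm M h)\<^sup>2"
      using fh h(2)[OF v(1)]
      by (simp add: L2_inner_diff_left L f VL2 v h(1) L2_norm_sq L2_inner_commute[of M v h])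
    moreover have "\<bar>L2_inner M (\<lambda>x. f x - v x - h x) h\<bar> \<le> L2_norm M (\<lambda>x. f x - v x - h x) * L2_norm M h"
      by (intro L2_Cauchy_Schwarz L2_fun_diff L h)
    moreover have "\<dots> \<le> e * L2_norm M h" using v(2) by (intro mult_right_mono) auto
    ultimately have "L2_norm M h * L2_norm M h \<le> e * L2_norm M h" by (simp add: power2_eq_square)
    then show "L2_norm M h \<le> 0 + e" using e L2_norm_nonneg[of M h]
      by (cases "L2_norm M h = 0") (auto simp: mult_le_cancel_right)
  qed
  then have h0: "L2_norm M h = 0" using L2_norm_nonneg[of M h] by linarith
  show ?thesis
  proof (rule closed[OF f])
    fix e :: real assume e: "e > 0"
    obtain v where v: "V v" "L2_norm M (\<lambda>x. f x - v x - h x) < e" using h(3)[OF e] by blast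
    have "L2_norm M (\<lambda>x. f x - v x) - L2_norm M h \<le> L2_norm M (\<lambda>x. f x - v x - h x)"
      by (intro L2_norm_diff_ge L2_fun_diff f h VL2 v)
    then show "\<exists>v. V v \<and> L2_norm M (\<lambda>x. f x - v x) < e" using v h0 by auto
  qed
qed

text \<open>Real-linear maps with a common bound \<open>C\<close>. Linearity is an equality of
  functions and not only almost everywhere, which all averages below satisfy.\<close>

definition L2_family :: "(nat \<Rightarrow> ('a \<Rightarrow> complex) \<Rightarrow> 'a \<Rightarrow> complex) \<Rightarrow> real \<Rightarrow> bool" where
  "L2_family \<Phi> C \<longleftrightarrow> (\<forall>N f. L2_fun M f \<longrightarrow> L2_fun M (\<Phi> N f)) \<and>
    (\<forall>N f g. L2_fun M f \<longrightarrow> L2_fun M g \<longrightarrow> \<Phi> N (\<lambda>x. f x + g x) = (\<lambda>x. \<Phi> N f x + \<Phi> N g x)) \<and>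
    (\<forall>N c f. L2_fun M f \<longrightarrow> \<Phi> N (\<lambda>x. c *\<^sub>R f x) = (\<lambda>x. c *\<^sub>R \<Phi> N f x)) \<and>
    (\<forall>N f. L2_fun M f \<longrightarrow> L2_norm M (\<Phi> N f) \<le> C * L2_norm M f)"

text \<open>The uniform bound makes the functions with \<open>\<Phi> N f\<close> tending to 0 a
  closed subspace, so duality applies. The limit theorems below take an \<open>h\<close> orthogonal
  to every function for which convergence holds and show that \<open>f\<close> is orthogonal to
  it.\<close>

lemma L2_family_tendsto_0:
  assumes fam: "L2_family \<Phi> C" and f: "L2_fun M f"
    and orth: "\<And>h. L2_fun M h \<Longrightarrow>
      (\<And>v. L2_fun M v \<Longrightarrow> (\<lambda>N. L2_norm M (\<Phi> N v)) \<longlonglongrightarrow> 0 \<Longrightarrow> L2_inner M h v = 0) \<Longrightarrow> L2_inner M f h = 0"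
  shows "(\<lambda>N. L2_norm M (\<Phi> N f)) \<longlonglongrightarrow> 0"
proof -
  define V where "V v \<longleftrightarrow> L2_fun M v \<and> (\<lambda>N. L2_norm M (\<Phi> N v)) \<longlonglongrightarrow> 0" for v
  note fam' = fam[unfolded L2_family_def]
  have L: "L2_fun M (\<Phi> N f)" if "L2_fun M f" for N f
    using conjunct1[OF fam'] that by simp
  have add: "\<Phi> N (\<lambda>x. f x + g x) = (\<lambda>x. \<Phi> N f x + \<Phi> N g x)" if "L2_fun M f" "L2_fun M g" for N f g
    using conjunct1[OF conjunct2[OF fam']] that by simp
  have scale: "\<Phi> N (\<lambda>x. c *\<^sub>R f x) = (\<lambda>x. c *\<^sub>R \<Phi> N f x)" if "L2_fun M f" for N c f
    using conjunct1[OF conjunct2[OF conjunct2[OF fam']]] that by simp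
  have bound: "L2_norm M (\<Phi> N f) \<le> C * L2_norm M f" if "L2_fun M f" for N f
    using conjunct2[OF conjunct2[OF conjunct2[OF fam']]] that by simp
  have "V f"
  proof (rule L2_closed_subspace_mem[OF _ _ f])
    show "L2_subspace M V" unfolding L2_subspace_def
    proof (intro conjI allI impI)
      fix v assume v: "V v"
      then show vL: "L2_fun M v" by (simp add: V_def)
      fix c :: real
      have "(\<lambda>N. \<bar>c\<bar> * L2_norm M (\<Phi> N v)) \<longlonglongrightarrow> 0"
        using v by (intro tendsto_mult_right_zero) (simp add: V_def)
      then show "V (\<lambda>x. c *\<^sub>R v x)"
        unfolding V_def using vL by (simp add: scale L2_norm_scaleR L2_fun_scaleR)
    next
      have "V (\<lambda>x. 0 *\<^sub>R v x)" if "L2_fun M v" for v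
        unfolding V_def using scale[OF that, of _ 0] that by simp
      from this[OF f] show "V (\<lambda>_. 0)" by simp
    next
      fix v w assume vw: "V v" "V w"
      then have vL: "L2_fun M v" "L2_fun M w" by (simp_all add: V_def)
      have lim: "(\<lambda>N. L2_norm M (\<Phi> N v) + L2_norm M (\<Phi> N w)) \<longlonglongrightarrow> 0"
        using vw tendsto_add[of "\<lambda>N. L2_norm M (\<Phi> N v)" 0 sequentially "\<lambda>N. L2_norm M (\<Phi> N w)" 0]
        by (simp add: V_def)
      have "(\<lambda>N. L2_norm M (\<Phi> N (\<lambda>x. v x + w x))) \<longlonglongrightarrow> 0"
        by (rule tendsto_sandwich[OF _ _ tendsto_const lim])
          (simp_all add: add[OF vL] L2_norm_add_le[OF L[OF vL(1)] L[OF vL(2)]])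
      then show "V (\<lambda>x. v x + w x)" using L2_fun_add[OF vL] by (simp add: V_def)
    qed
  next
    fix f assume f: "L2_fun M f" and approx: "\<And>e. e > 0 \<Longrightarrow> \<exists>v. V v \<and> L2_norm M (\<lambda>x. f x - v x) < e"
    define K where "K = \<bar>C\<bar> + 1"
    have K: "K > 0" "C \<le> K" by (auto simp: K_def)
    have "(\<lambda>N. L2_norm M (\<Phi> N f)) \<longlonglongrightarrow> 0"
    proof (rule LIMSEQ_I)
      fix r :: real assume r: "r > 0"
      then obtain v where v: "V v" "L2_norm M (\<lambda>x. f x - v x) < r / (2 * K)"
        using approx[of "r / (2 * K)"] K by auto
      have vL: "L2_fun M v" using v by (simp add: V_def)
      obtain no where no: "\<And>n. n \<ge> no \<Longrightarrow> L2_norm M (\<Phi> n v) < r / 2"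
        using LIMSEQ_D[of "\<lambda>N. L2_norm M (\<Phi> N v)" 0 "r / 2"] v(1) r by (auto simp: V_def)
      have "norm (L2_norm M (\<Phi> n f) - 0) < r" if n: "n \<ge> no" for n
      proof -
        have D: "L2_fun M (\<lambda>x. f x - v x)" by (rule L2_fun_diff[OF f vL])
        have "\<Phi> n f = (\<lambda>x. \<Phi> n (\<lambda>x. f x - v x) x + \<Phi> n v x)" using add[OF D vL, of n] by simp
        then have "L2_norm M (\<Phi> n f) \<le> L2_norm M (\<Phi> n (\<lambda>x. f x - v x)) + L2_norm M (\<Phi> n v)"
          using L2_norm_add_le[OF L[OF D, of n] L[OF vL, of n]] by simp
        also have "L2_norm M (\<Phi> n (\<lambda>x. f x - v x)) \<le> K * L2_norm M (\<lambda>x. f x - v x)"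
          using bound[OF D, of n] mult_right_mono[OF K(2) L2_norm_nonneg[of M "\<lambda>x. f x - v x"]] by linarith
        also have "\<dots> < r / 2" using v(2) K(1) by (simp add: field_simps)
        finally show ?thesis using no[OF n] by simp
      qed
      then show "\<exists>no. \<forall>n\<ge>no. norm (L2_norm M (\<Phi> n f) - 0) < r" by blast
    qed
    then show "V f" using f by (simp add: V_def)
  next
    fix h assume "L2_fun M h" "\<And>v. V v \<Longrightarrow> L2_inner M h v = 0"
    then show "L2_inner M f h = 0" by (intro orth) (auto simp: V_def)
  qed
  then show ?thesis by (simp add: V_def)
qed

section \<open>Measure preserving transformations\<close>

lemma mpt_measurable: "invertible_mpt M U \<Longrightarrow> U \<in> measurable M M"
  by (simp add: invertible_mpt_def)

lemma mpt_space: "invertible_mpt M U \<Longrightarrow> x \<in> space M \<Longrightarrow> U x \<in> space M"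
  by (auto dest: mpt_measurable measurable_space)

lemma mpt_integral:
  fixes f :: "'a \<Rightarrow> 'c::{banach, second_countable_topology}"
  assumes "invertible_mpt M U" "f \<in> borel_measurable M"
  shows "(\<integral>x. f (U x) \<partial>M) = (\<integral>x. f x \<partial>M)"
  using integral_distr[of U M M f] assms by (simp add: invertible_mpt_def)

lemma mpt_integrable:
  fixes f :: "'a \<Rightarrow> 'c::{banach, second_countable_topology}"
  assumes "invertible_mpt M U" "integrable M f"
  shows "integrable M (\<lambda>x. f (U x))"
  using integrable_distr_eq[of U M M f] assms by (simp add: invertible_mpt_def)

lemma mpt_AE:
  assumes "invertible_mpt M U" "AE x in M. P x"
  shows "AE x in M. P (U x)"
proof -
  have d: "distr M M U = M" using assms(1) by (simp add: invertible_mpt_def)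
  show ?thesis by (rule AE_distrD[of U M M P, unfolded d, OF mpt_measurable[OF assms(1)] assms(2)])
qed

lemma mpt_borel_measurable:
  "invertible_mpt M U \<Longrightarrow> f \<in> measurable M N \<Longrightarrow> (\<lambda>x. f (U x)) \<in> measurable M N"
  using measurable_compose[OF mpt_measurable] .

lemma mpt_L2_fun: "invertible_mpt M U \<Longrightarrow> L2_fun M f \<Longrightarrow> L2_fun M (\<lambda>x. f (U x))"
  unfolding L2_fun_def using mpt_integrable[of U "\<lambda>x. (norm (f x))\<^sup>2"] mpt_borel_measurable by blast

lemma mpt_L2_norm:
  "invertible_mpt M U \<Longrightarrow> f \<in> borel_measurable M \<Longrightarrow> L2_norm M (\<lambda>x. f (U x)) = L2_norm M f"
  unfolding L2_norm_def using mpt_integral[of U "\<lambda>x. (norm (f x))\<^sup>2"] by simp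

lemma mpt_L2_inner:
  "invertible_mpt M U \<Longrightarrow> f \<in> borel_measurable M \<Longrightarrow> g \<in> borel_measurable M \<Longrightarrow>
    L2_inner M (\<lambda>x. f (U x)) (\<lambda>x. g (U x)) = L2_inner M f g"
  unfolding L2_inner_def using mpt_integral[of U "\<lambda>x. f x \<bullet> g x"] by simp

lemma mpt_comp:
  assumes "invertible_mpt M U" "invertible_mpt M W"
  shows "invertible_mpt M (U \<circ> W)"
proof -
  have U: "U \<in> measurable M M" "distr M M U = M" "bij_betw U (space M) (space M)"
      "inv_into (space M) U \<in> measurable M M"
    and W: "W \<in> measurable M M" "distr M M W = M" "bij_betw W (space M) (space M)"
      "inv_into (space M) W \<in> measurable M M"
    using assms unfolding invertible_mpt_def by blast+
  have "bij_betw (U \<circ> W) (space M) (space M)" using bij_betw_trans[OF W(3) U(3)] .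
  moreover have "U \<circ> W \<in> measurable M M" using measurable_comp[OF W(1) U(1)] .
  moreover have "distr M M (U \<circ> W) = M"
    using distr_distr[OF U(1) W(1)] U(2) W(2) by simp
  moreover have "inv_into (space M) (U \<circ> W) \<in> measurable M M"
  proof (rule measurable_cong[THEN iffD1])
    show "(\<lambda>x. inv_into (space M) W (inv_into (space M) U x)) \<in> measurable M M"
      by (rule measurable_compose[OF U(4) W(4)])
    fix x assume x: "x \<in> space M"
    have "inj_on U (W ` space M)" "inj_on W (space M)" "x \<in> U ` W ` space M"
      using U(3) W(3) x by (simp_all add: bij_betw_def)
    from inv_into_comp[OF this] show
      "inv_into (space M) W (inv_into (space M) U x) = inv_into (space M) (U \<circ> W) x"
      using W(3) by (simp add: bij_betw_def)
  qed
  ultimately show ?thesis unfolding invertible_mpt_def by blast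
qed

lemma mpt_id: "invertible_mpt M id"
  unfolding invertible_mpt_def
proof (intro conjI)
  show "distr M M id = M" by (simp add: id_def distr_id)
  have "inv_into (space M) id \<in> measurable M M \<longleftrightarrow> (\<lambda>x. x) \<in> measurable M M"
    by (rule measurable_cong) (simp add: inv_into_f_f[of id "space M", unfolded id_apply])
  then show "inv_into (space M) id \<in> measurable M M" by simp
qed auto

lemma mpt_funpow: "invertible_mpt M U \<Longrightarrow> invertible_mpt M (U ^^ k)"
  by (induction k) (simp_all add: mpt_id mpt_comp)

text \<open>\<open>U\<close> preserves the norm, so the assumption is the case of equality in
  Cauchy--Schwarz for \<open>h\<close> and \<open>h \<circ> U\<close>: expanding the squared norm of
  \<open>h - h \<circ> U\<close> gives 0.\<close>

lemma mpt_invariant_iff_inner: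
  assumes U: "invertible_mpt M U" and h: "L2_fun M h"
    and "L2_inner M h (\<lambda>x. h x - h (U x)) = 0"
  shows "AE x in M. h (U x) = h x"
proof -
  have hU: "L2_fun M (\<lambda>x. h (U x))" by (rule mpt_L2_fun) fact+
  have "L2_inner M h (\<lambda>x. h (U x)) = (L2_norm M h)\<^sup>2"
    using assms hU by (simp add: L2_inner_diff_right L2_norm_sq)
  then have "(L2_norm M (\<lambda>x. h x - h (U x)))\<^sup>2 = 0"
    using h U hU by (simp add: L2_norm_diff_sq mpt_L2_norm L2_fun_measurable)
  then show ?thesis using L2_norm_eq_0_iff[OF L2_fun_diff[OF h hU]] by (auto elim: AE_mp)
qed

text \<open>Almost surely the truth value of \<open>f x \<le> q\<close> is prescribed simultaneously
  for all rational \<open>q\<close>. Two points with the same truth values have the same value of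
  \<open>f\<close>, since a rational would separate distinct values.\<close>

lemma AE_const_if_zero_one:
  fixes f :: "'a \<Rightarrow> real"
  assumes f: "f \<in> borel_measurable M" and "\<And>c. prob {x \<in> space M. f x \<le> c} \<in> {0, 1}"
  obtains c where "AE x in M. f x = c"
proof -
  have "\<forall>c. \<exists>b. AE x in M. (f x \<le> c) = b"
  proof
    fix c
    have [measurable]: "f \<in> borel_measurable M" by fact
    have m: "{x \<in> space M. f x \<le> c} \<in> events" by measurable
    consider "prob {x \<in> space M. f x \<le> c} = 0" | "prob {x \<in> space M. f x \<le> c} = 1"
      using assms(2)[of c] by auto
    then show "\<exists>b. AE x in M. (f x \<le> c) = b"
    proof cases
      case 1
      then have "AE x in M. x \<notin> {x \<in> space M. f x \<le> c}" using m by (simp add: prob_eq_0)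
      then have "AE x in M. (f x \<le> c) = False" using AE_space by eventually_elim auto
      then show "\<exists>b. AE x in M. (f x \<le> c) = b" by blast
    next
      case 2
      then have "AE x in M. x \<in> {x \<in> space M. f x \<le> c}" using m by (simp add: prob_eq_1)
      then have "AE x in M. (f x \<le> c) = True" by eventually_elim auto
      then show "\<exists>b. AE x in M. (f x \<le> c) = b" by blast
    qed
  qed
  from choice[OF this] obtain b where b: "\<And>c. AE x in M. (f x \<le> c) = b c" by blast
  have all: "AE x in M. \<forall>q\<in>\<rat>. (f x \<le> q) = b q"
    using b by (subst AE_ball_countable) (auto simp: countable_rat)
  have "\<exists>x0. \<forall>q\<in>\<rat>. (f x0 \<le> q) = b q"
  proof (rule ccontr)
    assume neg: "\<not> ?thesis"
    have "AE x in M. False" using all by eventually_elim (use neg in blast)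
    then show False by simp
  qed
  then obtain x0 where x0: "\<forall>q\<in>\<rat>. (f x0 \<le> q) = b q" by blast
  have "AE x in M. f x = f x0" using all
  proof eventually_elim
    case (elim x)
    show ?case
    proof (rule ccontr)
      assume "f x \<noteq> f x0"
      then consider "f x < f x0" | "f x0 < f x" by linarith
      then show False
      proof cases
        case 1
        then obtain q where "q \<in> \<rat>" "f x < q" "q < f x0" using Rats_dense_in_real by blast
        then show False using elim x0 by force
      next
        case 2
        then obtain q where "q \<in> \<rat>" "f x0 < q" "q < f x" using Rats_dense_in_real by blast
        then show False using elim x0 by force
      qed
    qed
  qed
  then show ?thesis using that by blast
qed

lemma AE_const_if_zero_one_complex:
  fixes f :: "'a \<Rightarrow> complex"
  assumes [measurable]: "f \<in> borel_measurable M"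
    and "\<And>c. prob {x \<in> space M. Re (f x) \<le> c} \<in> {0, 1}" "\<And>c. prob {x \<in> space M. Im (f x) \<le> c} \<in> {0, 1}"
  obtains c where "AE x in M. f x = c"
proof -
  obtain a where a: "AE x in M. Re (f x) = a"
    by (rule AE_const_if_zero_one[of "\<lambda>x. Re (f x)"]) (use assms in auto)
  obtain b where b: "AE x in M. Im (f x) = b"
    by (rule AE_const_if_zero_one[of "\<lambda>x. Im (f x)"]) (use assms in auto)
  have "AE x in M. f x = Complex a b" using a b by eventually_elim (simp add: complex_eq_iff)
  then show ?thesis using that by blast
qed

text \<open>Only strictly invariant sets are mentioned in the definition of ergodicity; a set that is invariant
  up to a null set is replaced by the set of points which visit it infinitely often.\<close>

lemma ergodic_AE_invariant:
  assumes U: "invertible_mpt M U" and erg: "ergodic M U"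
    and A: "A \<in> events" and inv: "AE x in M. U x \<in> A \<longleftrightarrow> x \<in> A"
  shows "prob A \<in> {0, 1}"
proof -
  define B where "B = {x \<in> space M. \<exists>\<^sub>\<infinity>k. (U ^^ k) x \<in> A}"
  have meas[measurable]: "(U ^^ k) \<in> measurable M M" for k using mpt_funpow[OF U] mpt_measurable by blast
  have [measurable]: "A \<in> events" by fact
  have B[measurable]: "B \<in> events" unfolding B_def INFM_nat by measurable
  have "U -` B \<inter> space M = B"
  proof -
    have "(\<exists>\<^sub>\<infinity>k. (U ^^ k) (U x) \<in> A) \<longleftrightarrow> (\<exists>\<^sub>\<infinity>k. (U ^^ k) x \<in> A)" for x
    proof -
      have "(\<exists>\<^sub>\<infinity>k. (U ^^ k) x \<in> A) \<longleftrightarrow> (\<exists>\<^sub>\<infinity>k. (U ^^ Suc k) x \<in> A)"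
        using eventually_sequentially_Suc[of "\<lambda>k. (U ^^ k) x \<notin> A"]
        unfolding frequently_def cofinite_eq_sequentially by simp
      then show ?thesis by (simp add: funpow_Suc_right del: funpow.simps)
    qed
    then show ?thesis using mpt_space[OF U] by (auto simp: B_def)
  qed
  then have "prob B \<in> {0, 1}" using erg B by (auto simp: ergodic_def)
  moreover have "prob B = prob A"
  proof (rule measure_eq_AE)
    have "AE x in M. (U ^^ k) x \<in> A \<longleftrightarrow> x \<in> A" for k
    proof (induction k)
      case (Suc k)
      show ?case using Suc mpt_AE[OF mpt_funpow[OF U, of k] inv] by eventually_elim simp
    qed simp
    then have "AE x in M. \<forall>k. (U ^^ k) x \<in> A \<longleftrightarrow> x \<in> A" by (simp add: AE_all_countable)
    then show "AE x in M. x \<in> B \<longleftrightarrow> x \<in> A" using AE_space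
      by eventually_elim (auto simp: B_def)
  qed auto
  ultimately show ?thesis by simp
qed

lemma ergodic_invariant_const:
  assumes U: "invertible_mpt M U" and erg: "ergodic M U"
    and f: "f \<in> borel_measurable M" and inv: "AE x in M. f (U x) = (f x :: complex)"
  obtains c where "AE x in M. f x = c"
proof (rule AE_const_if_zero_one_complex[OF f])
  have [measurable]: "f \<in> borel_measurable M" by fact
  have sp: "AE x in M. U x \<in> space M" using AE_space by eventually_elim (rule mpt_space[OF U])
  fix c
  show "prob {x \<in> space M. Re (f x) \<le> c} \<in> {0, 1}"
    by (rule ergodic_AE_invariant[OF U erg]) (use inv sp AE_space in \<open>measurable, eventually_elim, auto\<close>)
  show "prob {x \<in> space M. Im (f x) \<le> c} \<in> {0, 1}"
    by (rule ergodic_AE_invariant[OF U erg]) (use inv sp AE_space in \<open>measurable, eventually_elim, auto\<close>)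
qed (rule that)

end

section \<open>Averages along a multiplicative action\<close>

lemma L2_norm_cong: "(\<And>x. x \<in> space M \<Longrightarrow> f x = g x) \<Longrightarrow> L2_norm M f = L2_norm M g"
  unfolding L2_norm_def by (intro arg_cong[of _ _ sqrt] Bochner_Integration.integral_cong) auto

lemma L2_inner_cong:
  "(\<And>x. x \<in> space M \<Longrightarrow> f x = f' x) \<Longrightarrow> (\<And>x. x \<in> space M \<Longrightarrow> g x = g' x) \<Longrightarrow>
    L2_inner M f g = L2_inner M f' g'"
  unfolding L2_inner_def by (intro Bochner_Integration.integral_cong) auto

lemma L2_norm_weighted_sum_le:
  assumes "\<And>i. i \<in> I \<Longrightarrow> L2_fun M (f i)" "\<And>i. i \<in> I \<Longrightarrow> L2_norm M (f i) \<le> B"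
  shows "L2_norm M (\<lambda>x. \<Sum>i\<in>I. c i *\<^sub>R f i x) \<le> (\<Sum>i\<in>I. \<bar>c i\<bar>) * B"
proof -
  have "L2_norm M (\<lambda>x. \<Sum>i\<in>I. c i *\<^sub>R f i x) \<le> (\<Sum>i\<in>I. L2_norm M (\<lambda>x. c i *\<^sub>R f i x))"
    by (intro L2_norm_sum_le L2_fun_scaleR assms)
  also have "\<dots> \<le> (\<Sum>i\<in>I. \<bar>c i\<bar> * B)"
    by (intro sum_mono) (simp add: L2_norm_scaleR assms mult_left_mono)
  finally show ?thesis by (simp add: sum_distrib_right)
qed

text \<open>The scalar inequality bounds the coefficients of a combination of the
  \<open>a n\<close>, and the vectors enter only through their norm bound \<open>B\<close>. In this
  form a mean is replaced by sums along the multiples of the primes in \<open>Q\<close>.\<close>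

lemma turan_kubilius_L2:
  fixes a :: "nat \<Rightarrow> 'a \<Rightarrow> complex"
  assumes a: "\<And>n. n > 0 \<Longrightarrow> L2_fun M (a n)" "\<And>n. n > 0 \<Longrightarrow> L2_norm M (a n) \<le> B"
    and Q: "finite Q" "\<And>p. p \<in> Q \<Longrightarrow> prime p" and L: "L = (\<Sum>p\<in>Q. 1 / real p)" "L > 0"
    and x: "x \<ge> real (card Q)" "x \<ge> 1"
  shows "L2_norm M (\<lambda>\<omega>. (1/x) *\<^sub>R (\<Sum>n\<in>nats_upto x. a n \<omega>) -
      (1/L) *\<^sub>R (\<Sum>p\<in>Q. (1/x) *\<^sub>R (\<Sum>m\<in>nats_upto (x / real p). a (p * m) \<omega>))) \<le> 2 * B / sqrt L"
proof -
  have B: "B \<ge> 0" using a(2)[of 1] L2_norm_nonneg[of M "a 1"] by linarith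
  have *: "(1/x) *\<^sub>R (\<Sum>n\<in>nats_upto x. a n \<omega>) -
      (1/L) *\<^sub>R (\<Sum>p\<in>Q. (1/x) *\<^sub>R (\<Sum>m\<in>nats_upto (x / real p). a (p * m) \<omega>)) =
      (\<Sum>n\<in>nats_upto x. ((1/x) * (1 - num_divisors_in Q n / L)) *\<^sub>R a n \<omega>)" for \<omega>
  proof -
    have "(\<Sum>p\<in>Q. (1/x) *\<^sub>R (\<Sum>m\<in>nats_upto (x / real p). a (p * m) \<omega>)) =
        (\<Sum>p\<in>Q. (1/x) *\<^sub>R (\<Sum>n\<in>nats_upto x. if p dvd n then a n \<omega> else 0))"
      using Q(2) by (intro sum.cong refl) (simp add: sum_multiples_nats_upto prime_gt_0_nat)
    also have "\<dots> = (\<Sum>p\<in>Q. \<Sum>n\<in>nats_upto x. ((1/x) * (if p dvd n then 1 else 0)) *\<^sub>R a n \<omega>)"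
      unfolding scaleR_sum_right by (intro sum.cong refl) simp
    also have "\<dots> = (\<Sum>n\<in>nats_upto x. \<Sum>p\<in>Q. ((1/x) * (if p dvd n then 1 else 0)) *\<^sub>R a n \<omega>)"
      by (rule sum.swap)
    also have "\<dots> = (\<Sum>n\<in>nats_upto x. ((1/x) * num_divisors_in Q n) *\<^sub>R a n \<omega>)"
      unfolding num_divisors_in_altdef[OF Q(1)] sum_distrib_left scaleR_sum_left ..
    finally have eq: "(\<Sum>p\<in>Q. (1/x) *\<^sub>R (\<Sum>m\<in>nats_upto (x / real p). a (p * m) \<omega>)) =
      (\<Sum>n\<in>nats_upto x. ((1/x) * num_divisors_in Q n) *\<^sub>R a n \<omega>)" .
    show ?thesis unfolding eq unfolding scaleR_sum_right sum_subtractf [symmetric]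
      by (intro sum.cong refl) (simp add: right_diff_distrib scaleR_left_diff_distrib)
  qed
  have "L2_norm M (\<lambda>\<omega>. \<Sum>n\<in>nats_upto x. ((1/x) * (1 - num_divisors_in Q n / L)) *\<^sub>R a n \<omega>)
      \<le> (\<Sum>n\<in>nats_upto x. \<bar>(1/x) * (1 - num_divisors_in Q n / L)\<bar>) * B"
    by (rule L2_norm_weighted_sum_le) (auto simp: nats_upto_def a)
  also have "(\<Sum>n\<in>nats_upto x. \<bar>(1/x) * (1 - num_divisors_in Q n / L)\<bar>) =
      (1/x) * (\<Sum>n\<in>nats_upto x. \<bar>1 - num_divisors_in Q n / L\<bar>)"
    unfolding sum_distrib_left using x by (intro sum.cong refl) (simp add: abs_mult)
  also have "\<dots> * B \<le> ((1/x) * (2 * x / sqrt L)) * B"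
    using turan_kubilius[OF Q L x] B x by (intro mult_right_mono mult_left_mono) auto
  also have "\<dots> = 2 * B / sqrt L" using x by simp
  finally show ?thesis unfolding * .
qed

text \<open>The index is real because averages are taken at \<open>x / d\<close>, and the divisor is
  \<open>x\<close> rather than the number of terms: then the average at \<open>x / d\<close>,
  composed with \<open>S d\<close> and divided by \<open>d\<close>, is exactly the part of the
  average at \<open>x\<close> over the multiples of \<open>d\<close>.\<close>

definition mult_avg :: "(nat \<Rightarrow> 'a \<Rightarrow> 'a) \<Rightarrow> ('a \<Rightarrow> complex) \<Rightarrow> real \<Rightarrow> 'a \<Rightarrow> complex" where
  "mult_avg S G x = (\<lambda>\<omega>. (1/x) *\<^sub>R (\<Sum>n\<in>nats_upto x. G (S n \<omega>)))"

locale mult_system = prob_space M for M :: "'a measure" +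
  fixes S :: "nat \<Rightarrow> 'a \<Rightarrow> 'a"
  assumes mult_action: "multiplicative_action M S"
begin

lemma S_mpt: "n > 0 \<Longrightarrow> invertible_mpt M (S n)"
  using mult_action by (simp add: multiplicative_action_def Suc_le_eq)

lemma S_space: "n > 0 \<Longrightarrow> \<omega> \<in> space M \<Longrightarrow> S n \<omega> \<in> space M"
  using S_mpt mpt_space by blast

lemma S_S: "n > 0 \<Longrightarrow> m > 0 \<Longrightarrow> \<omega> \<in> space M \<Longrightarrow> S n (S m \<omega>) = S (n * m) \<omega>"
  using mult_action by (simp add: multiplicative_action_def Suc_le_eq)

lemma S_L2: "n > 0 \<Longrightarrow> L2_fun M G \<Longrightarrow> L2_fun M (\<lambda>\<omega>. G (S n \<omega>))"
  by (rule mpt_L2_fun[OF S_mpt])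

lemma S_norm: "n > 0 \<Longrightarrow> L2_fun M G \<Longrightarrow> L2_norm M (\<lambda>\<omega>. G (S n \<omega>)) = L2_norm M G"
  by (rule mpt_L2_norm[OF S_mpt L2_fun_measurable])

lemma mult_avg_L2: "L2_fun M G \<Longrightarrow> L2_fun M (mult_avg S G x)"
  unfolding mult_avg_def by (intro L2_fun_scaleR L2_fun_sum S_L2) (auto simp: nats_upto_def)

lemma L2_norm_sum_S_le:
  assumes "L2_fun M G" "finite I" "\<And>n. n \<in> I \<Longrightarrow> n > 0"
  shows "L2_norm M (\<lambda>\<omega>. \<Sum>n\<in>I. G (S n \<omega>)) \<le> real (card I) * L2_norm M G"
  using L2_norm_weighted_sum_le[of I M "\<lambda>n \<omega>. G (S n \<omega>)" "L2_norm M G" "\<lambda>_. 1"] assms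
  by (simp add: S_L2 S_norm)

lemma mult_avg_norm_le:
  assumes "L2_fun M G" "x > 0"
  shows "L2_norm M (mult_avg S G x) \<le> L2_norm M G"
proof -
  have "L2_norm M (mult_avg S G x) \<le> (1/x) * (real (card (nats_upto x)) * L2_norm M G)"
    unfolding mult_avg_def L2_norm_scaleR using assms
    by (intro mult_mono L2_norm_sum_S_le) (auto simp: nats_upto_pos)
  also have "\<dots> \<le> (1/x) * (x * L2_norm M G)"
    using assms by (intro mult_left_mono mult_right_mono card_nats_upto_le) auto
  finally show ?thesis using assms by simp
qed

lemma mult_avg_comp:
  assumes "d > 0" "\<omega> \<in> space M"
  shows "mult_avg S G x (S d \<omega>) = (1/x) *\<^sub>R (\<Sum>n\<in>nats_upto x. G (S (d * n) \<omega>))"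
  unfolding mult_avg_def using assms
  by (intro arg_cong[of _ _ "\<lambda>z. (1/x) *\<^sub>R z"] sum.cong refl) (auto simp: nats_upto_def S_S mult.commute)

text \<open>Passing from \<open>y\<close> to \<open>x\<close> adds at most \<open>x - y + 1\<close>
  terms and rescales the old ones by a relative change \<open>(x - y) / x\<close>. For large
  \<open>x\<close> this is slow variation on the multiplicative scale.\<close>

lemma mult_avg_lipschitz:
  assumes G: "L2_fun M G" and xy: "0 < y" "y \<le> x"
  shows "L2_norm M (\<lambda>\<omega>. mult_avg S G x \<omega> - mult_avg S G y \<omega>) \<le> L2_norm M G * (2 * (x - y) + 1) / x"
proof -
  let ?g = "L2_norm M G"
  let ?I = "nats_upto x - nats_upto y"
  have sub: "nats_upto y \<subseteq> nats_upto x" using xy by (intro nats_upto_mono)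
  have card: "real (card ?I) \<le> x - y + 1"
    using card_nats_upto_le[of x] card_nats_upto_ge[of y] xy card_mono[OF finite_nats_upto sub]
    by (simp add: card_Diff_subset[OF finite_nats_upto sub] of_nat_diff)
  have eq: "mult_avg S G x \<omega> - mult_avg S G y \<omega> =
      (1/x) *\<^sub>R (\<Sum>n\<in>?I. G (S n \<omega>)) - ((x - y) / x) *\<^sub>R mult_avg S G y \<omega>" for \<omega>
  proof -
    have "(\<Sum>n\<in>nats_upto x. G (S n \<omega>)) = (\<Sum>n\<in>?I. G (S n \<omega>)) + (\<Sum>n\<in>nats_upto y. G (S n \<omega>))"
      by (rule sum.subset_diff[OF sub finite_nats_upto])
    moreover have "1/x - 1/y = - ((x - y) / x * (1/y))" using xy by (simp add: field_simps)
    then have "(1/x) *\<^sub>R z - (1/y) *\<^sub>R z = - (((x - y) / x) *\<^sub>R (1/y) *\<^sub>R z)" for z :: complex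
      by (metis scaleR_left_diff_distrib scaleR_minus_left scaleR_scaleR)
    ultimately show ?thesis by (simp add: mult_avg_def scaleR_add_right algebra_simps)
  qed
  have L2I: "L2_fun M (\<lambda>\<omega>. (1/x) *\<^sub>R (\<Sum>n\<in>?I. G (S n \<omega>)))"
    by (intro L2_fun_scaleR L2_fun_sum S_L2 G) (auto simp: nats_upto_def)
  have "L2_norm M (\<lambda>\<omega>. mult_avg S G x \<omega> - mult_avg S G y \<omega>) \<le>
      L2_norm M (\<lambda>\<omega>. (1/x) *\<^sub>R (\<Sum>n\<in>?I. G (S n \<omega>))) + L2_norm M (\<lambda>\<omega>. ((x - y) / x) *\<^sub>R mult_avg S G y \<omega>)"
    unfolding eq by (intro L2_norm_diff_le L2I L2_fun_scaleR mult_avg_L2 G)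
  also have "\<dots> \<le> (1/x) * ((x - y + 1) * ?g) + ((x - y) / x) * ?g"
  proof (rule add_mono)
    have "L2_norm M (\<lambda>\<omega>. \<Sum>n\<in>?I. G (S n \<omega>)) \<le> real (card ?I) * ?g"
      by (rule L2_norm_sum_S_le[OF G]) (auto simp: nats_upto_pos)
    also have "\<dots> \<le> (x - y + 1) * ?g" using card by (intro mult_right_mono) auto
    finally show "L2_norm M (\<lambda>\<omega>. (1/x) *\<^sub>R (\<Sum>n\<in>?I. G (S n \<omega>))) \<le> (1/x) * ((x - y + 1) * ?g)"
      unfolding L2_norm_scaleR using xy by (simp add: divide_right_mono)
    show "L2_norm M (\<lambda>\<omega>. ((x - y) / x) *\<^sub>R mult_avg S G y \<omega>) \<le> ((x - y) / x) * ?g"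
      unfolding L2_norm_scaleR using xy mult_avg_norm_le[OF G xy(1)] by (simp add: divide_right_mono mult_left_mono)
  qed
  also have "\<dots> = ?g * (2 * (x - y) + 1) / x" using xy by (simp add: field_simps)
  finally show ?thesis .
qed

text \<open>Grouping by \<open>n = d * m\<close> turns the sum over \<open>d\<close> into the
  average of \<open>(ln n)\<^sup>2\<close> times \<open>G \<circ> S n\<close>. Replacing
  \<open>(ln n)\<^sup>2\<close> by \<open>(ln x)\<^sup>2\<close> costs at most
  \<open>2 * ln x * (ln x - ln n)\<close> per term, in total one logarithm less than the main
  term.\<close>

lemma mult_avg_selberg:
  assumes G: "L2_fun M G" and x: "x \<ge> 1"
  shows "L2_norm M (\<lambda>\<omega>. (ln x)\<^sup>2 *\<^sub>R mult_avg S G x \<omega> -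
      (\<Sum>d\<in>nats_upto x. (selberg d / real d) *\<^sub>R mult_avg S G (x / real d) (S d \<omega>))) \<le> 8 * ln x * L2_norm M G"
proof -
  have eq: "(ln x)\<^sup>2 *\<^sub>R mult_avg S G x \<omega> -
      (\<Sum>d\<in>nats_upto x. (selberg d / real d) *\<^sub>R mult_avg S G (x / real d) (S d \<omega>)) =
      (\<Sum>n\<in>nats_upto x. ((1/x) * ((ln x)\<^sup>2 - (ln (real n))\<^sup>2)) *\<^sub>R G (S n \<omega>))" if \<omega>: "\<omega> \<in> space M" for \<omega>
  proof -
    have "(\<Sum>d\<in>nats_upto x. (selberg d / real d) *\<^sub>R mult_avg S G (x / real d) (S d \<omega>)) =
        (\<Sum>d\<in>nats_upto x. \<Sum>m\<in>nats_upto (x / real d). (1/x * selberg d) *\<^sub>R G (S (d * m) \<omega>))"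
    proof (rule sum.cong[OF refl])
      fix d assume "d \<in> nats_upto x"
      then have d: "d > 0" by (simp add: nats_upto_def)
      show "(selberg d / real d) *\<^sub>R mult_avg S G (x / real d) (S d \<omega>) =
        (\<Sum>m\<in>nats_upto (x / real d). (1/x * selberg d) *\<^sub>R G (S (d * m) \<omega>))"
        unfolding mult_avg_comp[OF d \<omega>] scaleR_scaleR scaleR_sum_right using d by (simp add: field_simps)
    qed
    also have "\<dots> = (\<Sum>n\<in>nats_upto x. \<Sum>d | d dvd n. (1/x * selberg d) *\<^sub>R G (S (d * (n div d)) \<omega>))"
      by (rule sum_dvd_nats_upto [symmetric])
    also have "\<dots> = (\<Sum>n\<in>nats_upto x. (1/x * (ln (real n))\<^sup>2) *\<^sub>R G (S n \<omega>))"
    proof (rule sum.cong[OF refl])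
      fix n assume "n \<in> nats_upto x"
      then have n: "n > 0" by (simp add: nats_upto_def)
      have "(\<Sum>d | d dvd n. (1/x * selberg d) *\<^sub>R G (S (d * (n div d)) \<omega>)) =
          (\<Sum>d | d dvd n. (1/x * selberg d) *\<^sub>R G (S n \<omega>))"
        by (intro sum.cong refl) simp
      also have "\<dots> = (1/x * (\<Sum>d | d dvd n. selberg d)) *\<^sub>R G (S n \<omega>)"
        unfolding sum_distrib_left scaleR_sum_left ..
      finally show "(\<Sum>d | d dvd n. (1/x * selberg d) *\<^sub>R G (S (d * (n div d)) \<omega>)) =
        (1/x * (ln (real n))\<^sup>2) *\<^sub>R G (S n \<omega>)" by (simp only: sum_selberg_dvd[OF n])
    qed
    finally have eq1: "(\<Sum>d\<in>nats_upto x. (selberg d / real d) *\<^sub>R mult_avg S G (x / real d) (S d \<omega>)) =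
      (\<Sum>n\<in>nats_upto x. (1/x * (ln (real n))\<^sup>2) *\<^sub>R G (S n \<omega>))" .
    show ?thesis unfolding eq1 unfolding mult_avg_def scaleR_sum_right sum_subtractf [symmetric]
      by (intro sum.cong refl) (simp add: right_diff_distrib scaleR_left_diff_distrib mult.commute)
  qed
  have "L2_norm M (\<lambda>\<omega>. \<Sum>n\<in>nats_upto x. ((1/x) * ((ln x)\<^sup>2 - (ln (real n))\<^sup>2)) *\<^sub>R G (S n \<omega>)) \<le>
     (\<Sum>n\<in>nats_upto x. \<bar>(1/x) * ((ln x)\<^sup>2 - (ln (real n))\<^sup>2)\<bar>) * L2_norm M G"
    by (rule L2_norm_weighted_sum_le) (auto simp: nats_upto_def S_L2 S_norm G)
  also have "\<dots> \<le> (1/x * (2 * ln x * (4 * x))) * L2_norm M G"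
  proof (rule mult_right_mono)
    have "(\<Sum>n\<in>nats_upto x. \<bar>(1/x) * ((ln x)\<^sup>2 - (ln (real n))\<^sup>2)\<bar>) \<le>
      (\<Sum>n\<in>nats_upto x. 1/x * (2 * ln x * (ln x - ln (real n))))"
    proof (rule sum_mono)
      fix n assume "n \<in> nats_upto x"
      then have n: "0 < n" "real n \<le> x" by (auto simp: nats_upto_def)
      then have l: "0 \<le> ln (real n)" "ln (real n) \<le> ln x" by auto
      have "(ln x)\<^sup>2 - (ln (real n))\<^sup>2 = (ln x + ln (real n)) * (ln x - ln (real n))"
        by (simp add: power2_eq_square algebra_simps)
      moreover have "0 \<le> (ln x + ln (real n)) * (ln x - ln (real n))" using l by (intro mult_nonneg_nonneg) auto
      moreover have "(ln x + ln (real n)) * (ln x - ln (real n)) \<le> 2 * ln x * (ln x - ln (real n))"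
        using l by (intro mult_right_mono) auto
      ultimately show "\<bar>(1/x) * ((ln x)\<^sup>2 - (ln (real n))\<^sup>2)\<bar> \<le> 1/x * (2 * ln x * (ln x - ln (real n)))"
        using x by (simp add: abs_mult divide_right_mono)
    qed
    also have "\<dots> = 1/x * (2 * ln x * (\<Sum>n\<in>nats_upto x. ln x - ln (real n)))"
      by (simp only: sum_distrib_left)
    also have "\<dots> \<le> 1/x * (2 * ln x * (4 * x))"
      using sum_ln_diff_le[OF x] x by (intro mult_left_mono) auto
    finally show "(\<Sum>n\<in>nats_upto x. \<bar>(1/x) * ((ln x)\<^sup>2 - (ln (real n))\<^sup>2)\<bar>) \<le> 1/x * (2 * ln x * (4 * x))" .
  qed simp
  also have "\<dots> = 8 * ln x * L2_norm M G" using x by simp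
  finally show ?thesis by (subst L2_norm_cong[OF eq])
qed

text \<open>Where the norm of the average is almost as large as it ever gets, the weighted mean on the right hand side of
  Selberg's identity can only be that large if almost all its terms agree (uniform convexity).\<close>

lemma selberg_concentration:
  assumes G: "L2_fun M G" and \<alpha>: "\<alpha> > 0"
    and limsup: "\<And>\<kappa>. \<kappa> > 0 \<Longrightarrow> \<exists>X. \<forall>x\<ge>X. L2_norm M (mult_avg S G x) \<le> \<alpha> + \<kappa>" and \<eta>: "\<eta> > 0"
  shows "\<exists>\<kappa>>0. \<exists>X. \<forall>x\<ge>X. L2_norm M (mult_avg S G x) \<ge> \<alpha> - \<kappa> \<longrightarrow>
    (\<Sum>d\<in>nats_upto x. selberg d / real d *
      (L2_norm M (\<lambda>\<omega>. mult_avg S G (x / real d) (S d \<omega>) - mult_avg S G x \<omega>))\<^sup>2) \<le> \<eta> * (ln x)\<^sup>2"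
proof -
  define g where "g = L2_norm M G"
  \<comment> \<open>Then \<open>(\<alpha> + \<kappa>)\<^sup>2 - (\<alpha> - \<kappa>)\<^sup>2 = 4 *
    \<alpha> * \<kappa>\<close> uses up half of \<open>\<eta>\<close>; the other half is for the
    lower order terms collected in \<open>K\<close>.\<close>
  define \<kappa> where "\<kappa> = min \<alpha> (\<eta> / (8 * \<alpha>))"
  have \<kappa>: "\<kappa> > 0" "\<kappa> \<le> \<alpha>" "4 * \<alpha> * \<kappa> \<le> \<eta> / 2"
  proof -
    show "\<kappa> > 0" "\<kappa> \<le> \<alpha>" using \<alpha> \<eta> by (auto simp: \<kappa>_def)
    have "4 * \<alpha> * \<kappa> \<le> 4 * \<alpha> * (\<eta> / (8 * \<alpha>))" using \<alpha> by (intro mult_left_mono) (auto simp: \<kappa>_def)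
    also have "\<dots> = \<eta> / 2" using \<alpha> by simp
    finally show "4 * \<alpha> * \<kappa> \<le> \<eta> / 2" .
  qed
  obtain Y0 where Y0: "\<And>x. x \<ge> Y0 \<Longrightarrow> L2_norm M (mult_avg S G x) \<le> \<alpha> + \<kappa>" using limsup[OF \<kappa>(1)] by blast
  define Y where "Y = max 1 Y0"
  have Y: "Y \<ge> 1" "\<And>x. x \<ge> Y \<Longrightarrow> L2_norm M (mult_avg S G x) \<le> \<alpha> + \<kappa>" using Y0 by (auto simp: Y_def)
  obtain C1 where C1: "C1 \<ge> 0"
    "\<And>x. x \<ge> 1 \<Longrightarrow> \<bar>(\<Sum>d\<in>nats_upto x. selberg d) - 2 * x * ln x\<bar> \<le> C1 * x"
    using selberg_formula by blast
  obtain C2 where C2: "C2 \<ge> 0"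
    "\<And>x. x \<ge> 1 \<Longrightarrow> (\<Sum>d\<in>nats_upto x. selberg d / real d) \<le> (ln x)\<^sup>2 + 2 * ln x + C2"
    using sum_selberg_over_le by blast
  define A where "A = mult_avg S G"
  define K where "K = (2 + C2) * ((\<alpha> + \<kappa>)\<^sup>2 + g\<^sup>2) + g\<^sup>2 * Y * (2 + C1) + 16 * g\<^sup>2"
  have K: "K \<ge> 0" unfolding K_def using C1 C2 Y by (intro add_nonneg_nonneg mult_nonneg_nonneg) auto
  define X where "X = max Y (exp (max 1 (2 * K / \<eta>)))"
  show ?thesis
  proof (rule exI[of _ \<kappa>], intro conjI \<kappa>(1) exI[of _ X] allI impI)
    fix x assume xX: "x \<ge> X" and big: "L2_norm M (mult_avg S G x) \<ge> \<alpha> - \<kappa>"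
    have x: "x \<ge> 1" "x \<ge> Y" using xX Y(1) by (auto simp: X_def)
    have "exp (max 1 (2 * K / \<eta>)) \<le> x" using xX by (simp add: X_def)
    then have "max 1 (2 * K / \<eta>) \<le> ln x" using x by (subst ln_ge_iff) auto
    then have lx: "ln x \<ge> 1" "ln x \<ge> 2 * K / \<eta>" by auto
    define w where "w d = selberg d / real d" for d
    define v where "v d = (\<lambda>\<omega>. A (x / real d) (S d \<omega>))" for d
    define W where "W = (\<Sum>d\<in>nats_upto x. w d)"
    define b where "b = L2_norm M (A x)"
    have w: "w d \<ge> 0" for d by (simp add: w_def selberg_nonneg)
    have AL2: "L2_fun M (A y)" for y unfolding A_def by (rule mult_avg_L2[OF G])
    have vL2: "L2_fun M (v d)" if "d \<in> nats_upto x" for d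
      unfolding v_def using that by (intro S_L2 AL2) (auto simp: nats_upto_def)
    have vnorm: "L2_norm M (v d) = L2_norm M (A (x / real d))" if "d \<in> nats_upto x" for d
      unfolding v_def using that by (intro S_norm AL2) (auto simp: nats_upto_def)
    have b: "\<alpha> - \<kappa> \<le> b" "b \<le> \<alpha> + \<kappa>" "b \<le> g" "0 \<le> b"
      using big Y(2)[OF x(2)] mult_avg_norm_le[OF G, of x] x by (auto simp: b_def A_def g_def)
    have W: "W \<le> (ln x)\<^sup>2 + 2 * ln x + C2" "W \<ge> 0"
      using C2(2)[OF x(1)] w by (auto simp: W_def w_def intro!: sum_nonneg)
    \<comment> \<open>If \<open>x / d < Y\<close>, only the trivial bound \<open>g\<close> is
      available, but then \<open>selberg d / d\<close> is at most \<open>Y / x * selberg d\<close>,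
      so by Selberg's formula these \<open>d\<close> have total weight
      \<open>O(ln x)\<close>.\<close>
    have s1: "(\<Sum>d\<in>nats_upto x. w d * (L2_norm M (v d))\<^sup>2) \<le> (\<alpha> + \<kappa>)\<^sup>2 * W + g\<^sup>2 * (Y * (2 * ln x + C1))"
    proof -
      have "(\<Sum>d\<in>nats_upto x. w d * (L2_norm M (v d))\<^sup>2) \<le>
          (\<Sum>d\<in>nats_upto x. (\<alpha> + \<kappa>)\<^sup>2 * w d + g\<^sup>2 * (Y / x * selberg d))"
      proof (rule sum_mono)
        fix d assume d: "d \<in> nats_upto x"
        then have d0: "d > 0" "real d \<le> x" by (auto simp: nats_upto_def)
        show "w d * (L2_norm M (v d))\<^sup>2 \<le> (\<alpha> + \<kappa>)\<^sup>2 * w d + g\<^sup>2 * (Y / x * selberg d)"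
        proof (cases "x / real d \<ge> Y")
          case True
          have "(L2_norm M (v d))\<^sup>2 \<le> (\<alpha> + \<kappa>)\<^sup>2"
            using Y(2)[OF True] vnorm[OF d] by (intro power_mono) (auto simp: A_def)
          then have "w d * (L2_norm M (v d))\<^sup>2 \<le> w d * (\<alpha> + \<kappa>)\<^sup>2" using w by (rule mult_left_mono)
          moreover have "g\<^sup>2 * (Y / x * selberg d) \<ge> 0"
            using Y x selberg_nonneg[of d] by (intro mult_nonneg_nonneg divide_nonneg_nonneg) auto
          ultimately show ?thesis by (simp add: mult.commute)
        next
          case False
          then have "1 / real d \<le> Y / x" using d0 x by (simp add: field_simps)
          have "L2_norm M (v d) \<le> g"
            using vnorm[OF d] mult_avg_norm_le[OF G, of "x / real d"] d0 x by (simp add: A_def g_def)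
          then have "(L2_norm M (v d))\<^sup>2 \<le> g\<^sup>2" by (intro power_mono) auto
          then have "w d * (L2_norm M (v d))\<^sup>2 \<le> w d * g\<^sup>2" using w by (rule mult_left_mono)
          also have "w d \<le> Y / x * selberg d"
            using mult_right_mono[OF \<open>1 / real d \<le> Y / x\<close> selberg_nonneg[of d]] by (simp add: w_def)
          then have "w d * g\<^sup>2 \<le> Y / x * selberg d * g\<^sup>2" by (rule mult_right_mono) simp
          finally have "w d * (L2_norm M (v d))\<^sup>2 \<le> g\<^sup>2 * (Y / x * selberg d)" by (simp add: mult.commute)
          moreover have "(\<alpha> + \<kappa>)\<^sup>2 * w d \<ge> 0" using w by simp
          ultimately show ?thesis by linarith
        qed
      qed
      also have "\<dots> = (\<alpha> + \<kappa>)\<^sup>2 * W + g\<^sup>2 * (Y / x * (\<Sum>d\<in>nats_upto x. selberg d))"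
        by (simp only: W_def sum.distrib sum_distrib_left)
      also have "\<dots> \<le> (\<alpha> + \<kappa>)\<^sup>2 * W + g\<^sup>2 * (Y / x * (2 * x * ln x + C1 * x))"
        using C1(2)[OF x(1)] Y x by (intro add_left_mono mult_left_mono) (auto simp: abs_le_iff)
      also have "Y / x * (2 * x * ln x + C1 * x) = Y * (2 * ln x + C1)" using x by (simp add: field_simps)
      finally show ?thesis .
    qed
    have sumL2: "L2_fun M (\<lambda>\<omega>. \<Sum>d\<in>nats_upto x. w d *\<^sub>R v d \<omega>)"
      by (intro L2_fun_sum L2_fun_scaleR vL2)
    have s2: "(\<Sum>d\<in>nats_upto x. w d * L2_inner M (v d) (A x)) \<ge> (ln x)\<^sup>2 * b\<^sup>2 - 8 * ln x * g\<^sup>2"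
    proof -
      have "(\<Sum>d\<in>nats_upto x. w d * L2_inner M (v d) (A x)) = L2_inner M (\<lambda>\<omega>. \<Sum>d\<in>nats_upto x. w d *\<^sub>R v d \<omega>) (A x)"
        by (subst L2_inner_sum_left) (auto simp: L2_inner_scaleR_left AL2 intro!: L2_fun_scaleR vL2)
      moreover have "L2_inner M (\<lambda>\<omega>. (ln x)\<^sup>2 *\<^sub>R A x \<omega> - (\<Sum>d\<in>nats_upto x. w d *\<^sub>R v d \<omega>)) (A x) =
          (ln x)\<^sup>2 * b\<^sup>2 - L2_inner M (\<lambda>\<omega>. \<Sum>d\<in>nats_upto x. w d *\<^sub>R v d \<omega>) (A x)"
        by (subst L2_inner_diff_left) (auto simp: L2_inner_scaleR_left b_def L2_norm_sq AL2 sumL2 intro!: L2_fun_scaleR)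
      moreover have "\<bar>L2_inner M (\<lambda>\<omega>. (ln x)\<^sup>2 *\<^sub>R A x \<omega> - (\<Sum>d\<in>nats_upto x. w d *\<^sub>R v d \<omega>)) (A x)\<bar> \<le>
          L2_norm M (\<lambda>\<omega>. (ln x)\<^sup>2 *\<^sub>R A x \<omega> - (\<Sum>d\<in>nats_upto x. w d *\<^sub>R v d \<omega>)) * b"
        unfolding b_def by (intro L2_Cauchy_Schwarz L2_fun_diff L2_fun_scaleR AL2 sumL2)
      moreover have "L2_norm M (\<lambda>\<omega>. (ln x)\<^sup>2 *\<^sub>R A x \<omega> - (\<Sum>d\<in>nats_upto x. w d *\<^sub>R v d \<omega>)) * b \<le> 8 * ln x * g * g"
        using mult_avg_selberg[OF G x(1)] b lx by (intro mult_mono) (auto simp: A_def v_def w_def g_def)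
      ultimately show ?thesis by (simp add: power2_eq_square abs_le_iff)
    qed
    \<comment> \<open>After expanding, the squared norms are on average at most about
      \<open>(\<alpha> + \<kappa>)\<^sup>2\<close>, and the inner products at least about
      \<open>b\<^sup>2\<close>, by Selberg's identity paired with \<open>A x\<close>. At most about
      \<open>(\<alpha> + \<kappa>)\<^sup>2 - b\<^sup>2\<close> times \<open>(ln x)\<^sup>2\<close>
      survives.\<close>
    have "(\<Sum>d\<in>nats_upto x. w d * (L2_norm M (\<lambda>\<omega>. v d \<omega> - A x \<omega>))\<^sup>2) =
        (\<Sum>d\<in>nats_upto x. w d * (L2_norm M (v d))\<^sup>2 - 2 * (w d * L2_inner M (v d) (A x)) + w d * b\<^sup>2)"
      by (intro sum.cong refl) (simp add: L2_norm_diff_sq vL2 AL2 b_def algebra_simps)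
    also have "\<dots> = (\<Sum>d\<in>nats_upto x. w d * (L2_norm M (v d))\<^sup>2) -
        2 * (\<Sum>d\<in>nats_upto x. w d * L2_inner M (v d) (A x)) + W * b\<^sup>2"
      by (simp only: sum.distrib sum_subtractf sum_distrib_left sum_distrib_right W_def)
    also have "\<dots> \<le> ((\<alpha> + \<kappa>)\<^sup>2 * W + g\<^sup>2 * (Y * (2 * ln x + C1))) - 2 * ((ln x)\<^sup>2 * b\<^sup>2 - 8 * ln x * g\<^sup>2) + W * b\<^sup>2"
      by (intro add_mono diff_mono mult_left_mono s1 s2) (use W in auto)
    also have "\<dots> = ((\<alpha> + \<kappa>)\<^sup>2 + b\<^sup>2) * W - 2 * (ln x)\<^sup>2 * b\<^sup>2 + g\<^sup>2 * Y * (2 * ln x + C1) + 16 * g\<^sup>2 * ln x"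
      by (simp add: algebra_simps)
    also have "\<dots> \<le> ((\<alpha> + \<kappa>)\<^sup>2 - b\<^sup>2) * (ln x)\<^sup>2 + K * ln x"
    proof -
      have "((\<alpha> + \<kappa>)\<^sup>2 + b\<^sup>2) * W \<le> ((\<alpha> + \<kappa>)\<^sup>2 + b\<^sup>2) * ((ln x)\<^sup>2 + 2 * ln x + C2)"
        using W by (intro mult_left_mono) auto
      also have "\<dots> = ((\<alpha> + \<kappa>)\<^sup>2 + b\<^sup>2) * (ln x)\<^sup>2 + ((\<alpha> + \<kappa>)\<^sup>2 + b\<^sup>2) * (2 * ln x + C2)"
        by (simp add: algebra_simps)
      also have "((\<alpha> + \<kappa>)\<^sup>2 + b\<^sup>2) * (2 * ln x + C2) \<le> ((\<alpha> + \<kappa>)\<^sup>2 + g\<^sup>2) * ((2 + C2) * ln x)"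
      proof (rule mult_mono)
        show "(\<alpha> + \<kappa>)\<^sup>2 + b\<^sup>2 \<le> (\<alpha> + \<kappa>)\<^sup>2 + g\<^sup>2" using b by (intro add_left_mono power_mono) auto
        show "2 * ln x + C2 \<le> (2 + C2) * ln x"
          using lx C2(1) mult_left_mono[of 1 "ln x" C2] by (simp add: algebra_simps)
      qed (use lx C2 in auto)
      finally have "((\<alpha> + \<kappa>)\<^sup>2 + b\<^sup>2) * W \<le> ((\<alpha> + \<kappa>)\<^sup>2 + b\<^sup>2) * (ln x)\<^sup>2 + ((\<alpha> + \<kappa>)\<^sup>2 + g\<^sup>2) * ((2 + C2) * ln x)"
        by simp
      moreover have "g\<^sup>2 * Y * (2 * ln x + C1) \<le> g\<^sup>2 * Y * ((2 + C1) * ln x)"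
        using lx C1(1) Y mult_left_mono[of 1 "ln x" C1] by (intro mult_left_mono) (auto simp: algebra_simps)
      ultimately show ?thesis unfolding K_def by (simp add: algebra_simps)
    qed
    also have "\<dots> \<le> (\<eta> / 2) * (ln x)\<^sup>2 + (\<eta> / 2) * (ln x)\<^sup>2"
    proof (rule add_mono)
      have "(\<alpha> - \<kappa>)\<^sup>2 \<le> b\<^sup>2" using b \<kappa> by (intro power_mono) auto
      then have "(\<alpha> + \<kappa>)\<^sup>2 - b\<^sup>2 \<le> 4 * \<alpha> * \<kappa>" by (simp add: power2_eq_square algebra_simps)
      then show "((\<alpha> + \<kappa>)\<^sup>2 - b\<^sup>2) * (ln x)\<^sup>2 \<le> (\<eta> / 2) * (ln x)\<^sup>2" using \<kappa>(3) by (intro mult_right_mono) auto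
      have "K \<le> \<eta> / 2 * ln x" using lx(2) \<eta> by (simp add: field_simps)
      then have "K * ln x \<le> \<eta> / 2 * ln x * ln x" using lx by (intro mult_right_mono) auto
      then show "K * ln x \<le> (\<eta> / 2) * (ln x)\<^sup>2" by (simp add: power2_eq_square)
    qed
    finally show "(\<Sum>d\<in>nats_upto x. selberg d / real d *
      (L2_norm M (\<lambda>\<omega>. mult_avg S G (x / real d) (S d \<omega>) - mult_avg S G x \<omega>))\<^sup>2) \<le> \<eta> * (ln x)\<^sup>2"
      by (simp add: w_def v_def A_def)
  qed
qed

end

section \<open>Windows on which the averages are almost constant\<close>

context mult_system
begin

text \<open>A product of two primes acts by a composition of two of the finitely many maps.
  Finiteness holds only for the restrictions, since values outside \<open>space M\<close> are
  arbitrary.\<close>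

lemma finite_semiprime_maps:
  assumes "finite {restrict (S p) (space M) | p. prime p}"
  shows "finite {restrict (S d) (space M) | d. prime_or_semiprime d}"
proof -
  let ?F = "{restrict (S p) (space M) | p. prime p}"
  have "{restrict (S d) (space M) | d. prime_or_semiprime d} \<subseteq>
      ?F \<union> (\<lambda>(u, v). restrict (\<lambda>\<omega>. u (v \<omega>)) (space M)) ` (?F \<times> ?F)"
  proof
    fix u assume "u \<in> {restrict (S d) (space M) | d. prime_or_semiprime d}"
    then obtain d where d: "u = restrict (S d) (space M)" "prime_or_semiprime d" by blast
    show "u \<in> ?F \<union> (\<lambda>(u, v). restrict (\<lambda>\<omega>. u (v \<omega>)) (space M)) ` (?F \<times> ?F)"
    proof (cases "prime d")
      case False
      then obtain p q where pq: "prime p" "prime q" "d = p * q"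
        using d(2) by (auto simp: prime_or_semiprime_def)
      have "u = restrict (\<lambda>\<omega>. restrict (S p) (space M) (restrict (S q) (space M) \<omega>)) (space M)"
        unfolding d(1) using pq by (intro restrict_ext) (simp add: S_space S_S prime_gt_0_nat)
      then show ?thesis using pq
        by (intro UnI2 image_eqI[of _ _ "(restrict (S p) (space M), restrict (S q) (space M))"]) auto
    qed (use d in blast)
  qed
  then show ?thesis by (rule finite_subset) (use assms in blast)
qed

lemma restrict_eqD: "restrict f A = restrict g A \<Longrightarrow> x \<in> A \<Longrightarrow> f x = g x"
  by (metis restrict_apply')

text \<open>On a run of cells the averages take, up to a small error, only finitely many values, and they vary slowly.\<close>

lemma almost_constant_window:
  assumes G: "L2_fun M G" and fg: "finite {restrict (S p) (space M) | p. prime p}"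
    and \<alpha>: "\<alpha> > 0"
    and limsup: "\<And>\<kappa>. \<kappa> > 0 \<Longrightarrow> \<exists>X. \<forall>x\<ge>X. L2_norm M (mult_avg S G x) \<le> \<alpha> + \<kappa>"
    and often: "\<And>\<kappa> X. \<kappa> > 0 \<Longrightarrow> \<exists>x\<ge>X. L2_norm M (mult_avg S G x) \<ge> \<alpha> - \<kappa>"
    and \<theta>: "\<theta> > 0" and Z: "Z \<ge> 1"
  shows "\<exists>v\<ge>V. L2_norm M (mult_avg S G v) \<ge> \<alpha> - \<theta> \<and>
    (\<forall>z\<in>{1..Z}. L2_norm M (\<lambda>\<omega>. mult_avg S G (v / z) \<omega> - mult_avg S G v \<omega>) \<le> \<theta>)"
proof -
  define A where "A = mult_avg S G"
  define g where "g = L2_norm M G"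
  define K where "K = card {restrict (S d) (space M) | d. prime_or_semiprime d}"
  \<comment> \<open>The final error is \<open>3 * e * K + 3 * \<delta> * g\<close> with
    \<open>e \<le> 2 * \<epsilon>\<close> and \<open>3 * \<delta> * g \<le> \<epsilon>\<close>, at
    most \<open>(6 * K + 1) * \<epsilon>\<close>.\<close>
  define \<epsilon> where "\<epsilon> = \<theta> / (6 * real K + 6)"
  define \<delta> where "\<delta> = min 1 (\<epsilon> / (3 * (g + 1)))"
  define e where "e = \<epsilon> + 3 * \<delta> * g"
  have g: "g \<ge> 0" by (simp add: g_def)
  have \<epsilon>: "\<epsilon> > 0" "(6 * real K + 6) * \<epsilon> = \<theta>" using \<theta> by (auto simp: \<epsilon>_def)
  have \<delta>: "\<delta> > 0" "\<delta> \<le> 1" "3 * \<delta> * g \<le> \<epsilon>"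
  proof -
    show "\<delta> > 0" "\<delta> \<le> 1" using \<epsilon> g by (auto simp: \<delta>_def)
    have "\<delta> \<le> \<epsilon> / (3 * (g + 1))" by (simp add: \<delta>_def)
    then have "\<delta> * (3 * (g + 1)) \<le> \<epsilon>" using g by (simp add: pos_le_divide_eq)
    moreover have "3 * \<delta> * g \<le> \<delta> * (3 * (g + 1))" using \<open>\<delta> > 0\<close> by (simp add: algebra_simps)
    ultimately show "3 * \<delta> * g \<le> \<epsilon>" by linarith
  qed
  have e: "e \<ge> 0" "e \<le> 2 * \<epsilon>" using \<epsilon> \<delta> g by (auto simp: e_def)
  \<comment> \<open>\<open>r\<close> cells of logarithmic length \<open>\<delta>\<close> cover the
    window of length \<open>ln Z\<close>.\<close>
  define r where "r = nat \<lceil>ln Z / \<delta>\<rceil> + 1"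
  have r: "r \<ge> 1" "ln Z < real r * \<delta>"
  proof -
    have "ln Z / \<delta> < real r" unfolding r_def by linarith
    then show "ln Z < real r * \<delta>" using \<delta> by (simp add: pos_divide_less_eq)
  qed (simp add: r_def)
  obtain \<kappa>0 X0 where cells: "\<kappa>0 > 0"
    "\<And>x B. x \<ge> X0 \<Longrightarrow> (\<Sum>d | d \<in> nats_upto x \<and> d \<in> B. selberg d / real d) \<le> \<kappa>0 * (ln x)\<^sup>2 \<Longrightarrow>
      \<exists>j0. real (j0 + r) * \<delta> \<le> 7/8 * ln x \<and>
        (\<forall>j\<in>{j0..<j0 + r}. \<exists>d. d \<in> nats_upto x \<and> d \<notin> B \<and> exp (real j * \<delta>) < real d \<and> real d \<le> exp (real (Suc j) * \<delta>))"
    using run_of_good_cells[OF \<delta>(1) r(1)] by blast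
  have "\<kappa>0 * \<epsilon>\<^sup>2 / 2 > 0" using cells(1) \<epsilon> by simp
  from selberg_concentration[OF G \<alpha> limsup this] obtain \<kappa> X1 where conc: "\<kappa> > 0"
    "\<And>x. x \<ge> X1 \<Longrightarrow> L2_norm M (A x) \<ge> \<alpha> - \<kappa> \<Longrightarrow>
      (\<Sum>d\<in>nats_upto x. selberg d / real d * (L2_norm M (\<lambda>\<omega>. A (x / real d) (S d \<omega>) - A x \<omega>))\<^sup>2)
        \<le> \<kappa>0 * \<epsilon>\<^sup>2 / 2 * (ln x)\<^sup>2"
    unfolding A_def by blast
  \<comment> \<open>The bounds on \<open>ln x\<close> ensure, in this order: numbers that are
    neither prime nor a product of two primes weigh at most
    \<open>\<kappa>0 / 2 * (ln x)\<^sup>2\<close>; the points \<open>u j \<ge> x powr (1/8)\<close>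
    exceed \<open>1 / \<delta>\<close>; they exceed \<open>V\<close>; and
    \<open>x \<ge> 1\<close>.\<close>
  define X where "X = max (max X0 X1) (exp (max (160 / \<kappa>0) (max (8 * ln (1 / \<delta>)) (max (8 * ln (max 1 V)) 1))))"
  obtain x where xX: "x \<ge> X" and big: "L2_norm M (A x) \<ge> \<alpha> - min \<kappa> \<epsilon>"
    using often[of "min \<kappa> \<epsilon>" X] conc(1) \<epsilon> unfolding A_def by auto
  have "exp (max (160 / \<kappa>0) (max (8 * ln (1 / \<delta>)) (max (8 * ln (max 1 V)) 1))) \<le> x"
    using xX by (simp add: X_def)
  moreover from this have x0: "x > 0" using exp_gt_zero order.strict_trans2 by blast
  ultimately have "max (160 / \<kappa>0) (max (8 * ln (1 / \<delta>)) (max (8 * ln (max 1 V)) 1)) \<le> ln x"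
    by (subst ln_ge_iff) auto
  then have lx: "160 / \<kappa>0 \<le> ln x" "8 * ln (1 / \<delta>) \<le> ln x" "8 * ln (max 1 V) \<le> ln x" "1 \<le> ln x" by auto
  have x1: "x \<ge> 1" using lx(4) x0 ln_less_zero_iff[of x] by linarith
  define far where "far d = (L2_norm M (\<lambda>\<omega>. A (x / real d) (S d \<omega>) - A x \<omega>) > \<epsilon>)" for d
  \<comment> \<open>Excluded are the \<open>d\<close> violating the conclusion of the concentration
    lemma by more than \<open>\<epsilon>\<close>, and those whose maps are not known to be finite in
    number. Each of the two parts gets half of \<open>\<kappa>0\<close>.\<close>
  define B where "B = {d. far d} \<union> {d. \<not> prime_or_semiprime d}"
  have fin: "finite {d. d \<in> nats_upto x \<and> P d}" for P
    by (rule finite_subset[OF _ finite_nats_upto[of x]]) auto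
  have "(\<Sum>d | d \<in> nats_upto x \<and> d \<in> B. selberg d / real d) \<le> \<kappa>0 * (ln x)\<^sup>2"
  proof -
    have "(\<Sum>d | d \<in> nats_upto x \<and> d \<in> B. selberg d / real d) \<le>
        (\<Sum>d | d \<in> nats_upto x \<and> far d. selberg d / real d) +
        (\<Sum>d | d \<in> nats_upto x \<and> \<not> prime_or_semiprime d. selberg d / real d)"
    proof -
      have "(\<Sum>d | d \<in> nats_upto x \<and> d \<in> B. selberg d / real d) =
        (\<Sum>d\<in>{d. d \<in> nats_upto x \<and> far d} \<union> {d. d \<in> nats_upto x \<and> \<not> prime_or_semiprime d}. selberg d / real d)"
        by (rule sum.cong) (auto simp: B_def)
      also have "\<dots> \<le> (\<Sum>d | d \<in> nats_upto x \<and> far d. selberg d / real d) +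
        (\<Sum>d | d \<in> nats_upto x \<and> \<not> prime_or_semiprime d. selberg d / real d)"
        by (subst sum_Un[OF fin fin]) (simp add: sum_nonneg selberg_nonneg)
      finally show ?thesis .
    qed
    moreover have "(\<Sum>d | d \<in> nats_upto x \<and> \<not> prime_or_semiprime d. selberg d / real d) \<le> 80 * ln x"
      by (rule sum_selberg_not_semiprime_le[OF x1])
    moreover have "80 * ln x \<le> \<kappa>0 / 2 * (ln x)\<^sup>2"
    proof -
      have "160 \<le> \<kappa>0 * ln x" using lx(1) cells(1) by (simp add: field_simps)
      then have "160 * ln x \<le> \<kappa>0 * ln x * ln x" using lx by (intro mult_right_mono) auto
      then show ?thesis by (simp add: power2_eq_square)
    qed
    moreover have "(\<Sum>d | d \<in> nats_upto x \<and> far d. selberg d / real d) \<le> \<kappa>0 / 2 * (ln x)\<^sup>2"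
    proof -
      have "(\<Sum>d | d \<in> nats_upto x \<and> far d. selberg d / real d) * \<epsilon>\<^sup>2 =
          (\<Sum>d | d \<in> nats_upto x \<and> far d. selberg d / real d * \<epsilon>\<^sup>2)" by (rule sum_distrib_right)
      also have "\<dots> \<le> (\<Sum>d | d \<in> nats_upto x \<and> far d. selberg d / real d *
          (L2_norm M (\<lambda>\<omega>. A (x / real d) (S d \<omega>) - A x \<omega>))\<^sup>2)"
        using \<epsilon> by (intro sum_mono mult_left_mono power_mono) (auto simp: far_def selberg_nonneg)
      also have "\<dots> \<le> (\<Sum>d\<in>nats_upto x. selberg d / real d *
          (L2_norm M (\<lambda>\<omega>. A (x / real d) (S d \<omega>) - A x \<omega>))\<^sup>2)"
        by (rule sum_mono2) (auto simp: selberg_nonneg)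
      also have "\<dots> \<le> \<kappa>0 * \<epsilon>\<^sup>2 / 2 * (ln x)\<^sup>2"
        by (rule conc(2)) (use xX big in \<open>auto simp: X_def\<close>)
      also have "\<dots> = (\<kappa>0 / 2 * (ln x)\<^sup>2) * \<epsilon>\<^sup>2" by simp
      finally show ?thesis by (rule mult_right_le_imp_le) (use \<epsilon> in simp)
    qed
    ultimately show ?thesis by linarith
  qed
  from cells(2)[OF _ this] xX obtain j0 where j0: "real (j0 + r) * \<delta> \<le> 7/8 * ln x"
    "\<forall>j\<in>{j0..<j0 + r}. \<exists>d. d \<in> nats_upto x \<and> d \<notin> B \<and> exp (real j * \<delta>) < real d \<and> real d \<le> exp (real (Suc j) * \<delta>)"
    by (auto simp: X_def)
  from bchoice[OF j0(2)] obtain d where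
    d: "\<And>j. j \<in> {j0..<j0 + r} \<Longrightarrow> d j \<in> nats_upto x" "\<And>j. j \<in> {j0..<j0 + r} \<Longrightarrow> d j \<notin> B"
      "\<And>j. j \<in> {j0..<j0 + r} \<Longrightarrow> exp (real j * \<delta>) < real (d j)"
      "\<And>j. j \<in> {j0..<j0 + r} \<Longrightarrow> real (d j) \<le> exp (real (Suc j) * \<delta>)"
    by blast
  \<comment> \<open>\<open>u j\<close> is \<open>x\<close> divided by the left end of cell
    \<open>j\<close>. So \<open>x / d j\<close> lies between \<open>u (Suc j)\<close> and
    \<open>u j\<close>, and slow variation allows \<open>A (u j)\<close> in place of
    \<open>A (x / d j)\<close>.\<close>
  define u where "u j = x * exp (- (real j * \<delta>))" for j :: nat
  have u_pos: "u j > 0" for j using x0 by (simp add: u_def)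
  have u_Suc: "u (Suc j) = u j * exp (-\<delta>)" for j
  proof -
    have "- (real (Suc j) * \<delta>) = - (real j * \<delta>) + (- \<delta>)" by (simp add: algebra_simps)
    then show ?thesis unfolding u_def by (simp only: exp_add mult.assoc)
  qed
  have u_ge: "ln x / 8 \<le> ln (u j)" if "j \<le> j0 + r" for j
  proof -
    have "real j * \<delta> \<le> real (j0 + r) * \<delta>" using that \<delta> by (intro mult_right_mono) auto
    then show ?thesis using j0(1) x0 by (simp add: u_def ln_mult)
  qed
  have u_large: "u j \<ge> 1 / \<delta>" "u j \<ge> V" if "j \<le> j0 + r" for j
  proof -
    have "ln (1 / \<delta>) \<le> ln (u j)" "ln (max 1 V) \<le> ln (u j)" using u_ge[OF that] lx by linarith+
    then have "1 / \<delta> \<le> u j" "max 1 V \<le> u j" using u_pos[of j] \<delta> by (simp_all only: ln_le_cancel_iff) auto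
    then show "u j \<ge> 1 / \<delta>" "u j \<ge> V" by auto
  qed
  have AL2: "L2_fun M (A y)" for y unfolding A_def by (rule mult_avg_L2[OF G])
  have lip: "L2_norm M (\<lambda>\<omega>. A (u j) \<omega> - A y \<omega>) \<le> 3 * \<delta> * g"
    if "j \<le> j0 + r" "u (Suc j) \<le> y" "y \<le> u j" for j y
  proof -
    have y: "y > 0" using that u_pos[of "Suc j"] by linarith
    have "1 - exp (-\<delta>) \<le> \<delta>" using exp_ge_add_one_self[of "-\<delta>"] by simp
    then have "u j * (1 - exp (-\<delta>)) \<le> u j * \<delta>" using u_pos[of j] by (intro mult_left_mono) auto
    then have "u j - y \<le> u j * \<delta>" using that(2) unfolding u_Suc by (simp add: algebra_simps)
    moreover have "1 \<le> u j * \<delta>" using u_large(1)[OF that(1)] \<delta> by (simp add: field_simps)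
    moreover have "2 * a + 1 \<le> 3 * b" if "a \<le> b" "1 \<le> b" for a b :: real using that by linarith
    ultimately have "2 * (u j - y) + 1 \<le> 3 * (u j * \<delta>)" by blast
    then have "(2 * (u j - y) + 1) / u j \<le> 3 * \<delta>" using u_pos[of j] by (simp add: field_simps)
    then have "g * ((2 * (u j - y) + 1) / u j) \<le> g * (3 * \<delta>)" using g by (intro mult_left_mono)
    then show ?thesis
      using mult_avg_lipschitz[OF G y that(3)] by (simp add: A_def g_def mult_ac)
  qed
  have near: "L2_norm M (\<lambda>\<omega>. A (u j) (S (d j) \<omega>) - A x \<omega>) \<le> e" if j: "j \<in> {j0..<j0 + r}" for j
  proof -
    have dj: "d j > 0" using d(1)[OF j] by (rule nats_upto_pos)
    have dj': "real (d j) > 0" using dj by simp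
    have "x / exp (real (Suc j) * \<delta>) \<le> x / real (d j)"
      using d(4)[OF j] x0 dj' by (intro divide_left_mono) auto
    then have lo: "u (Suc j) \<le> x / real (d j)" by (simp add: u_def exp_minus divide_inverse)
    have "x / real (d j) \<le> x / exp (real j * \<delta>)"
      using d(3)[OF j] x0 dj' by (intro divide_left_mono) auto
    then have hi: "x / real (d j) \<le> u j" by (simp add: u_def exp_minus divide_inverse)
    have "L2_norm M (\<lambda>\<omega>. A (u j) (S (d j) \<omega>) - A (x / real (d j)) (S (d j) \<omega>)) =
        L2_norm M (\<lambda>\<omega>. A (u j) \<omega> - A (x / real (d j)) \<omega>)"
      using S_norm[OF dj L2_fun_diff[OF AL2[of "u j"] AL2[of "x / real (d j)"]]] by simp
    also have "\<dots> \<le> 3 * \<delta> * g" using lip[OF _ lo hi] j by simp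
    finally have 1: "L2_norm M (\<lambda>\<omega>. A (u j) (S (d j) \<omega>) - A (x / real (d j)) (S (d j) \<omega>)) \<le> 3 * \<delta> * g" .
    have 2: "L2_norm M (\<lambda>\<omega>. A (x / real (d j)) (S (d j) \<omega>) - A x \<omega>) \<le> \<epsilon>"
      using d(2)[OF j] by (simp add: B_def far_def)
    have "L2_norm M (\<lambda>\<omega>. A (u j) (S (d j) \<omega>) - A x \<omega>) \<le>
      L2_norm M (\<lambda>\<omega>. A (u j) (S (d j) \<omega>) - A (x / real (d j)) (S (d j) \<omega>)) +
      L2_norm M (\<lambda>\<omega>. A (x / real (d j)) (S (d j) \<omega>) - A x \<omega>)"
      by (rule L2_norm_triangle) (intro S_L2 dj AL2)+
    then show ?thesis using 1 2 by (simp add: e_def)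
  qed
  \<comment> \<open>The colour of \<open>j\<close> is the map \<open>S (d j)\<close>. If
    \<open>i\<close> and \<open>k\<close> share it, \<open>A (u i)\<close> and
    \<open>A (u k)\<close> composed with the same map are both near \<open>A x\<close>, and since
    this map preserves norms, \<open>A (u i)\<close> and \<open>A (u k)\<close> are near each
    other.\<close>
  have walk: "L2_norm M (\<lambda>\<omega>. A (u j0) \<omega> - A (u j) \<omega>) \<le> 3 * e * real K" if j: "j \<in> {j0..<j0 + r}" for j
  proof -
    define c where "c j = restrict (S (d j)) (space M)" for j
    have "L2_norm M (\<lambda>\<omega>. A (u j0) \<omega> - A (u j) \<omega>) \<le> 3 * e * real (card (c ` {j0..j}))"
    proof (rule coloured_walk[where D = "\<lambda>i j. L2_norm M (\<lambda>\<omega>. A (u i) \<omega> - A (u j) \<omega>)"])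
      show "L2_norm M (\<lambda>\<omega>. A (u i) \<omega> - A (u k) \<omega>) \<le>
        L2_norm M (\<lambda>\<omega>. A (u i) \<omega> - A (u l) \<omega>) + L2_norm M (\<lambda>\<omega>. A (u l) \<omega> - A (u k) \<omega>)" for i l k
        by (rule L2_norm_triangle) (rule AL2)+
      show "L2_norm M (\<lambda>\<omega>. A (u i) \<omega> - A (u (Suc i)) \<omega>) \<le> e" if "j0 \<le> i" "i < j" for i
      proof -
        have "u (Suc i) \<le> u i" unfolding u_Suc using u_pos[of i] \<delta> by (simp add: mult_le_cancel_left1)
        then have "L2_norm M (\<lambda>\<omega>. A (u i) \<omega> - A (u (Suc i)) \<omega>) \<le> 3 * \<delta> * g" using that j by (intro lip) auto
        then show ?thesis using \<epsilon> by (simp add: e_def)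
      qed
      show "L2_norm M (\<lambda>\<omega>. A (u i) \<omega> - A (u k) \<omega>) \<le> 2 * e"
        if ik: "j0 \<le> i" "i \<le> k" "k \<le> j" "c i = c k" for i k
      proof -
        have i: "i \<in> {j0..<j0 + r}" and k: "k \<in> {j0..<j0 + r}" using ik j by auto
        have di: "d i > 0" and dk: "d k > 0" using d(1)[OF i] d(1)[OF k] by (auto dest: nats_upto_pos)
        have "L2_norm M (\<lambda>\<omega>. A (u i) \<omega> - A (u k) \<omega>) = L2_norm M (\<lambda>\<omega>. A (u i) (S (d i) \<omega>) - A (u k) (S (d i) \<omega>))"
          using S_norm[OF di L2_fun_diff[OF AL2[of "u i"] AL2[of "u k"]]] by simp
        also have "\<dots> = L2_norm M (\<lambda>\<omega>. A (u i) (S (d i) \<omega>) - A (u k) (S (d k) \<omega>))"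
          using restrict_eqD[OF ik(4)[unfolded c_def]] by (intro L2_norm_cong) simp
        also have "\<dots> \<le> L2_norm M (\<lambda>\<omega>. A (u i) (S (d i) \<omega>) - A x \<omega>) + L2_norm M (\<lambda>\<omega>. A x \<omega> - A (u k) (S (d k) \<omega>))"
          by (rule L2_norm_triangle) (intro S_L2 di dk AL2)+
        also have "\<dots> \<le> e + e"
          using near[OF i] near[OF k] L2_norm_minus_commute[of M "A x" "\<lambda>\<omega>. A (u k) (S (d k) \<omega>)"]
          by (intro add_mono) linarith+
        finally show ?thesis by simp
      qed
    qed (use j e in auto)
    also have "\<dots> \<le> 3 * e * real K"
    proof -
      have "c ` {j0..j} \<subseteq> {restrict (S d) (space M) | d. prime_or_semiprime d}"
        using d(2) j by (fastforce simp: c_def B_def)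
      then have "card (c ` {j0..j}) \<le> K"
        unfolding K_def by (rule card_mono[OF finite_semiprime_maps[OF fg]])
      then show ?thesis using e by (intro mult_left_mono) auto
    qed
    finally show ?thesis .
  qed
  have \<theta>_ge: "3 * e * real K + 3 * \<delta> * g \<le> \<theta>" "\<epsilon> + e \<le> \<theta>"
  proof -
    have "3 * e * real K \<le> 3 * (2 * \<epsilon>) * real K" using e by (intro mult_right_mono mult_left_mono) auto
    then show "3 * e * real K + 3 * \<delta> * g \<le> \<theta>" using \<delta>(3) \<epsilon> by (simp add: algebra_simps)
    have "real K * \<epsilon> \<ge> 0" using \<epsilon> by simp
    moreover have "\<theta> = 6 * \<epsilon> + 6 * (real K * \<epsilon>)" using \<epsilon>(2) by (simp add: algebra_simps)
    ultimately show "\<epsilon> + e \<le> \<theta>" using e \<epsilon>(1) by linarith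
  qed
  have j0_in: "j0 \<in> {j0..<j0 + r}" using r by simp
  show ?thesis
  proof (rule exI[of _ "u j0"], intro conjI ballI)
    show "V \<le> u j0" using u_large by simp
    have d0: "d j0 > 0" using d(1)[OF j0_in] by (rule nats_upto_pos)
    have "L2_norm M (A x) - L2_norm M (\<lambda>\<omega>. A (u j0) (S (d j0) \<omega>)) \<le> L2_norm M (\<lambda>\<omega>. A x \<omega> - A (u j0) (S (d j0) \<omega>))"
      by (intro L2_norm_diff_ge S_L2 d0 AL2)
    also have "\<dots> \<le> e" using near[OF j0_in] by (subst L2_norm_minus_commute)
    finally have "L2_norm M (A x) - e \<le> L2_norm M (A (u j0))" by (simp add: S_norm[OF d0 AL2])
    then show "\<alpha> - \<theta> \<le> L2_norm M (mult_avg S G (u j0))"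
      using big \<theta>_ge(2) unfolding A_def [symmetric] by linarith
  next
    fix z assume z: "z \<in> {1..Z}"
    \<comment> \<open>The cell, counted from \<open>j0\<close>, for which \<open>u j0 / z\<close>
      lies between \<open>u (Suc (j0 + k))\<close> and \<open>u (j0 + k)\<close>.\<close>
    define k where "k = nat \<lfloor>ln z / \<delta>\<rfloor>"
    have lz: "0 \<le> ln z" "ln z \<le> ln Z" using z by auto
    have "real k \<le> ln z / \<delta>" "ln z / \<delta> < real k + 1" using lz \<delta> by (auto simp: k_def)
    then have k: "real k * \<delta> \<le> ln z" "ln z < real (Suc k) * \<delta>"
      using \<delta> by (simp_all add: pos_le_divide_eq pos_divide_less_eq add.commute)
    have "real k * \<delta> < real r * \<delta>" using k lz r by linarith
    then have kr: "k < r" using \<delta> by simp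
    have jk: "j0 + k \<in> {j0..<j0 + r}" using kr by simp
    have uz: "u j0 / z = x * exp (- (real j0 * \<delta>) - ln z)" using z by (simp add: u_def exp_diff)
    have "u (Suc (j0 + k)) \<le> u j0 / z"
      unfolding uz using x0 k by (simp add: u_def algebra_simps)
    moreover have "u j0 / z \<le> u (j0 + k)"
      unfolding uz using x0 k by (simp add: u_def algebra_simps)
    ultimately have "L2_norm M (\<lambda>\<omega>. A (u (j0 + k)) \<omega> - A (u j0 / z) \<omega>) \<le> 3 * \<delta> * g"
      using jk by (intro lip) auto
    moreover have "L2_norm M (\<lambda>\<omega>. A (u j0) \<omega> - A (u j0 / z) \<omega>) \<le>
      L2_norm M (\<lambda>\<omega>. A (u j0) \<omega> - A (u (j0 + k)) \<omega>) + L2_norm M (\<lambda>\<omega>. A (u (j0 + k)) \<omega> - A (u j0 / z) \<omega>)"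
      by (rule L2_norm_triangle) (rule AL2)+
    ultimately have "L2_norm M (\<lambda>\<omega>. A (u j0) \<omega> - A (u j0 / z) \<omega>) \<le> \<theta>" using walk[OF jk] \<theta>_ge(1) by linarith
    then show "L2_norm M (\<lambda>\<omega>. mult_avg S G (u j0 / z) \<omega> - mult_avg S G (u j0) \<omega>) \<le> \<theta>"
      unfolding A_def [symmetric] by (subst L2_norm_minus_commute)
  qed
qed

end

section \<open>Classes of primes and the multiplicative mean ergodic theorem\<close>

lemma exists_finite_large_sum:
  fixes P :: "nat set"
  assumes "\<not> (\<lambda>p. 1 / real p) summable_on P"
  obtains Q where "finite Q" "Q \<subseteq> P" "(\<Sum>p\<in>Q. 1 / real p) \<ge> L"
proof (rule ccontr)
  assume "\<not> thesis"
  with that have "\<And>Q. finite Q \<Longrightarrow> Q \<subseteq> P \<Longrightarrow> (\<Sum>p\<in>Q. 1 / real p) \<le> L" by (meson linear)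
  then have "(\<lambda>p. 1 / real p) summable_on P"
    by (intro nonneg_bdd_above_summable_on) (auto intro!: bdd_aboveI[of _ L])
  with assms show False by simp
qed

text \<open>Contraposed for \<open>1 / p\<close>, this is the pigeonhole principle that yields a
  class of primes with divergent reciprocal sum. It is also applied directly to the sum in the
  definition of pretentious ergodicity.\<close>

lemma summable_on_finite_fibres:
  fixes t :: "'b \<Rightarrow> real"
  assumes "finite (\<phi> ` A)" "\<And>u. u \<in> \<phi> ` A \<Longrightarrow> t summable_on {p \<in> A. \<phi> p = u}"
  shows "t summable_on A"
proof -
  have "t summable_on (\<Union>u\<in>U. {p \<in> A. \<phi> p = u})" if "finite U" "U \<subseteq> \<phi> ` A" for U
    using that
  proof (induction U rule: finite_induct)
    case (insert u U)
    have "{p \<in> A. \<phi> p = u} \<inter> (\<Union>u\<in>U. {p \<in> A. \<phi> p = u}) = {}" using insert(2) by auto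
    then show ?case using insert assms(2)[of u] by (simp add: summable_on_Un_disjoint)
  qed simp
  from this[OF assms(1) order_refl] have "t summable_on (\<Union>u\<in>\<phi> ` A. {p \<in> A. \<phi> p = u})" .
  also have "(\<Union>u\<in>\<phi> ` A. {p \<in> A. \<phi> p = u}) = A" by auto
  finally show ?thesis .
qed

context mult_system
begin

text \<open>Take a window at \<open>v\<close> where the norm is close to its upper limit
  \<open>\<alpha>\<close>; there \<open>A v\<close> is close to \<open>A v \<circ> S p0\<close>. The
  maps commute, so \<open>A v = AH - AH \<circ> S p0\<close> with \<open>AH\<close> the average of
  \<open>H\<close>, and invariance of the measure turns the squared norm of \<open>A v\<close> into
  the inner product of \<open>A v \<circ> S p0 - A v\<close> with \<open>AH \<circ> S p0\<close>.
  This is small, which excludes \<open>\<alpha> > 0\<close>.\<close>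

lemma mult_avg_coboundary_tendsto:
  assumes H: "L2_fun M H" and fg: "finite {restrict (S p) (space M) | p. prime p}"
    and P: "\<And>p. p \<in> P \<Longrightarrow> prime p" "\<And>p \<omega>. p \<in> P \<Longrightarrow> \<omega> \<in> space M \<Longrightarrow> S p \<omega> = S p0 \<omega>" "prime p0"
    and div: "\<not> (\<lambda>p. 1 / real p) summable_on P"
  shows "((\<lambda>x. L2_norm M (mult_avg S (\<lambda>\<omega>. H \<omega> - H (S p0 \<omega>)) x)) \<longlongrightarrow> 0) at_top"
proof -
  define G where "G = (\<lambda>\<omega>. H \<omega> - H (S p0 \<omega>))"
  define A where "A = mult_avg S G"
  define g where "g = L2_norm M G"
  define h where "h = L2_norm M H + 1"
  have p0: "p0 > 0" using P(3) by (rule prime_gt_0_nat)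
  have G: "L2_fun M G" unfolding G_def by (intro L2_fun_diff H S_L2 p0)
  have g: "g \<ge> 0" and h: "h > 0" by (auto simp: g_def h_def add_nonneg_pos)
  have AL2: "L2_fun M (A y)" for y unfolding A_def by (rule mult_avg_L2[OF G])
  \<comment> \<open>The upper limit is encoded as the infimum of the eventual bounds.\<close>
  define C where "C = {c. \<exists>X. \<forall>x\<ge>X. L2_norm M (A x) \<le> c}"
  define \<alpha> where "\<alpha> = Inf C"
  have C: "C \<noteq> {}" "bdd_below C"
  proof -
    have "g \<in> C" unfolding C_def g_def A_def
      by (intro CollectI exI[of _ 1] allI impI mult_avg_norm_le G) auto
    then show "C \<noteq> {}" by blast
    show "bdd_below C"
    proof (rule bdd_belowI[of _ 0])
      fix c assume "c \<in> C"
      then obtain X where "L2_norm M (A X) \<le> c" by (auto simp: C_def)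
      then show "0 \<le> c" using L2_norm_nonneg[of M "A X"] by linarith
    qed
  qed
  have limsup: "\<exists>X. \<forall>x\<ge>X. L2_norm M (A x) \<le> \<alpha> + \<kappa>" if "\<kappa> > 0" for \<kappa>
  proof -
    have "Inf C < \<alpha> + \<kappa>" using that by (simp add: \<alpha>_def)
    then obtain c where "c \<in> C" "c < \<alpha> + \<kappa>" using cInf_less_iff[OF C] by blast
    then obtain X where X: "\<forall>x\<ge>X. L2_norm M (A x) \<le> c" by (auto simp: C_def)
    show ?thesis using X \<open>c < \<alpha> + \<kappa>\<close> by (intro exI[of _ X]) force
  qed
  have often: "\<exists>x\<ge>X. L2_norm M (A x) \<ge> \<alpha> - \<kappa>" if "\<kappa> > 0" for \<kappa> X
  proof (rule ccontr)
    assume "\<not> ?thesis"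
    then have "\<alpha> - \<kappa> \<in> C" unfolding C_def by (auto intro!: exI[of _ X])
    then have "\<alpha> \<le> \<alpha> - \<kappa>" unfolding \<alpha>_def using C by (intro cInf_lower)
    then show False using that by simp
  qed
  have "\<not> \<alpha> > 0"
  proof
    assume \<alpha>: "\<alpha> > 0"
    \<comment> \<open>Then the final bound \<open>2 * e0 * h\<close> equals
      \<open>\<alpha>\<^sup>2 / 8\<close>, below the lower bound
      \<open>(\<alpha> / 2)\<^sup>2\<close> valid at \<open>v\<close>.\<close>
    define e0 where "e0 = \<alpha>\<^sup>2 / (16 * h)"
    have e0: "e0 > 0" using \<alpha> h by (simp add: e0_def)
    define \<theta> where "\<theta> = min (\<alpha> / 2) e0"
    have \<theta>: "\<theta> > 0" "\<theta> \<le> \<alpha> / 2" "\<theta> \<le> e0" using \<alpha> e0 by (auto simp: \<theta>_def)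
    \<comment> \<open>This makes the Turan--Kubilius error \<open>2 * g / sqrt L\<close> at most
      \<open>e0\<close>; the summand 1 keeps \<open>L\<close> positive also for
      \<open>g = 0\<close>.\<close>
    obtain Q where Q: "finite Q" "Q \<subseteq> P" "(\<Sum>p\<in>Q. 1 / real p) \<ge> (2 * g / e0 + 1)\<^sup>2"
      using exists_finite_large_sum[OF div] by blast
    define L where "L = (\<Sum>p\<in>Q. 1 / real p)"
    have "2 * g / e0 + 1 \<ge> 1" using g e0 by simp
    then have "(2 * g / e0 + 1)\<^sup>2 \<ge> 1" by (simp add: one_le_power)
    then have L: "L > 0" using Q(3) by (simp add: L_def)
    have "2 * g / e0 + 1 \<le> sqrt L" using Q(3) by (intro real_le_rsqrt) (simp add: L_def)
    then have "2 * g / e0 \<le> sqrt L" by simp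
    then have sL: "2 * g / sqrt L \<le> e0" using e0 L by (simp add: field_simps)
    \<comment> \<open>\<open>Z\<close> bounds the primes of \<open>Q\<close>, so that every
      \<open>v / p\<close> lies in the window, and \<open>V\<close> provides
      \<open>v \<ge> card Q\<close>.\<close>
    define Z where "Z = real (Max (insert 1 Q))"
    have Zge: "real p \<le> Z" if "p \<in> insert 1 Q" for p using Q(1) that by (simp add: Z_def del: insert_iff)
    have Z: "Z \<ge> 1" using Zge[of 1] by simp
    define V where "V = max 1 (real (card Q))"
    obtain v where v: "v \<ge> V" "L2_norm M (A v) \<ge> \<alpha> - \<theta>"
      "\<And>z. z \<in> {1..Z} \<Longrightarrow> L2_norm M (\<lambda>\<omega>. A (v / z) \<omega> - A v \<omega>) \<le> \<theta>"
      using almost_constant_window[OF G fg \<alpha> limsup[unfolded A_def] often[unfolded A_def] \<theta>(1) Z, of V]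
      unfolding A_def by blast
    have v1: "v \<ge> 1" "v \<ge> real (card Q)" using v(1) by (auto simp: V_def)
    have Qp: "prime p" "p > 0" "S p \<omega> = S p0 \<omega>" if "p \<in> Q" "\<omega> \<in> space M" for p \<omega>
      using that Q(2) P by (auto simp: prime_gt_0_nat)
    have Qprime: "prime p" if "p \<in> Q" for p using that Q(2) P by auto
    have tk: "L2_norm M (\<lambda>\<omega>. A v \<omega> - (1/L) *\<^sub>R (\<Sum>p\<in>Q. (1 / real p) *\<^sub>R A (v / real p) (S p0 \<omega>))) \<le> 2 * g / sqrt L"
    proof -
      have "L2_norm M (\<lambda>\<omega>. (1/v) *\<^sub>R (\<Sum>n\<in>nats_upto v. G (S n \<omega>)) -
          (1/L) *\<^sub>R (\<Sum>p\<in>Q. (1/v) *\<^sub>R (\<Sum>m\<in>nats_upto (v / real p). G (S (p * m) \<omega>)))) \<le> 2 * g / sqrt L"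
        by (rule turan_kubilius_L2[OF _ _ Q(1) Qprime]) (use v1 L in \<open>auto simp: S_L2 S_norm G g_def L_def\<close>)
      also have "L2_norm M (\<lambda>\<omega>. (1/v) *\<^sub>R (\<Sum>n\<in>nats_upto v. G (S n \<omega>)) -
          (1/L) *\<^sub>R (\<Sum>p\<in>Q. (1/v) *\<^sub>R (\<Sum>m\<in>nats_upto (v / real p). G (S (p * m) \<omega>)))) =
        L2_norm M (\<lambda>\<omega>. A v \<omega> - (1/L) *\<^sub>R (\<Sum>p\<in>Q. (1 / real p) *\<^sub>R A (v / real p) (S p0 \<omega>)))"
      proof (rule L2_norm_cong)
        fix \<omega> assume \<omega>: "\<omega> \<in> space M"
        have "(1/v) *\<^sub>R (\<Sum>m\<in>nats_upto (v / real p). G (S (p * m) \<omega>)) = (1 / real p) *\<^sub>R A (v / real p) (S p0 \<omega>)"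
          if p: "p \<in> Q" for p
        proof -
          have "A (v / real p) (S p0 \<omega>) = A (v / real p) (S p \<omega>)" using Qp[OF p \<omega>] by simp
          also have "\<dots> = (1 / (v / real p)) *\<^sub>R (\<Sum>m\<in>nats_upto (v / real p). G (S (p * m) \<omega>))"
            unfolding A_def using Qp[OF p \<omega>] \<omega> by (intro mult_avg_comp)
          finally show ?thesis using Qp(2)[OF p \<omega>] by simp
        qed
        then show "(1/v) *\<^sub>R (\<Sum>n\<in>nats_upto v. G (S n \<omega>)) -
            (1/L) *\<^sub>R (\<Sum>p\<in>Q. (1/v) *\<^sub>R (\<Sum>m\<in>nats_upto (v / real p). G (S (p * m) \<omega>))) =
          A v \<omega> - (1/L) *\<^sub>R (\<Sum>p\<in>Q. (1 / real p) *\<^sub>R A (v / real p) (S p0 \<omega>))"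
          by (simp add: A_def mult_avg_def[of S G v])
      qed
      finally show ?thesis .
    qed
    have win: "L2_norm M (\<lambda>\<omega>. (1/L) *\<^sub>R (\<Sum>p\<in>Q. (1 / real p) *\<^sub>R A (v / real p) (S p0 \<omega>)) - A v (S p0 \<omega>)) \<le> \<theta>"
    proof -
      have eq: "(1/L) *\<^sub>R (\<Sum>p\<in>Q. (1 / real p) *\<^sub>R A (v / real p) (S p0 \<omega>)) - A v (S p0 \<omega>) =
        (\<Sum>p\<in>Q. (1/L * (1 / real p)) *\<^sub>R (A (v / real p) (S p0 \<omega>) - A v (S p0 \<omega>)))" for \<omega>
      proof -
        have "(\<Sum>p\<in>Q. 1/L * (1 / real p)) = 1"
          unfolding sum_distrib_left [symmetric] L_def [symmetric] using L by simp
        then have "A v (S p0 \<omega>) = (\<Sum>p\<in>Q. (1/L * (1 / real p)) *\<^sub>R A v (S p0 \<omega>))"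
          by (simp only: scaleR_sum_left [symmetric] scaleR_one)
        then show ?thesis
          by (simp only: scaleR_sum_right scaleR_scaleR scaleR_diff_right sum_subtractf)
      qed
      have "L2_norm M (\<lambda>\<omega>. \<Sum>p\<in>Q. (1/L * (1 / real p)) *\<^sub>R (A (v / real p) (S p0 \<omega>) - A v (S p0 \<omega>))) \<le>
        (\<Sum>p\<in>Q. \<bar>1/L * (1 / real p)\<bar>) * \<theta>"
      proof (rule L2_norm_weighted_sum_le)
        fix p assume p: "p \<in> Q"
        show "L2_fun M (\<lambda>\<omega>. A (v / real p) (S p0 \<omega>) - A v (S p0 \<omega>))" by (intro L2_fun_diff S_L2 p0 AL2)
        have "L2_norm M (\<lambda>\<omega>. A (v / real p) (S p0 \<omega>) - A v (S p0 \<omega>)) = L2_norm M (\<lambda>\<omega>. A (v / real p) \<omega> - A v \<omega>)"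
          using S_norm[OF p0 L2_fun_diff[OF AL2[of "v / real p"] AL2[of v]]] by simp
        also have "\<dots> \<le> \<theta>" using Zge[of p] prime_ge_1_nat[OF Qprime[OF p]] p by (intro v(3)) auto
        finally show "L2_norm M (\<lambda>\<omega>. A (v / real p) (S p0 \<omega>) - A v (S p0 \<omega>)) \<le> \<theta>" .
      qed
      also have "(\<Sum>p\<in>Q. \<bar>1/L * (1 / real p)\<bar>) = (\<Sum>p\<in>Q. 1/L * (1 / real p))"
        using L by (intro sum.cong refl abs_of_nonneg) simp
      also have "\<dots> = 1" unfolding sum_distrib_left [symmetric] L_def [symmetric] using L by simp
      finally show ?thesis unfolding eq by simp
    qed
    define \<rho> where "\<rho> = L2_norm M (\<lambda>\<omega>. A v \<omega> - A v (S p0 \<omega>))"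
    have midL2: "L2_fun M (\<lambda>\<omega>. (1/L) *\<^sub>R (\<Sum>p\<in>Q. (1 / real p) *\<^sub>R A (v / real p) (S p0 \<omega>)))"
      by (intro L2_fun_scaleR L2_fun_sum S_L2 p0 AL2)
    have "\<rho> \<le> 2 * g / sqrt L + \<theta>"
      using L2_norm_triangle[OF AL2[of v] midL2 S_L2[OF p0 AL2[of v]]] tk win unfolding \<rho>_def by linarith
    then have \<rho>: "\<rho> \<le> 2 * e0" using sL \<theta> by linarith
    define AH where "AH = mult_avg S H v"
    have AH: "L2_fun M AH" unfolding AH_def by (rule mult_avg_L2[OF H])
    have "(L2_norm M (A v))\<^sup>2 = L2_inner M (A v) (A v)" by (rule L2_norm_sq)
    also have "\<dots> = L2_inner M (A v) (\<lambda>\<omega>. AH \<omega> - AH (S p0 \<omega>))"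
    proof (rule L2_inner_cong)
      fix \<omega> assume \<omega>: "\<omega> \<in> space M"
      have "AH (S p0 \<omega>) = (1/v) *\<^sub>R (\<Sum>n\<in>nats_upto v. H (S p0 (S n \<omega>)))"
        unfolding AH_def mult_avg_comp[OF p0 \<omega>] using \<omega> p0
        by (intro arg_cong[of _ _ "\<lambda>z. (1/v) *\<^sub>R z"] sum.cong refl) (simp add: S_S nats_upto_pos)
      moreover have "A v \<omega> = AH \<omega> - (1/v) *\<^sub>R (\<Sum>n\<in>nats_upto v. H (S p0 (S n \<omega>)))"
        by (simp add: A_def AH_def mult_avg_def G_def sum_subtractf scaleR_diff_right)
      ultimately show "A v \<omega> = AH \<omega> - AH (S p0 \<omega>)" by (simp only:)
    qed simp
    also have "\<dots> = L2_inner M (\<lambda>\<omega>. A v (S p0 \<omega>)) (\<lambda>\<omega>. AH (S p0 \<omega>)) - L2_inner M (A v) (\<lambda>\<omega>. AH (S p0 \<omega>))"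
      using mpt_L2_inner[OF S_mpt[OF p0] L2_fun_measurable[OF AL2[of v]] L2_fun_measurable[OF AH]]
      by (simp add: L2_inner_diff_right AL2 AH S_L2[OF p0])
    also have "\<dots> = L2_inner M (\<lambda>\<omega>. A v (S p0 \<omega>) - A v \<omega>) (\<lambda>\<omega>. AH (S p0 \<omega>))"
      by (simp add: L2_inner_diff_left AL2 AH S_L2[OF p0])
    also have "\<dots> \<le> L2_norm M (\<lambda>\<omega>. A v (S p0 \<omega>) - A v \<omega>) * L2_norm M (\<lambda>\<omega>. AH (S p0 \<omega>))"
      using L2_Cauchy_Schwarz[OF L2_fun_diff[OF S_L2[OF p0 AL2[of v]] AL2[of v]] S_L2[OF p0 AH]] by linarith
    also have "\<dots> \<le> (2 * e0) * h"
    proof (rule mult_mono)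
      show "L2_norm M (\<lambda>\<omega>. A v (S p0 \<omega>) - A v \<omega>) \<le> 2 * e0"
        using \<rho> unfolding \<rho>_def by (subst L2_norm_minus_commute)
      show "L2_norm M (\<lambda>\<omega>. AH (S p0 \<omega>)) \<le> h"
        unfolding S_norm[OF p0 AH] using mult_avg_norm_le[OF H, of v] v1 by (simp add: AH_def h_def)
    qed (use e0 in auto)
    also have "\<dots> = \<alpha>\<^sup>2 / 8" using h by (simp add: e0_def)
    finally have "(L2_norm M (A v))\<^sup>2 \<le> \<alpha>\<^sup>2 / 8" .
    moreover have "(\<alpha> / 2)\<^sup>2 \<le> (L2_norm M (A v))\<^sup>2" using v(2) \<theta> \<alpha> by (intro power_mono) auto
    moreover have "(\<alpha> / 2)\<^sup>2 = \<alpha>\<^sup>2 / 4" by (simp add: power_divide)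
    ultimately have "\<alpha>\<^sup>2 \<le> 0" by linarith
    then show False using \<alpha> by simp
  qed
  then have small: "\<exists>X. \<forall>x\<ge>X. L2_norm M (A x) \<le> \<kappa>" if "\<kappa> > 0" for \<kappa>
    using limsup[OF that] by force
  have "((\<lambda>x. L2_norm M (A x)) \<longlongrightarrow> 0) at_top"
  proof (rule tendstoI)
    fix e :: real assume "e > 0"
    then obtain X where X: "\<forall>x\<ge>X. L2_norm M (A x) \<le> e / 2" using small[of "e / 2"] by auto
    show "eventually (\<lambda>x. dist (L2_norm M (A x)) 0 < e) at_top"
      using eventually_ge_at_top[of X]
    proof eventually_elim
      case (elim x)
      then have "L2_norm M (A x) \<le> e / 2" using X by blast
      then show ?case using \<open>e > 0\<close> by simp
    qed
  qed
  then show ?thesis by (simp add: A_def G_def)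
qed

lemma mult_avg_of_nat: "mult_avg S G (real N) = (\<lambda>\<omega>. (1 / real N) *\<^sub>R (\<Sum>n=1..N. G (S n \<omega>)))"
  by (simp add: mult_avg_def nats_upto_of_nat)

lemma mult_avg_add: "mult_avg S (\<lambda>\<omega>. F \<omega> + G \<omega>) x = (\<lambda>\<omega>. mult_avg S F x \<omega> + mult_avg S G x \<omega>)"
  by (simp add: mult_avg_def sum.distrib scaleR_add_right)

lemma mult_avg_scaleR: "mult_avg S (\<lambda>\<omega>. c *\<^sub>R G \<omega>) x = (\<lambda>\<omega>. c *\<^sub>R mult_avg S G x \<omega>)"
  by (simp add: mult_avg_def fun_eq_iff scaleR_sum_right scaleR_left_commute)

text \<open>For a level set of \<open>h\<close> the defining sum splits over finitely many classes
  of primes. Where the reciprocals are summable, the terms are at most \<open>4 / p\<close>; on the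
  other classes \<open>S p\<close> fixes \<open>h\<close>, so the terms vanish. Hence every level
  set has measure 0 or 1.\<close>

lemma pretentiously_invariant_const:
  assumes fg: "finite {restrict (S p) (space M) | p. prime p}" and pe: "pretentiously_ergodic M S"
    and h: "h \<in> borel_measurable M"
    and inv: "\<And>p0. prime p0 \<Longrightarrow>
      \<not> (\<lambda>p. 1 / real p) summable_on {p. prime p \<and> restrict (S p) (space M) = restrict (S p0) (space M)} \<Longrightarrow>
      AE \<omega> in M. h (S p0 \<omega>) = (h \<omega> :: complex)"
  obtains c where "AE \<omega> in M. h \<omega> = c"
proof -
  define cls where "cls u = {p. prime p \<and> restrict (S p) (space M) = u}" for u
  define R where "R = {restrict (S p) (space M) | p. prime p}"
  have main: "prob A \<in> {0, 1}" if A: "A \<in> events" and Ainv: "\<And>p. prime p \<Longrightarrow> AE \<omega> in M. h (S p \<omega>) = h \<omega> \<Longrightarrow>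
      AE \<omega> in M. S p \<omega> \<in> A \<longleftrightarrow> \<omega> \<in> A" for A
  proof -
    define t where "t p = (L2_norm M (\<lambda>x. indicator A (S p x) - indicator A x))\<^sup>2 / real p" for p
    have ind: "L2_fun M (indicator A)" 
    proof (rule L2_norm_mono_AE(2)[where g = "\<lambda>_. 1"])
      show "indicator A \<in> borel_measurable M" using A by simp
    qed (auto simp: indicator_def)
    have nind: "L2_norm M (indicator A :: 'a \<Rightarrow> complex) \<le> 1"
    proof -
      have "L2_norm M (indicator A :: 'a \<Rightarrow> complex) \<le> L2_norm M (\<lambda>_. 1 :: complex)"
        by (rule L2_norm_mono_AE(1)) (use A in \<open>auto simp: indicator_def\<close>)
      then show ?thesis by simp
    qed
    have t_le: "t p \<le> 4 * (1 / real p)" if "prime p" for p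
    proof -
      have p: "p > 0" using that by (rule prime_gt_0_nat)
      have "L2_norm M (\<lambda>x. indicator A (S p x) - indicator A x) \<le>
        L2_norm M (\<lambda>x. indicator A (S p x)) + L2_norm M (indicator A)"
        by (intro L2_norm_diff_le S_L2 p ind)
      also have "\<dots> \<le> 2" using nind S_norm[OF p ind] by simp
      finally have "(L2_norm M (\<lambda>x. indicator A (S p x) - indicator A x))\<^sup>2 \<le> 2\<^sup>2" by (intro power_mono) auto
      then show ?thesis unfolding t_def using p by (simp add: divide_right_mono)
    qed
    have cls_summable: "t summable_on cls u" if u: "u \<in> R" for u
    proof (cases "(\<lambda>p. 1 / real p) summable_on cls u")
      case True
      then have "(\<lambda>p. 4 * (1 / real p)) summable_on cls u" by (rule summable_on_cmult_right)
      then show ?thesis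
      proof (rule summable_on_comparison_test)
        fix p assume "p \<in> cls u"
        then show "t p \<le> 4 * (1 / real p)" by (intro t_le) (simp add: cls_def)
        show "0 \<le> t p" by (simp add: t_def)
      qed
    next
      case False
      have "t p = 0" if p: "p \<in> cls u" for p
      proof -
        have pr: "prime p" "p > 0" "u = restrict (S p) (space M)" using p by (auto simp: cls_def prime_gt_0_nat)
        have "AE \<omega> in M. h (S p \<omega>) = h \<omega>" using inv[OF pr(1)] False unfolding cls_def pr(3) by blast
        then have "AE \<omega> in M. S p \<omega> \<in> A \<longleftrightarrow> \<omega> \<in> A" by (rule Ainv[OF pr(1)])
        then have "AE \<omega> in M. indicator A (S p \<omega>) - indicator A \<omega> = (0::complex)"
          by eventually_elim (auto simp: indicator_def)
        then have "L2_norm M (\<lambda>x. indicator A (S p x) - indicator A x) = 0"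
          using L2_norm_eq_0_iff[OF L2_fun_diff[OF S_L2[OF pr(2) ind] ind]] by blast
        then show ?thesis by (simp add: t_def)
      qed
      then show ?thesis by (rule summable_on_0)
    qed
    have "t summable_on {p. prime p}"
    proof (rule summable_on_finite_fibres[where \<phi> = "\<lambda>p. restrict (S p) (space M)"])
      show "finite ((\<lambda>p. restrict (S p) (space M)) ` {p. prime p})" using fg by (simp only: setcompr_eq_image)
      fix u assume "u \<in> (\<lambda>p. restrict (S p) (space M)) ` {p. prime p}"
      then have "t summable_on cls u" by (intro cls_summable) (auto simp: R_def)
      then show "t summable_on {p \<in> {p. prime p}. restrict (S p) (space M) = u}" by (simp add: cls_def)
    qed
    then show ?thesis using pe A unfolding pretentiously_ergodic_def t_def by blast
  qed
  have [measurable]: "h \<in> borel_measurable M" by fact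
  have sp: "AE \<omega> in M. S p \<omega> \<in> space M" if "prime p" for p
    using AE_space by eventually_elim (rule S_space[OF prime_gt_0_nat[OF that]])
  have "\<exists>c. AE \<omega> in M. h \<omega> = c"
  proof (rule AE_const_if_zero_one_complex[OF h])
    fix c
    show "prob {x \<in> space M. Re (h x) \<le> c} \<in> {0, 1}"
    proof (rule main)
      fix p assume p: "prime p" "AE \<omega> in M. h (S p \<omega>) = h \<omega>"
      show "AE \<omega> in M. (S p \<omega> \<in> {x \<in> space M. Re (h x) \<le> c}) = (\<omega> \<in> {x \<in> space M. Re (h x) \<le> c})"
        using p(2) sp[OF p(1)] AE_space by eventually_elim auto
    qed measurable
    show "prob {x \<in> space M. Im (h x) \<le> c} \<in> {0, 1}"
    proof (rule main)
      fix p assume p: "prime p" "AE \<omega> in M. h (S p \<omega>) = h \<omega>"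
      show "AE \<omega> in M. (S p \<omega> \<in> {x \<in> space M. Im (h x) \<le> c}) = (\<omega> \<in> {x \<in> space M. Im (h x) \<le> c})"
        using p(2) sp[OF p(1)] AE_space by eventually_elim auto
    qed measurable
  qed blast
  then show ?thesis using that by blast
qed

text \<open>An \<open>h\<close> orthogonal to all functions with convergence is orthogonal to the
  coboundary \<open>h - h \<circ> S p0\<close> for \<open>p0\<close> in a divergent class, hence
  invariant there, hence constant. Constants converge as well, so \<open>h\<close> is orthogonal to
  itself.\<close>

lemma mult_mean_ergodic:
  assumes fg: "finite {restrict (S p) (space M) | p. prime p}" and pe: "pretentiously_ergodic M S"
    and G: "L2_fun M G"
  shows "(\<lambda>N. L2_norm M (\<lambda>\<omega>. mult_avg S G (real N) \<omega> - (\<integral>y. G y \<partial>M))) \<longlonglongrightarrow> 0"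
proof (rule L2_family_tendsto_0[where \<Phi> = "\<lambda>N G \<omega>. mult_avg S G (real N) \<omega> - (\<integral>y. G y \<partial>M)" and C = 2, OF _ G])
  have avg_le: "L2_norm M (mult_avg S F (real N)) \<le> L2_norm M F" if "L2_fun M F" for F N
    using mult_avg_norm_le[OF that, of "real N"] by (cases "N = 0") (auto simp: mult_avg_def)
  have bound: "L2_norm M (\<lambda>\<omega>. mult_avg S F (real N) \<omega> - (\<integral>y. F y \<partial>M)) \<le> 2 * L2_norm M F"
    if F: "L2_fun M F" for F N
    using L2_norm_diff_le[OF mult_avg_L2[OF F, of "real N"] L2_fun_const[of "\<integral>y. F y \<partial>M"]]
      avg_le[OF F, of N] norm_integral_le_L2_norm[OF F] by simp
  show "L2_family (\<lambda>N G \<omega>. mult_avg S G (real N) \<omega> - (\<integral>y. G y \<partial>M)) 2"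
    unfolding L2_family_def
  proof (intro conjI allI impI)
    fix F F' :: "'a \<Rightarrow> complex" and N c
    assume F: "L2_fun M F"
    show "L2_fun M (\<lambda>\<omega>. mult_avg S F (real N) \<omega> - (\<integral>y. F y \<partial>M))"
      by (intro L2_fun_diff mult_avg_L2 F L2_fun_const)
    show "L2_norm M (\<lambda>\<omega>. mult_avg S F (real N) \<omega> - (\<integral>y. F y \<partial>M)) \<le> 2 * L2_norm M F"
      by (rule bound[OF F])
    show "(\<lambda>\<omega>. mult_avg S (\<lambda>x. c *\<^sub>R F x) (real N) \<omega> - (\<integral>y. c *\<^sub>R F y \<partial>M)) =
      (\<lambda>\<omega>. c *\<^sub>R (mult_avg S F (real N) \<omega> - (\<integral>y. F y \<partial>M)))"
      by (simp add: mult_avg_scaleR scaleR_diff_right)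
    assume "L2_fun M F'"
    then show "(\<lambda>\<omega>. mult_avg S (\<lambda>x. F x + F' x) (real N) \<omega> - (\<integral>y. F y + F' y \<partial>M)) =
      (\<lambda>\<omega>. (mult_avg S F (real N) \<omega> - (\<integral>y. F y \<partial>M)) + (mult_avg S F' (real N) \<omega> - (\<integral>y. F' y \<partial>M)))"
      using F by (simp add: fun_eq_iff mult_avg_add L2_fun_integrable)
  qed
next
  fix h assume h: "L2_fun M h"
    and orth: "\<And>v. L2_fun M v \<Longrightarrow> (\<lambda>N. L2_norm M (\<lambda>\<omega>. mult_avg S v (real N) \<omega> - (\<integral>y. v y \<partial>M))) \<longlonglongrightarrow> 0 \<Longrightarrow>
      L2_inner M h v = 0"
  obtain c where c: "AE \<omega> in M. h \<omega> = c"
  proof (rule pretentiously_invariant_const[OF fg pe L2_fun_measurable[OF h]])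
    fix p0 :: nat assume p0: "prime p0"
      and div: "\<not> (\<lambda>p. 1 / real p) summable_on {p. prime p \<and> restrict (S p) (space M) = restrict (S p0) (space M)}"
    have pos: "p0 > 0" using p0 by (rule prime_gt_0_nat)
    have "((\<lambda>x. L2_norm M (mult_avg S (\<lambda>\<omega>. h \<omega> - h (S p0 \<omega>)) x)) \<longlongrightarrow> 0) at_top"
      by (rule mult_avg_coboundary_tendsto[OF h fg _ _ p0 div]) (auto dest: restrict_eqD)
    then have "(\<lambda>N. L2_norm M (mult_avg S (\<lambda>\<omega>. h \<omega> - h (S p0 \<omega>)) (real N))) \<longlonglongrightarrow> 0"
      by (rule filterlim_compose) (rule filterlim_real_sequentially)
    moreover have "(\<integral>\<omega>. h \<omega> - h (S p0 \<omega>) \<partial>M) = 0"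
      using mpt_integral[OF S_mpt[OF pos] L2_fun_measurable[OF h]]
      by (simp add: L2_fun_integrable h S_L2[OF pos])
    ultimately have "L2_inner M h (\<lambda>\<omega>. h \<omega> - h (S p0 \<omega>)) = 0"
      by (intro orth L2_fun_diff h S_L2 pos) simp
    then show "AE \<omega> in M. h (S p0 \<omega>) = h \<omega>"
      by (rule mpt_invariant_iff_inner[OF S_mpt[OF pos] h])
  qed
  \<comment> \<open>At \<open>N = 0\<close> division by zero makes the average 0 instead of
    \<open>c\<close>.\<close>
  have "L2_norm M (\<lambda>\<omega>. mult_avg S (\<lambda>_. c) (real N) \<omega> - (\<integral>y. c \<partial>M)) = 0" if "N \<ge> 1" for N
    using that by (simp add: mult_avg_of_nat prob_space scaleR_conv_of_real)
  then have "(\<lambda>N. L2_norm M (\<lambda>\<omega>. mult_avg S (\<lambda>_. c) (real N) \<omega> - (\<integral>y. c \<partial>M))) \<longlonglongrightarrow> 0"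
    by (intro tendsto_eventually eventually_sequentiallyI[of 1])
  then have "L2_inner M h (\<lambda>_. c) = 0" by (intro orth) auto
  moreover have "L2_inner M h (\<lambda>_. c) = L2_inner M h h"
    unfolding L2_inner_def
  proof (rule integral_cong_AE)
    show "AE x in M. h x \<bullet> c = h x \<bullet> h x" using c by eventually_elim simp
  qed (use L2_fun_measurable[OF h] in measurable)
  ultimately have "L2_norm M h = 0" using L2_norm_sq[of M h] by simp
  then show "L2_inner M G h = 0" by (rule L2_inner_null[OF G h])
qed

end

section \<open>Additive averages, and products with unbounded functions\<close>

context prob_space
begin

text \<open>Von Neumann's argument: coboundaries of \<open>U\<close> telescope, so a function
  orthogonal to all functions with vanishing averages is invariant.\<close>

lemma additive_mean_tendsto_0:
  assumes U: "invertible_mpt M U" and f: "L2_fun M f"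
    and orth: "\<And>h. L2_fun M h \<Longrightarrow> AE x in M. h (U x) = h x \<Longrightarrow> L2_inner M f h = 0"
  shows "(\<lambda>N. L2_norm M (\<lambda>x. (1 / real N) *\<^sub>R (\<Sum>n=1..N. f ((U ^^ n) x)))) \<longlonglongrightarrow> 0"
proof (rule L2_family_tendsto_0[where \<Phi> = "\<lambda>N f x. (1 / real N) *\<^sub>R (\<Sum>n=1..N. f ((U ^^ n) x))" and C = 1, OF _ f])
  have UL: "L2_fun M (\<lambda>x. g ((U ^^ n) x))" if "L2_fun M g" for g n
    by (rule mpt_L2_fun[OF mpt_funpow[OF U] that])
  have Un: "L2_norm M (\<lambda>x. g ((U ^^ n) x)) = L2_norm M g" if "L2_fun M g" for g n
    by (rule mpt_L2_norm[OF mpt_funpow[OF U] L2_fun_measurable[OF that]])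
  show "L2_family (\<lambda>N f x. (1 / real N) *\<^sub>R (\<Sum>n=1..N. f ((U ^^ n) x))) 1"
    unfolding L2_family_def
  proof (intro conjI allI impI)
    fix g g' :: "'a \<Rightarrow> complex" and N c assume g: "L2_fun M g"
    show "L2_fun M (\<lambda>x. (1 / real N) *\<^sub>R (\<Sum>n=1..N. g ((U ^^ n) x)))"
      by (intro L2_fun_scaleR L2_fun_sum UL g)
    have "L2_norm M (\<lambda>x. \<Sum>n=1..N. g ((U ^^ n) x)) \<le> real N * L2_norm M g"
      using L2_norm_sum_le[of "{1..N}" M "\<lambda>n x. g ((U ^^ n) x)"] UL[OF g] Un[OF g] by simp
    then show "L2_norm M (\<lambda>x. (1 / real N) *\<^sub>R (\<Sum>n=1..N. g ((U ^^ n) x))) \<le> 1 * L2_norm M g"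
      unfolding L2_norm_scaleR by (cases "N = 0") (simp_all add: pos_divide_le_eq mult.commute)
    show "(\<lambda>x. (1 / real N) *\<^sub>R (\<Sum>n=1..N. c *\<^sub>R g ((U ^^ n) x))) =
      (\<lambda>x. c *\<^sub>R (1 / real N) *\<^sub>R (\<Sum>n=1..N. g ((U ^^ n) x)))"
      unfolding scaleR_sum_right [symmetric] by (simp add: scaleR_left_commute)
    show "(\<lambda>x. (1 / real N) *\<^sub>R (\<Sum>n=1..N. g ((U ^^ n) x) + g' ((U ^^ n) x))) =
      (\<lambda>x. (1 / real N) *\<^sub>R (\<Sum>n=1..N. g ((U ^^ n) x)) + (1 / real N) *\<^sub>R (\<Sum>n=1..N. g' ((U ^^ n) x)))"
      by (simp add: sum.distrib scaleR_add_right)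
  qed
  fix h assume h: "L2_fun M h"
    and null: "\<And>v. L2_fun M v \<Longrightarrow> (\<lambda>N. L2_norm M (\<lambda>x. (1 / real N) *\<^sub>R (\<Sum>n=1..N. v ((U ^^ n) x)))) \<longlonglongrightarrow> 0 \<Longrightarrow>
      L2_inner M h v = 0"
  have hU: "L2_fun M (\<lambda>x. h x - h (U x))" using UL[OF h, of 1] by (intro L2_fun_diff h) simp
  have "(\<lambda>N. L2_norm M (\<lambda>x. (1 / real N) *\<^sub>R (\<Sum>n=1..N. h ((U ^^ n) x) - h (U ((U ^^ n) x))))) \<longlonglongrightarrow> 0"
  proof (rule tendsto_sandwich[OF _ _ tendsto_const])
    have "(\<Sum>n=1..N. h ((U ^^ n) x) - h (U ((U ^^ n) x))) = h ((U ^^ 1) x) - h ((U ^^ Suc N) x)" for N x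
      by (induction N) simp_all
    then have "L2_norm M (\<lambda>x. (1 / real N) *\<^sub>R (\<Sum>n=1..N. h ((U ^^ n) x) - h (U ((U ^^ n) x)))) \<le>
        1 / real N * (2 * L2_norm M h)" for N
      using L2_norm_diff_le[OF UL[OF h, of 1] UL[OF h, of "Suc N"]] Un[OF h, of 1] Un[OF h, of "Suc N"]
      by (simp only: L2_norm_scaleR) (simp add: divide_right_mono)
    then show "\<forall>\<^sub>F N in sequentially. L2_norm M (\<lambda>x. (1 / real N) *\<^sub>R (\<Sum>n=1..N. h ((U ^^ n) x) - h (U ((U ^^ n) x))))
      \<le> 1 / real N * (2 * L2_norm M h)" by simp
    show "(\<lambda>N. 1 / real N * (2 * L2_norm M h)) \<longlonglongrightarrow> 0"
      by (intro tendsto_mult_left_zero lim_1_over_n)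
  qed simp
  then have "L2_inner M h (\<lambda>x. h x - h (U x)) = 0" by (rule null[OF hU])
  then have "AE x in M. h (U x) = h x" by (rule mpt_invariant_iff_inner[OF U h])
  then show "L2_inner M f h = 0" by (rule orth[OF h])
qed

lemma L2_truncation:
  assumes F: "L2_fun M F" and e: "e > 0"
  obtains K :: nat where "L2_norm M (\<lambda>x. if norm (F x) \<le> real K then 0 else F x) < e"
proof -
  have [measurable]: "F \<in> borel_measurable M" using F by (rule L2_fun_measurable)
  have "(\<lambda>K. \<integral>x. (norm (if norm (F x) \<le> real K then 0 else F x))\<^sup>2 \<partial>M) \<longlonglongrightarrow> (\<integral>x. 0 \<partial>M)"
  proof (rule integral_dominated_convergence[where w = "\<lambda>x. (norm (F x))\<^sup>2"])
    show "AE x in M. (\<lambda>K. (norm (if norm (F x) \<le> real K then 0 else F x))\<^sup>2) \<longlonglongrightarrow> 0"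
    proof (rule AE_I2)
      fix x
      obtain K0 where "norm (F x) \<le> real K0" using real_arch_simple by blast
      then have "(norm (if norm (F x) \<le> real K then 0 else F x))\<^sup>2 = 0" if "K \<ge> K0" for K
        using that by auto
      then show "(\<lambda>K. (norm (if norm (F x) \<le> real K then 0 else F x))\<^sup>2) \<longlonglongrightarrow> 0"
        by (intro tendsto_eventually eventually_sequentiallyI[of K0])
    qed
    show "AE x in M. norm ((norm (if norm (F x) \<le> real K then 0 else F x))\<^sup>2) \<le> (norm (F x))\<^sup>2" for K
      by simp
  qed (use L2_fun_integrable_sq[OF F] in simp_all)
  then have "(\<lambda>K. L2_norm M (\<lambda>x. if norm (F x) \<le> real K then 0 else F x)) \<longlonglongrightarrow> 0"
    unfolding L2_norm_def using tendsto_real_sqrt[of _ 0] by simp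
  then obtain K where "L2_norm M (\<lambda>x. if norm (F x) \<le> real K then 0 else F x) < e"
    using LIMSEQ_D[of "\<lambda>K. L2_norm M (\<lambda>x. if norm (F x) \<le> real K then 0 else F x)" 0 e] e by auto
  then show ?thesis by (rule that)
qed

text \<open>\<open>F\<close> is only square integrable, so it is truncated: the bounded part is
  handled by the norm of \<open>g N\<close>, and the rest has small norm and is multiplied by a
  function bounded by \<open>C\<close>.\<close>

lemma L2_mult_bounded_tendsto_0:
  assumes F: "L2_fun M F" and g: "\<And>N. g N \<in> borel_measurable M" "\<And>N. AE x in M. norm (g N x) \<le> C"
    and lim: "(\<lambda>N. L2_norm M (g N)) \<longlonglongrightarrow> 0"
  shows "(\<lambda>N. L2_norm M (\<lambda>x. F x * g N x)) \<longlonglongrightarrow> 0"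
proof (rule LIMSEQ_I)
  fix r :: real assume r: "r > 0"
  have [measurable]: "F \<in> borel_measurable M" using F by (rule L2_fun_measurable)
  have [measurable]: "g N \<in> borel_measurable M" for N by (rule g)
  define D where "D = \<bar>C\<bar> + 1"
  have D: "D > 0" by (simp add: D_def)
  have gD: "AE x in M. norm (g N x) \<le> D" for N using g(2)[of N] by eventually_elim (simp add: D_def)
  have gL: "L2_fun M (g N)" for N
  proof (rule L2_norm_mono_AE(2)[where g = "\<lambda>_. complex_of_real D"])
    show "AE x in M. norm (g N x) \<le> norm (complex_of_real D)" using gD[of N] D by simp
  qed auto
  obtain K :: nat where K: "L2_norm M (\<lambda>x. if norm (F x) \<le> real K then 0 else F x) < r / (2 * D)"
    using L2_truncation[OF F, of "r / (2 * D)"] r D by auto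
  let ?F1 = "\<lambda>x. if norm (F x) \<le> real K then F x else 0"
  let ?F2 = "\<lambda>x. if norm (F x) \<le> real K then 0 else F x"
  have F2: "L2_fun M ?F2" by (rule L2_norm_mono_AE(2)[where g = F]) (use F in auto)
  obtain no where no: "\<And>n. n \<ge> no \<Longrightarrow> L2_norm M (g n) < r / (2 * (real K + 1))"
    using LIMSEQ_D[OF lim, of "r / (2 * (real K + 1))"] r by (auto simp: add_nonneg_pos)
  have "norm (L2_norm M (\<lambda>x. F x * g n x) - 0) < r" if n: "n \<ge> no" for n
  proof -
    have 1: "L2_fun M (\<lambda>x. g n x * ?F1 x)" "L2_norm M (\<lambda>x. g n x * ?F1 x) \<le> real K * L2_norm M (g n)"
      by (rule L2_mult_bounded[OF gL]; auto)+
    have 2: "L2_fun M (\<lambda>x. ?F2 x * g n x)" "L2_norm M (\<lambda>x. ?F2 x * g n x) \<le> D * L2_norm M ?F2"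
      by (rule L2_mult_bounded[OF F2]; use gD in auto)+
    have eq: "(\<lambda>x. F x * g n x) = (\<lambda>x. g n x * ?F1 x + ?F2 x * g n x)" by auto
    have "L2_norm M (\<lambda>x. F x * g n x) \<le> L2_norm M (\<lambda>x. g n x * ?F1 x) + L2_norm M (\<lambda>x. ?F2 x * g n x)"
      unfolding eq by (rule L2_norm_add_le[OF 1(1) 2(1)])
    moreover have "real K * L2_norm M (g n) \<le> (real K + 1) * L2_norm M (g n)" by (intro mult_right_mono) auto
    moreover have "(real K + 1) * L2_norm M (g n) < r / 2"
    proof -
      have "(real K + 1) * L2_norm M (g n) < (real K + 1) * (r / (2 * (real K + 1)))"
        using no[OF n] by (intro mult_strict_left_mono) auto
      also have "\<dots> = r / 2" by (simp add: field_simps)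
      finally show ?thesis .
    qed
    moreover have "D * L2_norm M ?F2 < r / 2"
    proof -
      have "D * L2_norm M ?F2 < D * (r / (2 * D))" using K D by (intro mult_strict_left_mono) auto
      also have "\<dots> = r / 2" using D by simp
      finally show ?thesis .
    qed
    ultimately show ?thesis using 1(2) 2(2) by simp
  qed
  then show "\<exists>no. \<forall>n\<ge>no. norm (L2_norm M (\<lambda>x. F x * g n x) - 0) < r" by blast
qed

end

section \<open>Joint averages\<close>

text \<open>\<open>G\<close> is fixed and bounded, so the joint averages are linear maps of the
  other function, bounded by \<open>C\<close> on \<open>L2\<close>. Duality is then applied in that
  variable alone.\<close>

locale joint_system = mult_system M S for M :: "'a measure" and S +
  fixes T :: "'a \<Rightarrow> 'a" and G :: "'a \<Rightarrow> complex" and C :: real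
  assumes T: "invertible_mpt M T"
    and G_meas [measurable]: "G \<in> borel_measurable M" and G_le: "AE x in M. norm (G x) \<le> C"
begin

lemma C_nonneg: "C \<ge> 0"
proof -
  have "AE x in M. 0 \<le> C" using G_le by eventually_elim (meson norm_ge_zero order_trans)
  then show ?thesis by simp
qed

lemma G_L2: "L2_fun M G"
  by (rule Linf_imp_L2_fun) (use G_le in \<open>auto simp: Linf_fun_def\<close>)

lemma T_L2: "L2_fun M f \<Longrightarrow> L2_fun M (\<lambda>x. f ((T ^^ n) x))"
  by (rule mpt_L2_fun[OF mpt_funpow[OF T]])

lemma T_norm: "L2_fun M f \<Longrightarrow> L2_norm M (\<lambda>x. f ((T ^^ n) x)) = L2_norm M f"
  by (rule mpt_L2_norm[OF mpt_funpow[OF T] L2_fun_measurable])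

lemma G_S_meas: "n > 0 \<Longrightarrow> (\<lambda>x. G (S n x)) \<in> borel_measurable M"
  by (rule mpt_borel_measurable[OF S_mpt G_meas])

lemma G_S_le: "n > 0 \<Longrightarrow> AE x in M. norm (G (S n x)) \<le> C"
  by (rule mpt_AE[OF S_mpt G_le])

lemma term_L2:
  assumes "n > 0" "L2_fun M f"
  shows "L2_fun M (\<lambda>x. f ((T ^^ k) x) * G (S n x))"
    and "L2_norm M (\<lambda>x. f ((T ^^ k) x) * G (S n x)) \<le> C * L2_norm M f"
  using L2_mult_bounded[OF T_L2[OF assms(2), of k] G_S_meas[OF assms(1)] G_S_le[OF assms(1)]]
  by (simp_all add: T_norm[OF assms(2)])

definition joint_avg :: "nat \<Rightarrow> ('a \<Rightarrow> complex) \<Rightarrow> 'a \<Rightarrow> complex" where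
  "joint_avg N f = (\<lambda>x. (1 / real N) *\<^sub>R (\<Sum>n=1..N. f ((T ^^ n) x) * G (S n x)))"

lemma joint_avg_L2: "L2_fun M f \<Longrightarrow> L2_fun M (joint_avg N f)"
  unfolding joint_avg_def by (intro L2_fun_scaleR L2_fun_sum term_L2) auto

lemma joint_avg_norm_le:
  assumes "L2_fun M f"
  shows "L2_norm M (joint_avg N f) \<le> C * L2_norm M f"
proof -
  have "L2_norm M (\<lambda>x. \<Sum>n=1..N. f ((T ^^ n) x) * G (S n x)) \<le> (\<Sum>n=1..N. C * L2_norm M f)"
    by (rule order_trans[OF L2_norm_sum_le sum_mono]) (use term_L2[OF _ assms] in auto)
  then show ?thesis unfolding joint_avg_def L2_norm_scaleR using C_nonneg
    by (cases "N = 0") (simp_all add: pos_divide_le_eq mult_ac)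
qed

text \<open>Orthogonality criterion of Daboussi and Katai: along the primes of one class the factor \<open>G \<circ> S p\<close> does not
  depend on \<open>p\<close>, so only the correlations of \<open>T ^^ (p * n)\<close> and \<open>T ^^ (q * n)\<close> enter.\<close>

lemma joint_avg_katai:
  assumes f: "L2_fun M f"
    and orth: "\<And>k h. k > 0 \<Longrightarrow> L2_fun M h \<Longrightarrow> AE x in M. h ((T ^^ k) x) = h x \<Longrightarrow> L2_inner M f h = 0"
    and P: "\<And>p. p \<in> P \<Longrightarrow> prime p" "\<And>p \<omega>. p \<in> P \<Longrightarrow> \<omega> \<in> space M \<Longrightarrow> S p \<omega> = S p0 \<omega>" "prime p0"
    and div: "\<not> (\<lambda>p. 1 / real p) summable_on P"
  shows "(\<lambda>N. L2_norm M (joint_avg N f)) \<longlonglongrightarrow> 0"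
proof (rule LIMSEQ_I)
  fix r :: real assume r: "r > 0"
  have p0: "p0 > 0" using P(3) by (rule prime_gt_0_nat)
  \<comment> \<open>In \<open>L * b\<^sup>2\<close> the squared norm of \<open>f\<close> covers the
    diagonal, and the 1 leaves room \<open>L\<close> for the off-diagonal terms once
    \<open>N\<close> is large.\<close>
  define b where "b = sqrt ((L2_norm M f)\<^sup>2 + 1)"
  have b: "b > 0" "b\<^sup>2 = (L2_norm M f)\<^sup>2 + 1" by (auto simp: b_def add_nonneg_pos)
  have bf: "L2_norm M f \<le> b" unfolding b_def by (rule real_le_rsqrt) simp
  \<comment> \<open>Of the 3, two come from the Turan--Kubilius error and one from the bound for the
    main term \<open>W\<close>.\<close>
  obtain Q where Q: "finite Q" "Q \<subseteq> P" "(\<Sum>p\<in>Q. 1 / real p) \<ge> (3 * C * b / r + 1)\<^sup>2"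
    using exists_finite_large_sum[OF div] by blast
  define L where "L = (\<Sum>p\<in>Q. 1 / real p)"
  have Qp: "prime p" "p > 0" if "p \<in> Q" for p using that Q(2) P by (auto simp: prime_gt_0_nat)
  have c0: "3 * C * b / r \<ge> 0" using C_nonneg b r by simp
  then have "(3 * C * b / r + 1)\<^sup>2 \<ge> 1" by (simp add: one_le_power)
  then have L: "L > 0" using Q(3) by (simp add: L_def)
  have "3 * C * b / r + 1 \<le> sqrt L" using Q(3) by (intro real_le_rsqrt) (simp add: L_def)
  then have "3 * C * b / r < sqrt L" by linarith
  then have Lr: "3 * C * b / sqrt L < r" using L r by (simp add: field_simps)
  define E where "E k N = L2_norm M (\<lambda>x. (1 / real N) *\<^sub>R (\<Sum>n=1..N. f (((T ^^ k) ^^ n) x)))" for k N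
  have E0: "E k \<longlonglongrightarrow> 0" if "k > 0" for k
    unfolding E_def by (rule additive_mean_tendsto_0[OF mpt_funpow[OF T] f orth[OF that]])
  define d where "d p q = (if p < q then q - p else p - q :: nat)" for p q
  \<comment> \<open>Bounds for the correlations of distinct primes, divided by \<open>N\<close>. The
    value \<open>N div max p q\<close> is the number of \<open>m\<close> with both
    \<open>p * m\<close> and \<open>q * m\<close> at most \<open>N\<close>.\<close>
  define off where "off N = (\<Sum>p\<in>Q. \<Sum>q\<in>Q. if p = q then 0 else L2_norm M f * E (d p q) (N div max p q))" for N
  have "off \<longlonglongrightarrow> (\<Sum>p\<in>Q. \<Sum>q\<in>Q. 0)" unfolding off_def
  proof (intro tendsto_sum)
    fix p q assume pq: "p \<in> Q" "q \<in> Q"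
    show "(\<lambda>N. if p = q then 0 else L2_norm M f * E (d p q) (N div max p q)) \<longlonglongrightarrow> 0"
    proof (cases "p = q")
      case False
      have "filterlim (\<lambda>N. N div max p q) at_top sequentially"
        using Qp(2)[OF pq(1)] by (intro filterlim_at_top_div_const_nat) simp
      moreover have "E (d p q) \<longlonglongrightarrow> 0" using False by (intro E0) (auto simp: d_def)
      ultimately have "(\<lambda>N. E (d p q) (N div max p q)) \<longlonglongrightarrow> 0" by (rule filterlim_compose[rotated])
      then show ?thesis using False by (simp add: tendsto_mult_right_zero)
    qed simp
  qed
  then have "off \<longlonglongrightarrow> 0" by simp
  then obtain n0 where n0: "\<And>N. N \<ge> n0 \<Longrightarrow> norm (off N - 0) < L" using LIMSEQ_D[of off 0 L] L by blast
  have "norm (L2_norm M (joint_avg N f) - 0) < r" if N: "N \<ge> max n0 (max 1 (card Q))" for N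
  proof -
    have N1: "real N \<ge> real (card Q)" "real N \<ge> 1" "N > 0" "off N \<le> L"
      using N n0[of N] by auto
    define a where "a n x = f ((T ^^ n) x) * G (S n x)" for n x
    \<comment> \<open>The condition \<open>p * m \<le> N\<close> encodes the range
      \<open>m \<le> N / p\<close>, so that all primes share the range \<open>1..N\<close> and the
      sums can be exchanged.\<close>
    define D where "D m x = (\<Sum>p\<in>Q. if p * m \<le> N then f ((T ^^ (p * m)) x) else 0)" for m x
    define G' where "G' x = G (S p0 x)" for x
    have sL: "L2_fun M (\<lambda>x. if p * m \<le> N then f ((T ^^ (p * m)) x) else 0)" for p m
      by (cases "p * m \<le> N") (simp_all add: T_L2[OF f])
    have DL: "L2_fun M (D m)" for m
      unfolding D_def[abs_def] by (intro L2_fun_sum sL)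
    \<comment> \<open>\<open>T\<close> preserves the measure, so the \<open>m\<close>-th correlation
      is that of \<open>f\<close> with \<open>f\<close> composed with the \<open>m\<close>-th power
      of \<open>T ^^ (q - p)\<close>. The sum over \<open>m\<close> is thus an inner product with an
      additive average of a power of \<open>T\<close>.\<close>
    have corr: "(\<Sum>m=1..N. if p * m \<le> N \<and> q * m \<le> N then
          L2_inner M (\<lambda>x. f ((T ^^ (p * m)) x)) (\<lambda>x. f ((T ^^ (q * m)) x)) else 0) \<le>
        real N * (L2_norm M f * E (q - p) (N div q))" if pq: "p < q" "p > 0" for p q
    proof -
      let ?K = "N div q"
      have iff: "p * m \<le> N \<and> q * m \<le> N \<longleftrightarrow> m \<le> ?K" for m
      proof -
        have "p * m \<le> q * m" using pq by (intro mult_le_mono1) simp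
        moreover have "q * m \<le> N \<longleftrightarrow> m \<le> ?K" using pq by (simp add: less_eq_div_iff_mult_less_eq mult.commute)
        ultimately show ?thesis using le_trans by blast
      qed
      have K: "?K \<le> N" by simp
      have "(\<Sum>m=1..N. if p * m \<le> N \<and> q * m \<le> N then
          L2_inner M (\<lambda>x. f ((T ^^ (p * m)) x)) (\<lambda>x. f ((T ^^ (q * m)) x)) else 0) =
        (\<Sum>m=1..?K. L2_inner M (\<lambda>x. f ((T ^^ (p * m)) x)) (\<lambda>x. f ((T ^^ (q * m)) x)))"
        unfolding iff using K by (intro sum.mono_neutral_cong_right) auto
      also have "\<dots> = (\<Sum>m=1..?K. L2_inner M f (\<lambda>x. f (((T ^^ (q - p)) ^^ m) x)))"
      proof (rule sum.cong[OF refl])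
        fix m
        have "q * m = (q - p) * m + p * m" using pq by (simp flip: add_mult_distrib)
        then have "(T ^^ (q * m)) x = ((T ^^ (q - p)) ^^ m) ((T ^^ (p * m)) x)" for x
          by (simp add: funpow_add funpow_mult mult.commute)
        then show "L2_inner M (\<lambda>x. f ((T ^^ (p * m)) x)) (\<lambda>x. f ((T ^^ (q * m)) x)) =
          L2_inner M f (\<lambda>x. f (((T ^^ (q - p)) ^^ m) x))"
          using mpt_L2_inner[OF mpt_funpow[OF T] L2_fun_measurable[OF f]
            mpt_borel_measurable[OF mpt_funpow[OF mpt_funpow[OF T]] L2_fun_measurable[OF f]], of "p * m" m "q - p"]
          by simp
      qed
      also have "\<dots> = L2_inner M f (\<lambda>x. \<Sum>m=1..?K. f (((T ^^ (q - p)) ^^ m) x))"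
        by (rule L2_inner_sum_right [symmetric, OF _ f]) (rule mpt_L2_fun[OF mpt_funpow[OF mpt_funpow[OF T]] f])
      also have "\<dots> \<le> L2_norm M f * L2_norm M (\<lambda>x. \<Sum>m=1..?K. f (((T ^^ (q - p)) ^^ m) x))"
        using L2_Cauchy_Schwarz[OF f L2_fun_sum[of "{1..?K}" M "\<lambda>m x. f (((T ^^ (q - p)) ^^ m) x)"]]
          mpt_L2_fun[OF mpt_funpow[OF mpt_funpow[OF T]] f] by (simp add: abs_le_iff)
      also have "L2_norm M (\<lambda>x. \<Sum>m=1..?K. f (((T ^^ (q - p)) ^^ m) x)) = real ?K * E (q - p) ?K"
        by (cases "?K = 0") (simp_all add: E_def L2_norm_scaleR)
      also have "L2_norm M f * (real ?K * E (q - p) ?K) \<le> L2_norm M f * (real N * E (q - p) ?K)"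
        using K by (intro mult_left_mono mult_right_mono) (auto simp: E_def)
      finally show ?thesis by (simp add: mult_ac)
    qed
    have corr': "(\<Sum>m=1..N. if p * m \<le> N \<and> q * m \<le> N then
          L2_inner M (\<lambda>x. f ((T ^^ (p * m)) x)) (\<lambda>x. f ((T ^^ (q * m)) x)) else 0) \<le>
        real N * ((if p = q then (L2_norm M f)\<^sup>2 * (1 / real p) else 0) +
          (if p = q then 0 else L2_norm M f * E (d p q) (N div max p q)))" if pq: "p \<in> Q" "q \<in> Q" for p q
    proof -
      consider "p < q" | "q < p" | "p = q" by linarith
      then show ?thesis
      proof cases
        case 1
        then show ?thesis using corr[OF 1 Qp(2)[OF pq(1)]] by (simp add: d_def max_def)
      next
        case 2
        have sw: "L2_inner M (\<lambda>x. f ((T ^^ (p * m)) x)) (\<lambda>x. f ((T ^^ (q * m)) x)) =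
          L2_inner M (\<lambda>x. f ((T ^^ (q * m)) x)) (\<lambda>x. f ((T ^^ (p * m)) x))" for m
          by (rule L2_inner_commute)
        show ?thesis unfolding sw using corr[OF 2 Qp(2)[OF pq(2)]] 2
          by (simp add: d_def max_def conj_commute)
      next
        case 3
        have p: "p > 0" by (rule Qp(2)[OF pq(1)])
        have iff: "p * m \<le> N \<longleftrightarrow> m \<le> N div p" for m
          using p by (simp add: less_eq_div_iff_mult_less_eq mult.commute)
        have "(\<Sum>m=1..N. if p * m \<le> N \<and> q * m \<le> N then
          L2_inner M (\<lambda>x. f ((T ^^ (p * m)) x)) (\<lambda>x. f ((T ^^ (q * m)) x)) else 0) =
          (\<Sum>m=1..N div p. (L2_norm M f)\<^sup>2)"
          unfolding 3 [symmetric] iff conj_absorb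
          by (intro sum.mono_neutral_cong_right) (auto simp: T_norm[OF f] simp flip: L2_norm_sq)
        also have "\<dots> = real (N div p) * (L2_norm M f)\<^sup>2" by simp
        also have "\<dots> \<le> real N / real p * (L2_norm M f)\<^sup>2"
          by (intro mult_right_mono of_nat_div_le_of_nat) simp
        finally show ?thesis using 3 by (simp add: mult_ac)
      qed
    qed
    have D2: "(\<Sum>m=1..N. (L2_norm M (D m))\<^sup>2) \<le> real N * (L * b\<^sup>2)"
    proof -
      have "(\<Sum>m=1..N. (L2_norm M (D m))\<^sup>2) = (\<Sum>m=1..N. \<Sum>p\<in>Q. \<Sum>q\<in>Q.
          if p * m \<le> N \<and> q * m \<le> N then
          L2_inner M (\<lambda>x. f ((T ^^ (p * m)) x)) (\<lambda>x. f ((T ^^ (q * m)) x)) else 0)"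
      proof (rule sum.cong[OF refl])
        fix m
        let ?s = "\<lambda>p x. if p * m \<le> N then f ((T ^^ (p * m)) x) else 0"
        have s: "L2_fun M (?s p)" for p by (rule sL)
        have "(L2_norm M (D m))\<^sup>2 = L2_inner M (\<lambda>x. \<Sum>p\<in>Q. ?s p x) (\<lambda>x. \<Sum>q\<in>Q. ?s q x)"
          by (simp add: L2_norm_sq D_def[abs_def])
        also have "\<dots> = (\<Sum>p\<in>Q. L2_inner M (?s p) (\<lambda>x. \<Sum>q\<in>Q. ?s q x))"
          by (rule L2_inner_sum_left[OF s L2_fun_sum[OF s]])
        also have "\<dots> = (\<Sum>p\<in>Q. \<Sum>q\<in>Q. L2_inner M (?s p) (?s q))"
          by (intro sum.cong refl L2_inner_sum_right s)
        also have "\<dots> = (\<Sum>p\<in>Q. \<Sum>q\<in>Q. if p * m \<le> N \<and> q * m \<le> N then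
          L2_inner M (\<lambda>x. f ((T ^^ (p * m)) x)) (\<lambda>x. f ((T ^^ (q * m)) x)) else 0)"
          by (intro sum.cong refl) (auto simp: L2_inner_def)
        finally show "(L2_norm M (D m))\<^sup>2 = \<dots>" .
      qed
      also have "\<dots> = (\<Sum>p\<in>Q. \<Sum>m=1..N. \<Sum>q\<in>Q. if p * m \<le> N \<and> q * m \<le> N then
          L2_inner M (\<lambda>x. f ((T ^^ (p * m)) x)) (\<lambda>x. f ((T ^^ (q * m)) x)) else 0)"
        by (rule sum.swap)
      also have "\<dots> = (\<Sum>p\<in>Q. \<Sum>q\<in>Q. \<Sum>m=1..N. if p * m \<le> N \<and> q * m \<le> N then
          L2_inner M (\<lambda>x. f ((T ^^ (p * m)) x)) (\<lambda>x. f ((T ^^ (q * m)) x)) else 0)"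
        by (rule sum.cong[OF refl]) (rule sum.swap)
      also have "\<dots> \<le> (\<Sum>p\<in>Q. \<Sum>q\<in>Q. real N * ((if p = q then (L2_norm M f)\<^sup>2 * (1 / real p) else 0) +
          (if p = q then 0 else L2_norm M f * E (d p q) (N div max p q))))"
        by (intro sum_mono corr')
      also have "\<dots> = real N * ((\<Sum>p\<in>Q. \<Sum>q\<in>Q. if p = q then (L2_norm M f)\<^sup>2 * (1 / real p) else 0) + off N)"
        unfolding off_def sum_distrib_left [symmetric] sum.distrib ..
      also have "(\<Sum>p\<in>Q. \<Sum>q\<in>Q. if p = q then (L2_norm M f)\<^sup>2 * (1 / real p) else 0) = (L2_norm M f)\<^sup>2 * L"
        unfolding L_def sum_distrib_left using Q(1) by simp
      also have "real N * ((L2_norm M f)\<^sup>2 * L + off N) \<le> real N * (L * b\<^sup>2)"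
        using N1(4) unfolding b(2) by (intro mult_left_mono) (simp_all add: algebra_simps)
      finally show ?thesis .
    qed
    have D1: "(\<Sum>m=1..N. L2_norm M (D m)) \<le> real N * (sqrt L * b)"
    proof (rule power2_le_imp_le)
      have "(\<Sum>m=1..N. L2_norm M (D m) * 1)\<^sup>2 \<le> (\<Sum>m=1..N. (L2_norm M (D m))\<^sup>2) * (\<Sum>m=1..N. 1\<^sup>2)"
        by (rule Cauchy_Schwarz_ineq_sum)
      also have "\<dots> \<le> (real N * (L * b\<^sup>2)) * real N" using D2 L by (intro mult_mono) auto
      also have "\<dots> = (real N * (sqrt L * b))\<^sup>2" using L by (simp add: power_mult_distrib power2_eq_square[of "real N"])
      finally show "(\<Sum>m=1..N. L2_norm M (D m))\<^sup>2 \<le> (real N * (sqrt L * b))\<^sup>2" by simp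
    qed (use L b in simp)
    have G'm: "n > 0 \<Longrightarrow> (\<lambda>x. G' (S n x)) \<in> borel_measurable M" for n
      unfolding G'_def using mpt_borel_measurable[OF S_mpt mpt_borel_measurable[OF S_mpt[OF p0] G_meas]] .
    have G'b: "n > 0 \<Longrightarrow> AE x in M. norm (G' (S n x)) \<le> C" for n
      unfolding G'_def using mpt_AE[OF S_mpt G_S_le[OF p0]] .
    define W where "W x = (1/L) *\<^sub>R (\<Sum>p\<in>Q. (1 / real N) *\<^sub>R (\<Sum>m\<in>nats_upto (real N / real p). a (p * m) x))" for x
    \<comment> \<open>For \<open>p\<close> in the class, \<open>S (p * m)\<close> is
      \<open>S p0 \<circ> S m\<close>, so the factor \<open>G' \<circ> S m\<close> comes out of the
      sum over \<open>p\<close>. Afterwards it enters only through its bound \<open>C\<close>, so no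
      relation between \<open>T\<close> and \<open>S\<close> is involved.\<close>
    have Weq: "W x = (1/L * (1 / real N)) *\<^sub>R (\<Sum>m=1..N. D m x * G' (S m x))" if x: "x \<in> space M" for x
    proof -
      have "(\<Sum>p\<in>Q. \<Sum>m\<in>nats_upto (real N / real p). a (p * m) x) =
        (\<Sum>p\<in>Q. \<Sum>m=1..N. if p * m \<le> N then f ((T ^^ (p * m)) x) * G' (S m x) else 0)"
      proof (rule sum.cong[OF refl])
        fix p assume p: "p \<in> Q"
        have "(\<Sum>m\<in>nats_upto (real N / real p). a (p * m) x) =
          (\<Sum>m\<in>nats_upto (real N / real p). f ((T ^^ (p * m)) x) * G' (S m x))"
        proof (rule sum.cong[OF refl])
          fix m assume "m \<in> nats_upto (real N / real p)"
          then have m: "m > 0" by (rule nats_upto_pos)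
          have "S (p * m) x = S p (S m x)" using S_S[OF Qp(2)[OF p] m x] by simp
          also have "\<dots> = S p0 (S m x)" using P(2)[of p "S m x"] p Q(2) S_space[OF m x] by auto
          finally show "a (p * m) x = f ((T ^^ (p * m)) x) * G' (S m x)" by (simp add: a_def G'_def)
        qed
        also have "\<dots> = (\<Sum>m=1..N. if p * m \<le> N then f ((T ^^ (p * m)) x) * G' (S m x) else 0)"
        proof (rule sum.mono_neutral_cong_left)
          have iff: "m \<in> nats_upto (real N / real p) \<longleftrightarrow> m > 0 \<and> p * m \<le> N" for m
            using Qp(2)[OF p] by (simp add: nats_upto_def pos_le_divide_eq mult.commute flip: of_nat_mult)
          show "nats_upto (real N / real p) \<subseteq> {1..N}"
          proof
            fix m assume "m \<in> nats_upto (real N / real p)"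
            then have "m > 0" "p * m \<le> N" by (simp_all add: iff)
            moreover have "m \<le> p * m" using Qp(2)[OF p] by (cases p) auto
            ultimately have "m \<le> N" using le_trans by blast
            then show "m \<in> {1..N}" using \<open>m > 0\<close> by simp
          qed
          show "\<forall>m\<in>{1..N} - nats_upto (real N / real p).
            (if p * m \<le> N then f ((T ^^ (p * m)) x) * G' (S m x) else 0) = 0" by (auto simp: iff)
          show "\<And>m. m \<in> nats_upto (real N / real p) \<Longrightarrow> f ((T ^^ (p * m)) x) * G' (S m x) =
            (if p * m \<le> N then f ((T ^^ (p * m)) x) * G' (S m x) else 0)" by (simp add: iff)
        qed simp
        finally show "(\<Sum>m\<in>nats_upto (real N / real p). a (p * m) x) =
          (\<Sum>m=1..N. if p * m \<le> N then f ((T ^^ (p * m)) x) * G' (S m x) else 0)" .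
      qed
      also have "\<dots> = (\<Sum>m=1..N. \<Sum>p\<in>Q. if p * m \<le> N then f ((T ^^ (p * m)) x) * G' (S m x) else 0)"
        by (rule sum.swap)
      also have "\<dots> = (\<Sum>m=1..N. D m x * G' (S m x))"
        unfolding D_def sum_distrib_right by (intro sum.cong refl) auto
      finally show ?thesis unfolding W_def scaleR_sum_right [symmetric] scaleR_scaleR by simp
    qed
    have Wnorm: "L2_norm M W \<le> C * b / sqrt L"
    proof -
      have "L2_norm M (\<lambda>x. \<Sum>m=1..N. D m x * G' (S m x)) \<le> (\<Sum>m=1..N. C * L2_norm M (D m))"
        by (rule order_trans[OF L2_norm_sum_le sum_mono]) (use L2_mult_bounded[OF DL G'm G'b] in auto)
      also have "\<dots> \<le> C * (real N * (sqrt L * b))"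
        unfolding sum_distrib_left [symmetric] by (intro mult_left_mono D1 C_nonneg)
      finally have le: "L2_norm M (\<lambda>x. \<Sum>m=1..N. D m x * G' (S m x)) \<le> C * (real N * (sqrt L * b))" .
      have "L2_norm M W = L2_norm M (\<lambda>x. (1/L * (1 / real N)) *\<^sub>R (\<Sum>m=1..N. D m x * G' (S m x)))"
        by (rule L2_norm_cong) (rule Weq)
      also have "\<dots> = 1/L * (1 / real N) * L2_norm M (\<lambda>x. \<Sum>m=1..N. D m x * G' (S m x))"
        unfolding L2_norm_scaleR using L by simp
      also have "\<dots> \<le> 1/L * (1 / real N) * (C * (real N * (sqrt L * b)))"
        by (rule mult_left_mono[OF le]) (use L in simp)
      also have "\<dots> = C * b * (sqrt L / L)" using N1 by simp
      also have "sqrt L / L = 1 / sqrt L" using L real_sqrt_mult_self[of L] by (simp add: field_simps)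
      finally show ?thesis by simp
    qed
    have aL: "n > 0 \<Longrightarrow> L2_fun M (a n)" "n > 0 \<Longrightarrow> L2_norm M (a n) \<le> C * L2_norm M f" for n
      unfolding a_def[abs_def] using term_L2[OF _ f] by auto
    have tk: "L2_norm M (\<lambda>x. joint_avg N f x - W x) \<le> 2 * (C * L2_norm M f) / sqrt L"
      using turan_kubilius_L2[OF aL Q(1) Qp(1) L_def L N1(1,2)]
      by (simp add: joint_avg_def W_def a_def nats_upto_of_nat)
    have WL: "L2_fun M W"
      unfolding W_def[abs_def] using Qp(2) by (intro L2_fun_scaleR L2_fun_sum aL) (auto simp: nats_upto_pos)
    have "L2_norm M (joint_avg N f) - L2_norm M W \<le> 2 * (C * L2_norm M f) / sqrt L"
      using L2_norm_diff_ge[OF joint_avg_L2[OF f] WL, of N] tk by linarith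
    also have "\<dots> \<le> 2 * (C * b) / sqrt L"
      using L bf C_nonneg by (intro divide_right_mono mult_left_mono) auto
    finally have "L2_norm M (joint_avg N f) \<le> 3 * C * b / sqrt L" using Wnorm by (simp add: add_divide_distrib)
    then show ?thesis using Lr by simp
  qed
  then show "\<exists>no. \<forall>N\<ge>no. norm (L2_norm M (joint_avg N f) - 0) < r" by blast
qed

end

text \<open>The representatives \<open>Suc i\<close> run through \<open>1..k\<close>, because
  aperiodicity speaks of residues \<open>r \<ge> 1\<close>. Then \<open>m\<close> starts at 0, and
  \<open>k * m + Suc i \<le> N\<close> has \<open>(N + k - Suc i) div k\<close> solutions.\<close>

lemma sum_residue_classes:
  fixes \<phi> :: "nat \<Rightarrow> 'b::comm_monoid_add"
  assumes k: "k > 0"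
  shows "(\<Sum>n=1..N. \<phi> n) = (\<Sum>i<k. \<Sum>m<(N + k - Suc i) div k. \<phi> (k * m + Suc i))"
proof -
  have iff: "m < (N + k - Suc i) div k \<longleftrightarrow> k * m + Suc i \<le> N" if "i < k" for i m
  proof -
    have "m < (N + k - Suc i) div k \<longleftrightarrow> Suc m * k \<le> N + k - Suc i"
      using k by (simp only: Suc_le_eq [symmetric] less_eq_div_iff_mult_less_eq)
    also have "\<dots> \<longleftrightarrow> k * m + Suc i \<le> N" using that by (auto simp: algebra_simps)
    finally show ?thesis .
  qed
  have "(\<Sum>n=1..N. \<phi> n) = (\<Sum>(i,m)\<in>(SIGMA i:{..<k}. {..<(N + k - Suc i) div k}). \<phi> (k * m + Suc i))"
    by (rule sum.reindex_bij_witness[where i = "\<lambda>(i,m). k * m + Suc i" and j = "\<lambda>n. ((n - 1) mod k, (n - 1) div k)"])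
       (use k in \<open>auto simp: iff Suc_le_eq\<close>)
  also have "\<dots> = (\<Sum>i<k. \<Sum>m<(N + k - Suc i) div k. \<phi> (k * m + Suc i))"
    by (rule sum.Sigma [symmetric]) auto
  finally show ?thesis .
qed

lemma residue_class_count:
  fixes N k i :: nat
  assumes "i < k" "N > 0"
  shows "(N + k - Suc i) div k \<le> N"
    and "\<bar>real ((N + k - Suc i) div k) / real N - 1 / real k\<bar> \<le> 1 / real N"
proof -
  let ?c = "(N + k - Suc i) div k"
  have eq: "k * ?c + (N + k - Suc i) mod k = N + k - Suc i" by simp
  have md: "(N + k - Suc i) mod k < k" using assms by simp
  have lo: "N \<le> k * ?c + k" and hi: "k * ?c \<le> N + k" using eq md assms by linarith+
  have "real N \<le> real (k * ?c + k)" "real (k * ?c) \<le> real (N + k)"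
    using lo hi by (simp_all only: of_nat_le_iff)
  then have "\<bar>real k * real ?c - real N\<bar> \<le> real k" by (simp add: abs_le_iff)
  moreover have "real ?c / real N - 1 / real k = (real k * real ?c - real N) / (real k * real N)"
    using assms by (simp add: field_simps)
  ultimately show "\<bar>real ?c / real N - 1 / real k\<bar> \<le> 1 / real N"
    using assms by (simp add: abs_divide abs_mult pos_divide_le_eq)
  have "1 * 1 + k * N \<ge> k + N"
  proof -
    have "(k - 1) * (N - 1) \<ge> 0" by simp
    obtain k' N' where "k = Suc k'" "N = Suc N'" using assms by (metis gr0_conv_Suc less_nat_zero_code not_gr_zero)
    then show ?thesis by simp
  qed
  then have "N + k - Suc i \<le> k * N" by simp
  then have "?c \<le> k * N div k" by (rule div_le_mono)
  then show "?c \<le> N" using assms by simp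
qed

section \<open>Periodic functions and convergence of the joint averages\<close>

context joint_system
begin

lemma norm_integral_G_le: "norm (\<integral>y. G y \<partial>M) \<le> C"
proof -
  have "L2_norm M G \<le> L2_norm M (\<lambda>_. complex_of_real C)"
    by (rule L2_norm_mono_AE(1)) (use G_le C_nonneg in auto)
  then show ?thesis using norm_integral_le_L2_norm[OF G_L2] C_nonneg by simp
qed

lemma T_AE_invariant:
  assumes "AE x in M. f ((T ^^ k) x) = f x"
  shows "AE x in M. \<forall>m j. f ((T ^^ (k * m + j)) x) = f ((T ^^ j) x)"
proof -
  have "AE x in M. f ((T ^^ (k * m + j)) x) = f ((T ^^ j) x)" for m j
  proof (induction m)
    case (Suc m)
    have "AE x in M. f ((T ^^ k) ((T ^^ (k * m + j)) x)) = f ((T ^^ (k * m + j)) x)"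
      using mpt_AE[OF mpt_funpow[OF T] assms] .
    then show ?case using Suc
    proof eventually_elim
      case (elim x)
      have "k * Suc m + j = k + (k * m + j)" by simp
      then have "(T ^^ (k * Suc m + j)) x = (T ^^ k) ((T ^^ (k * m + j)) x)" by (simp only: funpow_add comp_apply)
      then show ?case using elim by simp
    qed
  qed simp
  then show ?thesis by (simp add: AE_all_countable)
qed

lemma joint_avg_const:
  assumes mean: "(\<lambda>N. L2_norm M (\<lambda>\<omega>. mult_avg S G (real N) \<omega> - (\<integral>y. G y \<partial>M))) \<longlonglongrightarrow> 0"
    and F: "L2_fun M F" and c: "AE x in M. F x = c"
  shows "(\<lambda>N. L2_norm M (\<lambda>x. joint_avg N F x - (\<integral>y. F y \<partial>M) * (\<integral>y. G y \<partial>M))) \<longlonglongrightarrow> 0"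
proof -
  define I where "I = (\<integral>y. G y \<partial>M)"
  have Fint: "(\<integral>y. F y \<partial>M) = c"
    using integral_cong_AE[of F M "\<lambda>_. c"] c L2_fun_measurable[OF F] by (simp add: prob_space)
  have all: "AE x in M. \<forall>n. F ((T ^^ n) x) = c"
    using mpt_AE[OF mpt_funpow[OF T] c] by (simp add: AE_all_countable)
  have L: "L2_fun M (\<lambda>\<omega>. mult_avg S G (real N) \<omega> - I)" for N
    by (intro L2_fun_diff mult_avg_L2 G_L2 L2_fun_const)
  have le: "L2_norm M (\<lambda>x. joint_avg N F x - c * I) \<le> norm c * L2_norm M (\<lambda>\<omega>. mult_avg S G (real N) \<omega> - I)" for N
  proof -
    have "L2_norm M (\<lambda>x. joint_avg N F x - c * I) = L2_norm M (\<lambda>\<omega>. (mult_avg S G (real N) \<omega> - I) * c)"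
    proof (rule L2_norm_cong_AE)
      show "AE x in M. joint_avg N F x - c * I = (mult_avg S G (real N) x - I) * c"
        using all by eventually_elim
          (simp add: joint_avg_def mult_avg_of_nat scaleR_conv_of_real algebra_simps flip: sum_distrib_left)
      show "(\<lambda>x. joint_avg N F x - c * I) \<in> borel_measurable M"
        using L2_fun_measurable[OF joint_avg_L2[OF F]] by measurable
      show "(\<lambda>x. (mult_avg S G (real N) x - I) * c) \<in> borel_measurable M"
        using L2_fun_measurable[OF L] by measurable
    qed
    also have "\<dots> \<le> norm c * L2_norm M (\<lambda>\<omega>. mult_avg S G (real N) \<omega> - I)"
      by (rule L2_mult_bounded(2)[OF L]) auto
    finally show ?thesis .
  qed
  have lim: "(\<lambda>N. norm c * L2_norm M (\<lambda>\<omega>. mult_avg S G (real N) \<omega> - I)) \<longlonglongrightarrow> 0"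
    using mean unfolding I_def by (rule tendsto_mult_right_zero)
  have "(\<lambda>N. L2_norm M (\<lambda>x. joint_avg N F x - c * I)) \<longlonglongrightarrow> 0"
    by (rule tendsto_sandwich[OF _ _ tendsto_const lim]) (simp_all add: le)
  then show ?thesis by (simp add: Fint I_def)
qed

text \<open>Aperiodicity averages over \<open>m = 1..K\<close> with divisor \<open>K\<close>; here
  \<open>m\<close> starts at 0 and the divisor is \<open>N\<close>. The shift costs two boundary
  terms of size \<open>1 / N\<close>, and the number of terms divided by \<open>N\<close> tends to
  \<open>1 / k\<close>.\<close>

lemma residue_class_avg_tendsto:
  assumes ap: "aperiodic M S" and i: "i < k"
  shows "(\<lambda>N. L2_norm M (\<lambda>x. (1 / real N) *\<^sub>R (\<Sum>m<(N + k - Suc i) div k. G (S (k * m + Suc i) x)) -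
    (1 / real k) *\<^sub>R (\<integral>y. G y \<partial>M))) \<longlonglongrightarrow> 0"
proof -
  define I where "I = (\<integral>y. G y \<partial>M)"
  define g where "g m x = G (S (k * m + Suc i) x)" for m x
  define E where "E N = L2_norm M (\<lambda>x. (\<Sum>n=1..N. g n x) / of_nat N - I)" for N
  define c where "c N = (N + k - Suc i) div k" for N
  have gL: "L2_fun M (g m)" and gn: "L2_norm M (g m) = L2_norm M G" for m
    unfolding g_def[abs_def] by (intro S_L2 S_norm G_L2; simp)+
  have E: "E \<longlonglongrightarrow> 0"
    using ap[unfolded aperiodic_def, rule_format, OF G_L2, of "Suc i" k] i
    unfolding tendsto_L2_def E_def g_def I_def by simp
  have clim: "filterlim c at_top sequentially"
  proof (rule filterlim_at_top_mono)
    show "filterlim (\<lambda>N. N div k) at_top sequentially" using i by (intro filterlim_at_top_div_const_nat) simp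
    show "\<forall>\<^sub>F N in sequentially. N div k \<le> c N" unfolding c_def using i by (intro always_eventually allI div_le_mono) simp
  qed
  have EL: "L2_fun M (\<lambda>x. (\<Sum>n=1..N. g n x) / of_nat N - I)" for N
  proof -
    have "L2_fun M (\<lambda>x. (1 / real N) *\<^sub>R (\<Sum>n=1..N. g n x) - I)"
      by (intro L2_fun_diff L2_fun_scaleR L2_fun_sum gL L2_fun_const)
    then show ?thesis by (simp add: scaleR_conv_of_real)
  qed
  have le: "L2_norm M (\<lambda>x. (1 / real N) *\<^sub>R (\<Sum>m<c N. g m x) - (1 / real k) *\<^sub>R I) \<le>
      E (c N) + 1 / real N * (2 * L2_norm M G + norm I)" if N: "N \<ge> 1" for N
  proof -
    have eq: "(1 / real N) *\<^sub>R (\<Sum>m<c N. g m x) - (1 / real k) *\<^sub>R I =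
      (real (c N) / real N) *\<^sub>R ((\<Sum>n=1..c N. g n x) / of_nat (c N) - I) +
      ((1 / real N) *\<^sub>R (g 0 x - g (c N) x) + (real (c N) / real N - 1 / real k) *\<^sub>R I)" for x
    proof -
      have 1: "(\<Sum>m<K. g m x) = (\<Sum>n=1..K. g n x) + (g 0 x - g K x)" for K
        by (induction K) simp_all
      have 2: "(real (c N) / real N) *\<^sub>R ((\<Sum>n=1..c N. g n x) / of_nat (c N)) = (1 / real N) *\<^sub>R (\<Sum>n=1..c N. g n x)"
        by (cases "c N = 0") (simp_all add: scaleR_conv_of_real)
      show ?thesis unfolding 1 scaleR_diff_right scaleR_add_right scaleR_left_diff_distrib 2
        by simp
    qed
    have "L2_norm M (\<lambda>x. (1 / real N) *\<^sub>R (\<Sum>m<c N. g m x) - (1 / real k) *\<^sub>R I) \<le>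
      L2_norm M (\<lambda>x. (real (c N) / real N) *\<^sub>R ((\<Sum>n=1..c N. g n x) / of_nat (c N) - I)) +
      (L2_norm M (\<lambda>x. (1 / real N) *\<^sub>R (g 0 x - g (c N) x)) + L2_norm M (\<lambda>x. (real (c N) / real N - 1 / real k) *\<^sub>R I))"
      unfolding eq
      by (intro order_trans[OF L2_norm_add_le] add_mono order_refl L2_norm_add_le L2_fun_add L2_fun_scaleR EL
        L2_fun_diff gL L2_fun_const)
    also have "\<dots> \<le> E (c N) + (1 / real N * (2 * L2_norm M G) + 1 / real N * norm I)"
    proof (intro add_mono)
      have "real (c N) / real N \<le> 1" using residue_class_count(1)[OF i, of N] N by (simp add: c_def)
      then have "real (c N) / real N * E (c N) \<le> 1 * E (c N)" by (intro mult_right_mono) (simp_all add: E_def)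
      then show "L2_norm M (\<lambda>x. (real (c N) / real N) *\<^sub>R ((\<Sum>n=1..c N. g n x) / of_nat (c N) - I)) \<le> E (c N)"
        unfolding L2_norm_scaleR by (simp add: E_def)
      show "L2_norm M (\<lambda>x. (1 / real N) *\<^sub>R (g 0 x - g (c N) x)) \<le> 1 / real N * (2 * L2_norm M G)"
        unfolding L2_norm_scaleR using L2_norm_diff_le[OF gL gL, of 0 "c N"] by (simp add: gn divide_right_mono)
      have "L2_norm M (\<lambda>x. (real (c N) / real N - 1 / real k) *\<^sub>R I) = \<bar>real (c N) / real N - 1 / real k\<bar> * norm I"
        by (subst L2_norm_scaleR) simp
      also have "\<dots> \<le> 1 / real N * norm I"
        using residue_class_count(2)[OF i, of N] N by (intro mult_right_mono) (simp_all add: c_def)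
      finally show "L2_norm M (\<lambda>x. (real (c N) / real N - 1 / real k) *\<^sub>R I) \<le> 1 / real N * norm I" .
    qed
    finally show ?thesis by (simp add: algebra_simps)
  qed
  have lim: "(\<lambda>N. E (c N) + 1 / real N * (2 * L2_norm M G + norm I)) \<longlonglongrightarrow> 0"
    using tendsto_add[OF filterlim_compose[OF E clim] tendsto_mult_left_zero[OF lim_1_over_n]] by simp
  have "(\<lambda>N. L2_norm M (\<lambda>x. (1 / real N) *\<^sub>R (\<Sum>m<c N. g m x) - (1 / real k) *\<^sub>R I)) \<longlonglongrightarrow> 0"
    by (rule tendsto_sandwich[OF _ _ tendsto_const lim])
       (simp, intro eventually_sequentiallyI[of 1] le)
  then show ?thesis by (simp only: c_def g_def I_def)
qed

text \<open>On the class of \<open>Suc i\<close> the factor \<open>F ((T ^^ n) x)\<close> is almost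
  everywhere the fixed function \<open>F \<circ> T ^^ Suc i\<close>, while the part of the average
  of \<open>G\<close> along the class tends to its integral divided by \<open>k\<close>. What
  remains is the mean of \<open>F\<close> over one period of the orbit, which is
  \<open>T\<close>-invariant and so constant by ergodicity.\<close>

lemma joint_avg_periodic:
  assumes ap: "aperiodic M S" and erg: "ergodic M T"
    and F: "L2_fun M F" and k: "k > 0" and inv: "AE x in M. F ((T ^^ k) x) = F x"
  shows "(\<lambda>N. L2_norm M (\<lambda>x. joint_avg N F x - (\<integral>y. F y \<partial>M) * (\<integral>y. G y \<partial>M))) \<longlonglongrightarrow> 0"
proof -
  define I where "I = (\<integral>y. G y \<partial>M)"
  define w where "w i N x = (1 / real N) *\<^sub>R (\<Sum>m<(N + k - Suc i) div k. G (S (k * m + Suc i) x)) - (1 / real k) *\<^sub>R I" for i N x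
  have GSL: "L2_fun M (\<lambda>x. G (S (k * m + Suc i) x))" for m i
    by (rule S_L2[OF _ G_L2]) simp
  have wL: "L2_fun M (w i N)" for i N
    unfolding w_def[abs_def] by (intro L2_fun_diff L2_fun_scaleR L2_fun_sum GSL L2_fun_const)
  have wlim: "(\<lambda>N. L2_norm M (w i N)) \<longlonglongrightarrow> 0" if "i < k" for i
    unfolding w_def[abs_def] I_def by (rule residue_class_avg_tendsto[OF ap that])
  \<comment> \<open>The uniform bound permits multiplication by \<open>F \<circ> T ^^ Suc i\<close>,
    which may be unbounded.\<close>
  have wb: "AE x in M. norm (w i N x) \<le> C + norm I" if i: "i < k" for i N
  proof -
    have "AE x in M. \<forall>m. norm (G (S (k * m + Suc i) x)) \<le> C"
      using G_S_le by (simp add: AE_all_countable)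
    then show ?thesis
    proof eventually_elim
      case (elim x)
      have "norm ((1 / real N) *\<^sub>R (\<Sum>m<(N + k - Suc i) div k. G (S (k * m + Suc i) x))) \<le> C"
      proof (cases "N = 0")
        case False
        let ?c = "(N + k - Suc i) div k"
        have "norm (\<Sum>m<?c. G (S (k * m + Suc i) x)) \<le> real (card {..<?c}) * C"
          by (rule sum_norm_bound) (use elim in blast)
        also have "\<dots> \<le> real N * C"
          using residue_class_count(1)[OF i, of N] False C_nonneg by (intro mult_right_mono) auto
        finally show ?thesis using False by (simp add: pos_divide_le_eq mult.commute)
      qed (use C_nonneg in simp)
      moreover have "norm ((1 / real k) *\<^sub>R I) \<le> norm I" using k by (simp add: divide_le_eq mult_le_cancel_left1)
      ultimately show ?case unfolding w_def by (intro order_trans[OF norm_triangle_ineq4] add_mono)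
    qed
  qed
  define Fb where "Fb x = (1 / real k) *\<^sub>R (\<Sum>i<k. F ((T ^^ Suc i) x))" for x
  have FbL: "L2_fun M Fb" unfolding Fb_def[abs_def] by (intro L2_fun_scaleR L2_fun_sum T_L2 F)
  have per: "AE x in M. \<forall>m j. F ((T ^^ (k * m + j)) x) = F ((T ^^ j) x)" by (rule T_AE_invariant[OF inv])
  have "AE x in M. Fb (T x) = Fb x" using per
  proof eventually_elim
    case (elim x)
    have "(\<Sum>i<k. F ((T ^^ Suc i) (T x))) = (\<Sum>i<k. F ((T ^^ Suc (Suc i)) x))"
      by (simp add: funpow_Suc_right del: funpow.simps)
    also have "\<dots> = (\<Sum>i<k. F ((T ^^ Suc i) x)) + (F ((T ^^ Suc k) x) - F ((T ^^ Suc 0) x))"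
      by (induction k) (simp_all del: funpow.simps)
    also have "F ((T ^^ Suc k) x) = F ((T ^^ Suc 0) x)" using elim[rule_format, of 1 "Suc 0"] by (simp del: funpow.simps)
    finally show ?case by (simp add: Fb_def)
  qed
  then obtain c where c: "AE x in M. Fb x = c"
    using ergodic_invariant_const[OF T erg L2_fun_measurable[OF FbL]] by blast
  have "c = (\<integral>y. Fb y \<partial>M)"
    using integral_cong_AE[of Fb M "\<lambda>_. c"] c L2_fun_measurable[OF FbL] by (simp add: prob_space)
  also have "\<dots> = (1 / real k) *\<^sub>R (\<Sum>i<k. \<integral>y. F ((T ^^ Suc i) y) \<partial>M)"
    unfolding Fb_def by (simp add: Bochner_Integration.integral_sum L2_fun_integrable T_L2[OF F] del: funpow.simps)
  also have "\<dots> = (\<integral>y. F y \<partial>M)"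
    using k by (simp add: mpt_integral[OF mpt_funpow[OF T] L2_fun_measurable[OF F]] scaleR_conv_of_real del: funpow.simps)
  finally have cF: "c = (\<integral>y. F y \<partial>M)" .
  have eq: "AE x in M. joint_avg N F x - (\<integral>y. F y \<partial>M) * I = (\<Sum>i<k. F ((T ^^ Suc i) x) * w i N x)" for N
    using per c
  proof eventually_elim
    case (elim x)
    have "(\<Sum>n=1..N. F ((T ^^ n) x) * G (S n x)) =
      (\<Sum>i<k. F ((T ^^ Suc i) x) * (\<Sum>m<(N + k - Suc i) div k. G (S (k * m + Suc i) x)))"
      unfolding sum_residue_classes[OF k] sum_distrib_left
      by (intro sum.cong refl) (simp only: elim(1))
    moreover have "(\<integral>y. F y \<partial>M) * I = (\<Sum>i<k. F ((T ^^ Suc i) x) * ((1 / real k) *\<^sub>R I))"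
      unfolding cF [symmetric] elim(2) [symmetric] Fb_def
      by (simp add: sum_distrib_right sum_distrib_left scaleR_conv_of_real mult_ac del: funpow.simps)
    ultimately show ?case
      by (simp only: joint_avg_def w_def right_diff_distrib sum_subtractf mult_scaleR_right
        scaleR_sum_right [symmetric])
  qed
  have FwL: "L2_fun M (\<lambda>x. F ((T ^^ Suc i) x) * w i N x)" if "i < k" for i N
    by (rule L2_mult_bounded(1)[OF T_L2[OF F] L2_fun_measurable[OF wL] wb[OF that]])
  have le: "L2_norm M (\<lambda>x. joint_avg N F x - (\<integral>y. F y \<partial>M) * I) \<le>
      (\<Sum>i<k. L2_norm M (\<lambda>x. F ((T ^^ Suc i) x) * w i N x))" for N
  proof -
    have "L2_norm M (\<lambda>x. joint_avg N F x - (\<integral>y. F y \<partial>M) * I) = L2_norm M (\<lambda>x. \<Sum>i<k. F ((T ^^ Suc i) x) * w i N x)"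
    proof (rule L2_norm_cong_AE[OF eq])
      show "(\<lambda>x. joint_avg N F x - (\<integral>y. F y \<partial>M) * I) \<in> borel_measurable M"
        using L2_fun_measurable[OF joint_avg_L2[OF F]] by measurable
      show "(\<lambda>x. \<Sum>i<k. F ((T ^^ Suc i) x) * w i N x) \<in> borel_measurable M"
        by (intro L2_fun_measurable L2_fun_sum FwL) simp
    qed
    also have "\<dots> \<le> (\<Sum>i<k. L2_norm M (\<lambda>x. F ((T ^^ Suc i) x) * w i N x))"
      by (rule L2_norm_sum_le) (use FwL in simp)
    finally show ?thesis .
  qed
  have "(\<lambda>N. \<Sum>i<k. L2_norm M (\<lambda>x. F ((T ^^ Suc i) x) * w i N x)) \<longlonglongrightarrow> (\<Sum>i<k. 0)"
    by (intro tendsto_sum L2_mult_bounded_tendsto_0[OF T_L2[OF F] L2_fun_measurable[OF wL] wb wlim]) simp_all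
  then have lim: "(\<lambda>N. \<Sum>i<k. L2_norm M (\<lambda>x. F ((T ^^ Suc i) x) * w i N x)) \<longlonglongrightarrow> 0" by simp
  show ?thesis unfolding I_def [symmetric]
    by (rule tendsto_sandwich[OF _ _ tendsto_const lim]) (simp, intro always_eventually allI le)
qed

text \<open>Functions invariant under a power of \<open>T\<close> converge, so an \<open>h\<close>
  orthogonal to all functions with convergence is orthogonal to them. The Daboussi--Katai criterion
  then sends the joint averages of \<open>h\<close> to 0, and the integral of \<open>h\<close>
  vanishes. So \<open>h\<close> itself converges and is orthogonal to itself.\<close>

lemma joint_avg_tendsto:
  assumes fg: "finite {restrict (S p) (space M) | p. prime p}" and pe: "pretentiously_ergodic M S"
    and erg: "ergodic M T" and cases: "totally_ergodic M T \<or> aperiodic M S" and F: "L2_fun M F"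
  shows "(\<lambda>N. L2_norm M (\<lambda>x. joint_avg N F x - (\<integral>y. F y \<partial>M) * (\<integral>y. G y \<partial>M))) \<longlonglongrightarrow> 0"
proof (rule L2_family_tendsto_0
    [where \<Phi> = "\<lambda>N F x. joint_avg N F x - (\<integral>y. F y \<partial>M) * (\<integral>y. G y \<partial>M)" and C = "2 * C", OF _ F])
  show "L2_family (\<lambda>N F x. joint_avg N F x - (\<integral>y. F y \<partial>M) * (\<integral>y. G y \<partial>M)) (2 * C)"
    unfolding L2_family_def
  proof (intro conjI allI impI)
    fix f f' :: "'a \<Rightarrow> complex" and N c assume f: "L2_fun M f"
    show "L2_fun M (\<lambda>x. joint_avg N f x - (\<integral>y. f y \<partial>M) * (\<integral>y. G y \<partial>M))"
      by (intro L2_fun_diff joint_avg_L2 f L2_fun_const)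
    have "norm ((\<integral>y. f y \<partial>M) * (\<integral>y. G y \<partial>M)) \<le> L2_norm M f * C"
      unfolding norm_mult by (intro mult_mono norm_integral_le_L2_norm f norm_integral_G_le) auto
    moreover have "L2_norm M f * C = C * L2_norm M f" "2 * C * L2_norm M f = C * L2_norm M f + C * L2_norm M f"
      by simp_all
    ultimately show "L2_norm M (\<lambda>x. joint_avg N f x - (\<integral>y. f y \<partial>M) * (\<integral>y. G y \<partial>M)) \<le> 2 * C * L2_norm M f"
      using L2_norm_diff_le[OF joint_avg_L2[OF f, of N] L2_fun_const[of "(\<integral>y. f y \<partial>M) * (\<integral>y. G y \<partial>M)"]]
        joint_avg_norm_le[OF f, of N] unfolding L2_norm_const by linarith
    show "(\<lambda>x. joint_avg N (\<lambda>x. c *\<^sub>R f x) x - (\<integral>y. c *\<^sub>R f y \<partial>M) * (\<integral>y. G y \<partial>M)) =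
      (\<lambda>x. c *\<^sub>R (joint_avg N f x - (\<integral>y. f y \<partial>M) * (\<integral>y. G y \<partial>M)))"
      by (simp add: joint_avg_def scaleR_diff_right scaleR_left_commute flip: scaleR_sum_right)
    assume "L2_fun M f'"
    then show "(\<lambda>x. joint_avg N (\<lambda>x. f x + f' x) x - (\<integral>y. f y + f' y \<partial>M) * (\<integral>y. G y \<partial>M)) =
      (\<lambda>x. (joint_avg N f x - (\<integral>y. f y \<partial>M) * (\<integral>y. G y \<partial>M)) + (joint_avg N f' x - (\<integral>y. f' y \<partial>M) * (\<integral>y. G y \<partial>M)))"
      using f by (simp add: fun_eq_iff joint_avg_def L2_fun_integrable distrib_right sum.distrib scaleR_add_right)
  qed
next
  fix h assume h: "L2_fun M h"
    and null: "\<And>v. L2_fun M v \<Longrightarrow>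
      (\<lambda>N. L2_norm M (\<lambda>x. joint_avg N v x - (\<integral>y. v y \<partial>M) * (\<integral>y. G y \<partial>M))) \<longlonglongrightarrow> 0 \<Longrightarrow> L2_inner M h v = 0"
  have orth: "L2_inner M h v = 0" if k: "k > 0" and v: "L2_fun M v" "AE x in M. v ((T ^^ k) x) = v x" for k v
  proof (rule null[OF v(1)])
    show "(\<lambda>N. L2_norm M (\<lambda>x. joint_avg N v x - (\<integral>y. v y \<partial>M) * (\<integral>y. G y \<partial>M))) \<longlonglongrightarrow> 0"
      using cases
    proof
      assume "totally_ergodic M T"
      then have "ergodic M (T ^^ k)" using k by (simp add: totally_ergodic_def Suc_le_eq)
      then obtain c where "AE x in M. v x = c"
        using ergodic_invariant_const[OF mpt_funpow[OF T] _ L2_fun_measurable[OF v(1)] v(2)] by blast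
      then show ?thesis by (rule joint_avg_const[OF mult_mean_ergodic[OF fg pe G_L2] v(1)])
    next
      assume "aperiodic M S"
      then show ?thesis by (rule joint_avg_periodic[OF _ erg v(1) k v(2)])
    qed
  qed
  \<comment> \<open>Pigeonhole: there are finitely many classes, and the reciprocals of all primes
    are not summable.\<close>
  have "\<exists>p0. prime p0 \<and>
    \<not> (\<lambda>p. 1 / real p) summable_on {p. prime p \<and> restrict (S p) (space M) = restrict (S p0) (space M)}"
  proof (rule ccontr)
    assume neg: "\<not> ?thesis"
    have "(\<lambda>p. 1 / real p) summable_on {p. prime p}"
    proof (rule summable_on_finite_fibres[where \<phi> = "\<lambda>p. restrict (S p) (space M)"])
      show "finite ((\<lambda>p. restrict (S p) (space M)) ` {p. prime p})" using fg by (simp only: setcompr_eq_image)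
      fix u assume "u \<in> (\<lambda>p. restrict (S p) (space M)) ` {p. prime p}"
      then show "(\<lambda>p. 1 / real p) summable_on {p \<in> {p. prime p}. restrict (S p) (space M) = u}" using neg by auto
    qed
    then show False using not_summable_on_prime_inverse by simp
  qed
  then obtain p0 where p0: "prime p0"
    "\<not> (\<lambda>p. 1 / real p) summable_on {p. prime p \<and> restrict (S p) (space M) = restrict (S p0) (space M)}" by blast
  have lim: "(\<lambda>N. L2_norm M (joint_avg N h)) \<longlonglongrightarrow> 0"
    by (rule joint_avg_katai[OF h orth _ _ p0]) (auto dest: restrict_eqD)
  define c where "c = (\<integral>y. h y \<partial>M)"
  \<comment> \<open>Constants are invariant under \<open>T\<close>; choosing the integral of
    \<open>h\<close> as the constant makes the real inner product equal to
    \<open>c \<bullet> c\<close>, so it detects \<open>c = 0\<close> in both coordinates.\<close>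
  have "L2_inner M h (\<lambda>_. c) = 0" by (rule orth[of 1]) auto
  moreover have "L2_inner M h (\<lambda>_. c) = c \<bullet> c"
    unfolding L2_inner_def c_def by (rule integral_inner_left) (rule L2_fun_integrable[OF h])
  ultimately have "c = 0" by simp
  then have "L2_inner M h h = 0" using null[OF h] lim by (simp add: c_def)
  then have "L2_norm M h = 0" using L2_norm_sq[of M h] by simp
  then show "L2_inner M F h = 0" by (rule L2_inner_null[OF F h])
qed

end

theorem corollary1p32:
  fixes M :: "'a::metric_space measure"
    and T :: "'a \<Rightarrow> 'a"
    and S :: "nat \<Rightarrow> 'a \<Rightarrow> 'a"
  assumes "regular_prob_space M"
    and "invertible_mpt M T" and "ergodic M T"
    and "multiplicative_action M S" and "finitely_generated M S"
    and "pretentiously_ergodic M S"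
    and "totally_ergodic M T \<or> aperiodic M S"
  shows "jointly_ergodic M T S"
proof -
  interpret prob_space M using assms(1) by (simp add: regular_prob_space_def)
  have "tendsto_L2 M (\<lambda>N x. (\<Sum>n=1..N. F ((T ^^ n) x) * G (S n x)) / of_nat N)
      (\<lambda>_. (\<integral>y. F y \<partial>M) * (\<integral>y. G y \<partial>M))" if F: "Linf_fun M F" and G: "Linf_fun M G" for F G
  proof -
    obtain C where C: "AE x in M. norm (G x) \<le> C" and G_meas: "G \<in> borel_measurable M"
      using G by (auto simp: Linf_fun_def)
    interpret joint_system M S T G C
      by unfold_locales (use assms C G_meas in auto)
    show ?thesis
      using joint_avg_tendsto[OF assms(5)[unfolded finitely_generated_def] assms(6,3,7) Linf_imp_L2_fun[OF F]]
      by (simp add: tendsto_L2_def joint_avg_def scaleR_conv_of_real)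
  qed
  then show ?thesis unfolding jointly_ergodic_def by blast
qed

end
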